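(* Let $m\ge 1$, let $q,\beta\in(0,1]$, put $\mu=q/\beta$ and $c=c(q,\beta)$, and let $S=(S(n))_{n\in\mathbb{Z}}$ be a $\mathrm{Ber}(q)\mathrm{Geom}(\beta)$ service process, i.e. an i.i.d. sequence of $\mathrm{Ber}(q)\mathrm{Geom}(\beta)$ random variables. Then for all $\lambda_1,\dots,\lambda_m>0$ with $\lambda_1+\dots+\lambda_m\le\mu$, the distribution $F_{m,c,\lambda_1,\dots,\lambda_m}$ is a fixed point for $S$. That is: if $\underline{A}$ is an $m$-type arrival process with distribution $F_{m,c,\lambda_1,\dots,\lambda_m}$, independent of $S$, and $\underline{D}=D(\underline{A},S)$ is the $m$-type departure process, then $\underline{D}$ has the same distribution as $\underline{A}$.
   Context: **Bernoulli-geometric distribution.** For $p,\alpha\in(0,1]$, a random variable $Y$ has distribution $\mathrm{Ber}(p)\mathrm{Geom}(\alpha)$ if $\mathbb{P}(Y=0)=1-p$ and $\mathbb{P}(Y=k)=p\alpha(1-\alpha)^{k-1}$ for $k\ge1$. Its mean is $p/\alpha$. Define $c(p,\alpha)=\frac{p}{1-p}\cdot\frac{\alpha}{1-\alpha}\in(0,\infty]$, with value $+\infty$ if $p=1$ or $\alpha=1$. For each $c\in(0,\infty]$ and each $\lambda>0$ there is exactly one pair $(p,\alpha)\in(0,1]^2$ with $p/\alpha=\lambda$ and $c(p,\alpha)=c$. **Batch queue.** Given an arrival process $A=(A(n))_{n\in\mathbb{Z}}$ and a service process $S=(S(n))_{n\in\mathbb{Z}}$ with non-negative values, define the queue length (after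 the service at time $n-1$ and before the arrival at time $n$) $$X(n)=\sup_{k\le n}\sum_{r=k}^{n-1}(A(r)-S(r))\in[0,\infty]$$ (an empty sum is $0$), the departure process $D(n)=\min(X(n)+A(n),S(n))$, written $D=D(A,S)$, and the unused service process $U(n)=S(n)-D(n)$, written $U=U(A,S)$. **Multi-type queue.** An $m$-type arrival process is $\underline{A}=(A^{=1},\dots,A^{=m})$, where $A^{=r}(n)\ge0$ is the number of $r$th-class customers arriving at time $n$ (lower class number means higher priority). Put $A^{\le r}=\sum_{i=1}^r A^{=i}$. The $m$-type departure process $D(\underline{A},S)=(D^{=1},\dots,D^{=m})$ is defined by $D^{\le r}=D(A^{\le r},S)$ for $1\le r\le m$, $D^{\le 0}=0$, and $D^{=r}=D^{\le r}-D^{\le r-1}$. The unused service is $S-D^{\le m}$. **The distributions $F_m=F_{m,c,\lambda_1,\dots,\lambda_m}$** ($c\in(0,\infty]$, $\lambda_j>0$) are defined recursively. $F_{1,c,\lambda_1}$ is the law of an i.i.d. $\mathrm{Ber}(p)\mathrm{Geom}(\alpha)$ sequence indexed by $\mathbb{Z}$, where $p/\alpha=\lambda_1$ and $c(p,\alpha)=c$. For $m\ge2$, let $\underline{A}$ have law $F_{m-1,c,\lambda_1,\dots,\lambda_{m-1}}$, and let $S_m$ be an independent i.i.d. $\mathrm{Ber}(q_m)\mathrm{Geom}(\beta_m)$ sequence with $q_m/\beta_m=\lambda_1+\dots+\lambda_m$ and $c(q_m,\beta_m)=c$. Let $(D^{=1},\dots,D^{=m-1})=D(\underline{A},S_m)$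 and $U=S_m-D^{\le m-1}$. Then $F_m$ is the law of the $m$-type process $(D^{=1},\dots,D^{=m-1},U)$; that is, unused service is replaced by customers of type $m$. *)

theory Defs
  imports "HOL-Probability.Probability"
begin

definition bergeom_pmf :: "real \<Rightarrow> real \<Rightarrow> nat pmf" where
  "bergeom_pmf p \<alpha> = embed_pmf (\<lambda>k. if k = 0 then 1 - p else p * \<alpha> * (1 - \<alpha>) ^ (k - 1))"

lemma pmf_bergeom_pmf:
  assumes "0 < p" "p \<le> 1" "0 < \<alpha>" "\<alpha> \<le> 1"
  shows "pmf (bergeom_pmf p \<alpha>) k = (if k = 0 then 1 - p else p * \<alpha> * (1 - \<alpha>) ^ (k - 1))"
  unfolding bergeom_pmf_def
proof (rule pmf_embed_pmf)
  let ?f = "\<lambda>k::nat. if k = 0 then 1 - p else p * \<alpha> * (1 - \<alpha>) ^ (k - 1)"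
  show nn: "\<And>k. 0 \<le> ?f k" using assms by simp
  have "(\<lambda>k. (1 - \<alpha>) ^ k) sums (1 / (1 - (1 - \<alpha>)))"
    using assms by (intro geometric_sums) simp
  hence "(\<lambda>k. p * \<alpha> * (1 - \<alpha>) ^ k) sums (p * \<alpha> * (1 / (1 - (1 - \<alpha>))))"
    by (rule sums_mult)
  hence "(\<lambda>k. ?f (Suc k)) sums p" using assms by simp
  hence "?f sums (p + ?f 0)" by (rule sums_Suc)
  hence s: "?f sums 1" by simp
  have "(\<integral>\<^sup>+k. ennreal (?f k) \<partial>count_space UNIV) = (\<Sum>k. ennreal (?f k))"
    by (rule nn_integral_count_space_nat)
  also have "\<dots> = ennreal (\<Sum>k. ?f k)"
    using nn s by (intro suminf_ennreal2) (auto simp: sums_iff)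
  also have "\<dots> = 1" using s by (simp add: sums_iff)
  finally show "(\<integral>\<^sup>+k. ennreal (?f k) \<partial>count_space UNIV) = 1" .
qed

definition bergeom :: "real \<Rightarrow> real \<Rightarrow> real measure" where
  "bergeom p \<alpha> = distr (measure_pmf (bergeom_pmf p \<alpha>)) borel real"

definition bg_c :: "real \<Rightarrow> real \<Rightarrow> ereal" where
  "bg_c p \<alpha> = (if p = 1 \<or> \<alpha> = 1 then \<infinity> else ereal (p / (1 - p) * (\<alpha> / (1 - \<alpha>))))"

text \<open>The parameters \<open>(p, \<alpha>)\<close> with mean \<open>l\<close> and \<open>bg_c p \<alpha> = c\<close>; they are uniquely
  determined for \<open>l > 0\<close> and \<open>c \<in> (0, \<infinity>]\<close>, see \<open>bg_params_ex1\<close> below.\<close>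

definition bg_params :: "ereal \<Rightarrow> real \<Rightarrow> real \<times> real" where
  "bg_params c l = (THE x. case x of (p, \<alpha>) \<Rightarrow>
      0 < p \<and> p \<le> 1 \<and> 0 < \<alpha> \<and> \<alpha> \<le> 1 \<and> p / \<alpha> = l \<and> bg_c p \<alpha> = c)"

lemma bg_c_strict_mono:
  assumes "0 < p" "p < p'" "p' < 1" "0 < \<alpha>" "\<alpha> < \<alpha>'" "\<alpha>' < 1"
  shows "bg_c p \<alpha> < bg_c p' \<alpha>'"
proof -
  have "p / (1 - p) < p' / (1 - p')" "\<alpha> / (1 - \<alpha>) < \<alpha>' / (1 - \<alpha>')"
    using assms by (auto intro!: frac_less)
  hence "p / (1 - p) * (\<alpha> / (1 - \<alpha>)) < p' / (1 - p') * (\<alpha>' / (1 - \<alpha>'))"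
    using assms by (intro mult_strict_mono) auto
  thus ?thesis using assms by (simp add: bg_c_def)
qed

lemma bg_params_ex1:
  assumes c: "0 < c" and l: "0 < l"
  shows "\<exists>!x. case x of (p, \<alpha>) \<Rightarrow>
    0 < p \<and> p \<le> 1 \<and> 0 < \<alpha> \<and> \<alpha> \<le> 1 \<and> p / \<alpha> = l \<and> bg_c p \<alpha> = c"
proof -
  define P where "P \<alpha> \<longleftrightarrow> 0 < \<alpha> \<and> \<alpha> \<le> 1 \<and> l * \<alpha> \<le> 1 \<and> bg_c (l * \<alpha>) \<alpha> = c" for \<alpha>
  have ex: "\<exists>\<alpha>. P \<alpha>"
  proof (cases c)
    case (real r)
    define b where "b = min 1 (1 / l)"
    have b: "0 < b" "b \<le> 1" "l * b \<le> 1" "l * b = 1 \<or> b = 1"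
      using l by (auto simp: b_def min_def field_simps)
    define f where "f x = l * x\<^sup>2 - r * ((1 - l * x) * (1 - x))" for x
    have "continuous_on {0..b} f" unfolding f_def by (intro continuous_intros)
    moreover have "f 0 \<le> 0" "0 \<le> f b" using c real b l by (auto simp: f_def)
    ultimately obtain x where x: "0 \<le> x" "x \<le> b" "f x = 0"
      using IVT'[of f 0 0 b] b by auto
    have "x \<noteq> 0" using x c real by (auto simp: f_def)
    have "x \<noteq> b" using x b l by (auto simp: f_def)
    hence "x < b" "0 < x" using x \<open>x \<noteq> 0\<close> by auto
    hence x1: "x < 1" "l * x < 1" using b l mult_strict_left_mono[of x b l] by linarith+
    have "l * x / (1 - l * x) * (x / (1 - x)) = r"
      using x(3) x1 by (simp add: f_def power2_eq_square divide_eq_eq mult.assoc)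
    hence "P x" using x1 \<open>0 < x\<close> real by (simp add: P_def bg_c_def)
    thus ?thesis ..
  next
    case PInf
    have "P (min 1 (1 / l))" using l PInf
      by (auto simp: P_def bg_c_def min_def field_simps)
    thus ?thesis ..
  next
    case MInf
    thus ?thesis using c by simp
  qed
  have less: False if "P x" "P y" "x < y" for x y
  proof -
    have "l * x < l * y" using that l by simp
    hence lt: "x < 1" "l * x < 1" using that by (auto simp: P_def)
    hence cx: "c \<noteq> \<infinity>" using that(1) by (auto simp: P_def bg_c_def)
    hence "y \<noteq> 1" "l * y \<noteq> 1" using that(2) by (auto simp: P_def bg_c_def)
    hence "y < 1" "l * y < 1" using that by (auto simp: P_def)
    hence "bg_c (l * x) x < bg_c (l * y) y"
      using that \<open>l * x < l * y\<close> l by (intro bg_c_strict_mono) (auto simp: P_def)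
    thus False using that by (simp add: P_def)
  qed
  obtain a where a: "P a" using ex ..
  show ?thesis
  proof (rule ex1I[of _ "(l * a, a)"])
    show "case (l * a, a) of (p, \<alpha>) \<Rightarrow>
      0 < p \<and> p \<le> 1 \<and> 0 < \<alpha> \<and> \<alpha> \<le> 1 \<and> p / \<alpha> = l \<and> bg_c p \<alpha> = c"
      using a l by (auto simp: P_def)
  next
    fix x assume *: "case x of (p, \<alpha>) \<Rightarrow>
      0 < p \<and> p \<le> 1 \<and> 0 < \<alpha> \<and> \<alpha> \<le> 1 \<and> p / \<alpha> = l \<and> bg_c p \<alpha> = c"
    obtain p \<alpha> where x: "x = (p, \<alpha>)" by force
    have p: "p = l * \<alpha>" using * x by auto
    hence "P \<alpha>" using * x by (simp add: P_def)
    hence "\<alpha> = a" using a less by (meson linorder_neqE)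
    thus "x = (l * a, a)" using x p by simp
  qed
qed

definition bergeom_seq :: "real \<Rightarrow> real \<Rightarrow> (int \<Rightarrow> real) measure" where
  "bergeom_seq p \<alpha> = PiM UNIV (\<lambda>_. bergeom p \<alpha>)"

definition queue_length :: "(int \<Rightarrow> real) \<Rightarrow> (int \<Rightarrow> real) \<Rightarrow> int \<Rightarrow> ereal" where
  "queue_length A S n = (SUP k\<in>{..n}. ereal (\<Sum>r=k..n-1. A r - S r))"

text \<open>The minimum is always finite: \<open>queue_length A S n \<ge> 0\<close> and \<open>S n\<close> is real.\<close>

definition departure :: "(int \<Rightarrow> real) \<Rightarrow> (int \<Rightarrow> real) \<Rightarrow> int \<Rightarrow> real" where
  "departure A S n = real_of_ereal (min (queue_length A S n + ereal (A n)) (ereal (S n)))"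

text \<open>An \<open>m\<close>-type process is a function \<open>A :: nat \<Rightarrow> int \<Rightarrow> real\<close>, with \<open>A r n\<close> the number of
  customers of class \<open>r \<in> {1..m}\<close> at time \<open>n\<close>; outside \<open>{1..m}\<close> it is \<open>undefined\<close>, as in all
  product spaces \<open>PiM\<close>.\<close>

definition proc_space :: "(int \<Rightarrow> real) measure" where
  "proc_space = PiM UNIV (\<lambda>_. borel)"

definition mproc_space :: "nat \<Rightarrow> (nat \<Rightarrow> int \<Rightarrow> real) measure" where
  "mproc_space m = PiM {1..m} (\<lambda>_. proc_space)"

definition upto_class :: "(nat \<Rightarrow> int \<Rightarrow> real) \<Rightarrow> nat \<Rightarrow> int \<Rightarrow> real" where
  "upto_class A r n = (\<Sum>i=1..r. A i n)"

definition departure_upto :: "(nat \<Rightarrow> int \<Rightarrow> real) \<Rightarrow> (int \<Rightarrow> real) \<Rightarrow> nat \<Rightarrow> int \<Rightarrow> real" where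
  "departure_upto A S r n = (if r = 0 then 0 else departure (upto_class A r) S n)"

definition mdeparture ::
  "nat \<Rightarrow> (nat \<Rightarrow> int \<Rightarrow> real) \<Rightarrow> (int \<Rightarrow> real) \<Rightarrow> nat \<Rightarrow> int \<Rightarrow> real" where
  "mdeparture m A S = (\<lambda>r\<in>{1..m}. \<lambda>n. departure_upto A S r n - departure_upto A S (r - 1) n)"

definition munused :: "nat \<Rightarrow> (nat \<Rightarrow> int \<Rightarrow> real) \<Rightarrow> (int \<Rightarrow> real) \<Rightarrow> int \<Rightarrow> real" where
  "munused m A S n = S n - departure_upto A S m n"

text \<open>Only the values \<open>lam 1, \<dots>, lam m\<close> enter \<open>F m c lam\<close>. The case \<open>m = 0\<close> is a dummy that
  is not used by the other equations.\<close>

fun F :: "nat \<Rightarrow> ereal \<Rightarrow> (nat \<Rightarrow> real) \<Rightarrow> (nat \<Rightarrow> int \<Rightarrow> real) measure" where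
  "F 0 c lam = null_measure (mproc_space 0)"
| "F (Suc 0) c lam =
    (case bg_params c (lam 1) of (p, \<alpha>) \<Rightarrow>
      distr (bergeom_seq p \<alpha>) (mproc_space 1) (\<lambda>Y. \<lambda>r\<in>{1..1}. Y))"
| "F (Suc (Suc k)) c lam =
    (case bg_params c (\<Sum>i=1..k+2. lam i) of (q, \<beta>) \<Rightarrow>
      distr (F (Suc k) c lam \<Otimes>\<^sub>M bergeom_seq q \<beta>) (mproc_space (k + 2))
        (\<lambda>(A, S). (mdeparture (k + 1) A S)(k + 2 := munused (k + 1) A S)))"

lemma sets_bergeom_seq [measurable_cong]: "sets (bergeom_seq p \<alpha>) = sets proc_space"
  unfolding bergeom_seq_def proc_space_def by (intro sets_PiM_cong) (auto simp: bergeom_def)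

lemma sets_F [measurable_cong]: "sets (F m c lam) = sets (mproc_space m)"
  by (induction m c lam rule: F.induct) (auto simp: split_beta numeral_2_eq_2)

text \<open>The maps in the definition of \<open>F\<close> are measurable, so that the image measures above are
  the intended ones.\<close>

lemma measurable_departure:
  assumes "\<And>n. (\<lambda>x. A x n) \<in> borel_measurable N" "\<And>n. (\<lambda>x. S x n) \<in> borel_measurable N"
  shows "(\<lambda>x. departure (A x) (S x) n) \<in> borel_measurable N"
  unfolding departure_def queue_length_def using assms by measurable

lemma measurable_departure_upto:
  assumes A: "A \<in> measurable N (mproc_space m)" and S: "S \<in> measurable N proc_space"
    and r: "r \<le> m"
  shows "(\<lambda>x. departure_upto (A x) (S x) r n) \<in> borel_measurable N"
proof -
  have "(\<lambda>x. S x k) \<in> borel_measurable N" for k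
    using S unfolding proc_space_def by measurable
  moreover have "(\<lambda>x. A x i k) \<in> borel_measurable N" if "i \<in> {1..m}" for i k
  proof -
    have "(\<lambda>x. A x i) \<in> measurable N proc_space"
      using A that unfolding mproc_space_def by measurable
    thus ?thesis unfolding proc_space_def by measurable
  qed
  ultimately show ?thesis using r
    unfolding departure_upto_def upto_class_def
    by (cases "r = 0") (auto intro!: measurable_departure borel_measurable_sum)
qed

lemma measurable_mdeparture:
  assumes "A \<in> measurable N (mproc_space m)" and "S \<in> measurable N proc_space"
  shows "(\<lambda>x. mdeparture m (A x) (S x)) \<in> measurable N (mproc_space m)"
  unfolding mdeparture_def mproc_space_def
proof (rule measurable_restrict)
  fix r assume r: "r \<in> {1..m}"
  show "(\<lambda>x n. departure_upto (A x) (S x) r n - departure_upto (A x) (S x) (r - 1) n)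
    \<in> measurable N proc_space"
    unfolding proc_space_def
    by (rule measurable_PiM_single')
       (use assms r in \<open>auto intro!: borel_measurable_diff measurable_departure_upto\<close>)
qed

lemma measurable_munused:
  assumes "A \<in> measurable N (mproc_space m)" and S: "S \<in> measurable N proc_space"
  shows "(\<lambda>x. munused m (A x) (S x)) \<in> measurable N proc_space"
proof -
  have "(\<lambda>x. S x k) \<in> borel_measurable N" for k
    using S unfolding proc_space_def by measurable
  hence "(\<lambda>x. munused m (A x) (S x) k) \<in> borel_measurable N" for k
    unfolding munused_def
    by (intro borel_measurable_diff measurable_departure_upto[OF assms]) auto
  thus ?thesis unfolding proc_space_def by (intro measurable_PiM_single') auto
qed

lemma measurable_F_step:
  "(\<lambda>(A, S). (mdeparture m A S)(m + 1 := munused m A S))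
    \<in> measurable (mproc_space m \<Otimes>\<^sub>M proc_space) (mproc_space (m + 1))"
proof -
  have *: "insert (m + 1) {1..m} = {1..m + 1}" by auto
  have "(\<lambda>x. (mdeparture m (fst x) (snd x))(m + 1 := munused m (fst x) (snd x)))
    \<in> measurable (mproc_space m \<Otimes>\<^sub>M proc_space) (PiM (insert (m + 1) {1..m}) (\<lambda>_. proc_space))"
    by (rule measurable_fun_upd[where J = "{1..m}"])
       (use measurable_mdeparture[of fst _ m snd] measurable_munused[of fst _ m snd] in
         \<open>auto simp: mproc_space_def\<close>)
  thus ?thesis unfolding * split_beta' mproc_space_def .
qed

lemma prob_space_bergeom_seq: "prob_space (bergeom_seq p \<alpha>)"
  unfolding bergeom_seq_def bergeom_def
  by (intro prob_space_PiM prob_space.prob_space_distr prob_space_measure_pmf) simp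

lemma prob_space_F: "prob_space (F (Suc k) c lam)"
proof (induction k)
  case 0
  have "(\<lambda>Y. \<lambda>r\<in>{1..1}. Y) \<in> measurable (bergeom_seq p \<alpha>) (mproc_space 1)" for p \<alpha>
    unfolding mproc_space_def by (intro measurable_restrict) measurable
  thus ?case
    by (auto simp: split_beta intro!: prob_space.prob_space_distr[OF prob_space_bergeom_seq])
next
  case (Suc k)
  have "prob_space (F (Suc k) c lam \<Otimes>\<^sub>M bergeom_seq q \<beta>)" for q \<beta>
    by (intro prob_space_pair Suc prob_space_bergeom_seq)
  moreover have "(\<lambda>(A, S). (mdeparture (k + 1) A S)(k + 2 := munused (k + 1) A S))
      \<in> measurable (F (Suc k) c lam \<Otimes>\<^sub>M bergeom_seq q \<beta>) (mproc_space (k + 2))" for q \<beta>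
    using measurable_F_step[of "k + 1"]
    by (simp add: sets_F sets_bergeom_seq cong: measurable_cong_sets sets_pair_measure_cong)
  ultimately show ?case
    unfolding F.simps split_beta by (intro prob_space.prob_space_distr) auto
qed

text \<open>The library's \<open>indep_var\<close> requires both random elements to take values in the same type;
  this is its characterization \<open>indep_var_eq\<close> for two different types.\<close>

definition indep_elements ::
  "'a measure \<Rightarrow> 'b measure \<Rightarrow> ('a \<Rightarrow> 'b) \<Rightarrow> 'c measure \<Rightarrow> ('a \<Rightarrow> 'c) \<Rightarrow> bool" where
  "indep_elements M N X N' Y \<longleftrightarrow>
     X \<in> measurable M N \<and> Y \<in> measurable M N' \<and>
     prob_space.indep_set M
       (sigma_sets (space M) {X -` B \<inter> space M | B. B \<in> sets N})
       (sigma_sets (space M) {Y -` B \<inter> space M | B. B \<in> sets N'})"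

lemma indep_elements_iff_indep_var:
  "prob_space M \<Longrightarrow> indep_elements M N X N' Y \<longleftrightarrow> prob_space.indep_var M N X N' Y"
  by (simp add: indep_elements_def prob_space.indep_var_eq conj_assoc)

end

theory Submission imports Defs begin

text \<open>
  The key is a pathwise interchange identity for two servers \<open>S\<close>, \<open>T\<close> in tandem:
  \<open>D(D(A, S), T) = D(D(A, R), D(S, T))\<close> for all \<open>A\<close>, whenever \<open>R \<ge> S\<close> and \<open>R(n) = S(n)\<close> at all
  times at which the queue with arrivals \<open>S\<close> and services \<open>T\<close> is not empty. If \<open>S\<close> and \<open>T\<close> are
  Bernoulli-geometric with the same \<open>c\<close>, that queue is reversible, and the services \<open>R\<close> of the
  reversed queue, built with independent extra randomness, satisfy the condition. By reversibility
  (Burke's theorem) \<open>(D(S, T), R)\<close> has the law of \<open>(S, T)\<close>. At equal intensities the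
  queue never empties (or nothing is random) and \<open>R = S\<close> does the job.

  Now \<open>F m\<close> is the output of a server \<open>S\<close> fed with \<open>F (m - 1)\<close>, with the unused services as
  class \<open>m\<close>. Sending it through \<open>T\<close> amounts, by the interchange identity, to sending
  \<open>F (m - 1)\<close> first through \<open>R\<close>, where it is a fixed point by induction, and then through
  \<open>D(S, T)\<close>, which is distributed like \<open>S\<close>.
\<close>

section \<open>Pathwise queues and the interchange identity\<close>

text \<open>Why \<open>R\<close> has this form: read backwards in time, the customers that arrive
  are those that leave. The reversed server therefore offers at least the arrivals \<open>S\<close>,
  and more only when it empties the reversed queue, that is, when the forward queue is empty before
  the arrival. The surplus is not recorded by \<open>S\<close> and \<open>T\<close>, hence the extra
  randomness. Equality of \<open>c\<close> enters as detailed balance for a single time slot. Two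
  obstacles shape the rest. Time has no beginning, so stationarity cannot be imposed as an initial
  condition: runs from the stationary law are compared with queues that start empty in the distant
  past, by a coupling whose failure probability decays exponentially. The interchange identity is an
  identity between the total contents of two tandems. It is proved for finite queues and extended by
  monotone limits, because the queues fed by \<open>A\<close> may be infinite.\<close>

text \<open>Demands that the supremum in \<open>queue_length\<close> is attained at every time. This
  gives explicit starting times, from which the tandem formulas below are built.\<close>

definition queue_solution :: "(int \<Rightarrow> real) \<Rightarrow> (int \<Rightarrow> real) \<Rightarrow> (int \<Rightarrow> real) \<Rightarrow> bool" where
  "queue_solution A S X \<longleftrightarrow> (\<forall>n. (\<forall>i\<le>n. (\<Sum>r=i..<n. A r - S r) \<le> X n) \<and>
     (\<exists>i\<le>n. X n = (\<Sum>r=i..<n. A r - S r)))"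

lemma sum_int_split:
  fixes f :: "int \<Rightarrow> real"
  assumes "i \<le> j" "j \<le> n"
  shows "sum f {i..<n} = sum f {i..<j} + sum f {j..<n}"
proof -
  have "{i..<n} = {i..<j} \<union> {j..<n}" using assms by auto
  thus ?thesis by (simp add: sum.union_disjoint ivl_disj_int)
qed

lemma sum_int_Suc:
  fixes f :: "int \<Rightarrow> real"
  assumes "i \<le> n"
  shows "sum f {i..<n+1} = sum f {i..<n} + f n"
proof -
  have "{n..<n+1} = {n}" by auto
  thus ?thesis using sum_int_split[of i n "n+1" f] assms by simp
qed

lemma queue_length_altdef:
  "queue_length A S n = (SUP k\<in>{..n}. ereal (\<Sum>r=k..<n. A r - S r))"
proof -
  have "{k..n-1} = {k..<n}" for k :: int by auto
  thus ?thesis unfolding queue_length_def by simp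
qed

lemma queue_length_nonneg: "0 \<le> queue_length A S n"
  unfolding queue_length_altdef by (rule SUP_upper2[of n]) auto

lemma queue_length_solution:
  assumes "queue_solution A S X"
  shows "queue_length A S n = ereal (X n)"
  unfolding queue_length_altdef
proof (rule antisym)
  show "(SUP k\<in>{..n}. ereal (\<Sum>r=k..<n. A r - S r)) \<le> ereal (X n)"
    using assms by (intro SUP_least) (auto simp: queue_solution_def)
  obtain i where "i \<le> n" "X n = (\<Sum>r=i..<n. A r - S r)"
    using assms by (auto simp: queue_solution_def)
  thus "ereal (X n) \<le> (SUP k\<in>{..n}. ereal (\<Sum>r=k..<n. A r - S r))"
    by (intro SUP_upper2[of i]) auto
qed

lemma departure_solution:
  assumes "queue_solution A S X"
  shows "departure A S n = min (X n + A n) (S n)"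
  unfolding departure_def queue_length_solution[OF assms] by (simp add: min_def)

lemma queue_solution_nonneg: "queue_solution A S X \<Longrightarrow> 0 \<le> X n"
  by (auto simp: queue_solution_def dest!: spec[of _ n] spec[of "\<lambda>i. i \<le> n \<longrightarrow> _ i" n])

lemma queue_solution_step:
  assumes "queue_solution A S X"
  shows "X (n + 1) = max 0 (X n + A n - S n)"
proof (rule antisym)
  obtain i where i: "i \<le> n + 1" "X (n+1) = (\<Sum>r=i..<n+1. A r - S r)"
    using assms by (auto simp: queue_solution_def)
  show "X (n + 1) \<le> max 0 (X n + A n - S n)"
  proof (cases "i = n + 1")
    case False
    hence "i \<le> n" using i by simp
    moreover from this have "(\<Sum>r=i..<n. A r - S r) \<le> X n"
      using assms by (auto simp: queue_solution_def)
    ultimately show ?thesis using i by (simp add: sum_int_Suc)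
  qed (use i in auto)
  obtain j where j: "j \<le> n" "X n = (\<Sum>r=j..<n. A r - S r)"
    using assms by (auto simp: queue_solution_def)
  have "(\<Sum>r=j..<n+1. A r - S r) \<le> X (n+1)"
    using assms j by (auto simp: queue_solution_def)
  thus "max 0 (X n + A n - S n) \<le> X (n + 1)"
    using queue_solution_nonneg[OF assms, of "n+1"] j by (simp add: sum_int_Suc)
qed

lemma departure_conservation:
  assumes "queue_solution A S X"
  shows "departure A S n = A n + X n - X (n + 1)"
  unfolding departure_solution[OF assms] queue_solution_step[OF assms] by auto

lemma departure_sum:
  assumes "queue_solution A S X" "i \<le> n"
  shows "(\<Sum>r=i..<n. departure A S r) = (\<Sum>r=i..<n. A r) + X i - X n"
  using assms(2)
proof (induction n rule: int_ge_induct)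
  case (step n)
  thus ?case by (simp add: sum_int_Suc departure_conservation[OF assms(1)])
qed simp

text \<open>The queue is empty up to time \<open>N\<close>, so that the supremum over all starting times is a
  maximum over finitely many of them.\<close>

lemma ex_queue_solution:
  assumes "\<And>n. n < N \<Longrightarrow> A n \<le> S n"
  shows "\<exists>X. queue_solution A S X"
proof -
  define w where "w i n = (\<Sum>r=i..<n. A r - S r)" for i n
  define X where "X n = Max ((\<lambda>i. w i n) ` {min N n..n})" for n
  have fin: "finite ((\<lambda>i. w i n) ` {min N n..n})" "(\<lambda>i. w i n) ` {min N n..n} \<noteq> {}" for n by auto
  have ub: "w i n \<le> X n" if "i \<le> n" for i n
  proof (cases "i < min N n")
    case True
    have "w i n = w i (min N n) + w (min N n) n"
      unfolding w_def using True by (intro sum_int_split) auto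
    moreover have "w i (min N n) \<le> 0"
      unfolding w_def using assms by (intro sum_nonpos) auto
    moreover have "w (min N n) n \<le> X n"
      unfolding X_def using fin[of n] by (intro Max_ge) auto
    ultimately show ?thesis by simp
  next
    case False
    thus ?thesis unfolding X_def using fin[of n] that by (intro Max_ge) auto
  qed
  have "\<exists>i\<le>n. X n = w i n" for n
  proof -
    have "X n \<in> (\<lambda>i. w i n) ` {min N n..n}" unfolding X_def by (rule Max_in[OF fin])
    thus ?thesis by auto
  qed
  thus ?thesis using ub unfolding queue_solution_def w_def by blast
qed

text \<open>With \<open>tandem_queue_attained\<close> this is a last-passage formula: the total
  content of the tandem is the maximum over \<open>i \<le> j \<le> n\<close> of
  \<open>A[i,n) - S[i,j) - T[j,n)\<close>. The servers thus enter only through the minimum over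
  \<open>j\<close> of \<open>S[i,j) + T[j,n)\<close>.\<close>

lemma tandem_queue_upper:
  assumes X: "queue_solution A S X" and Y: "queue_solution (departure A S) T Y"
    and "i \<le> j" "j \<le> n"
  shows "(\<Sum>r=i..<n. A r) - (\<Sum>r=i..<j. S r) - (\<Sum>r=j..<n. T r) \<le> X n + Y n"
proof -
  have "(\<Sum>r=j..<n. departure A S r - T r) \<le> Y n"
    using Y assms by (auto simp: queue_solution_def)
  moreover have "(\<Sum>r=i..<j. A r - S r) \<le> X j"
    using X assms by (auto simp: queue_solution_def)
  ultimately show ?thesis
    using assms sum_int_split[of i j n A]
    by (simp add: sum_subtractf departure_sum[OF X])
qed

lemma tandem_queue_attained:
  assumes X: "queue_solution A S X" and Y: "queue_solution (departure A S) T Y"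
  shows "\<exists>i j. i \<le> j \<and> j \<le> n \<and>
    X n + Y n = (\<Sum>r=i..<n. A r) - (\<Sum>r=i..<j. S r) - (\<Sum>r=j..<n. T r)"
proof -
  obtain j where j: "j \<le> n" "Y n = (\<Sum>r=j..<n. departure A S r - T r)"
    using Y by (auto simp: queue_solution_def)
  obtain i where i: "i \<le> j" "X j = (\<Sum>r=i..<j. A r - S r)"
    using X by (auto simp: queue_solution_def)
  show ?thesis
    using i j sum_int_split[of i j n A]
    by (intro exI[of _ i] exI[of _ j]) (simp add: sum_subtractf departure_sum[OF X])
qed

text \<open>Together, \<open>passage_ge\<close> and \<open>passage_le\<close> say that the passage times \<open>min\<^sub>j (S[i,j) + T[j,n))\<close> do not change when \<open>(S, T)\<close>
  is replaced by \<open>(R, D(S, T))\<close>.\<close>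

lemma passage_ge:
  assumes X: "queue_solution S T X" and R: "\<And>n. S n \<le> R n" and "i \<le> j" "j \<le> n"
  shows "\<exists>k. i \<le> k \<and> k \<le> n \<and> (\<Sum>r=i..<k. S r) + (\<Sum>r=k..<n. T r)
     \<le> (\<Sum>r=i..<j. R r) + (\<Sum>r=j..<n. departure S T r)"
proof -
  obtain k where k: "k \<le> n" "X n = (\<Sum>r=k..<n. S r - T r)"
    using X by (auto simp: queue_solution_def)
  have RS: "(\<Sum>r=i..<j. S r) \<le> (\<Sum>r=i..<j. R r)" using R by (intro sum_mono)
  \<comment> \<open>\<open>k\<close> starts the maximal sum for \<open>X n\<close>. If
    \<open>k \<ge> j\<close>, then \<open>D[j,n) = X j + S[j,k) + T[k,n)\<close>, so
    \<open>k\<close> is the witness; if \<open>k < j\<close>, the bound on \<open>X j\<close> gives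
    \<open>D[j,n) \<ge> T[j,n)\<close>, and \<open>j\<close> is the witness.\<close>
  show ?thesis
  proof (cases "k \<ge> j")
    case True
    thus ?thesis
      using assms k RS queue_solution_nonneg[OF X, of j]
        sum_int_split[of i j k S] sum_int_split[of j k n S]
      by (intro exI[of _ k]) (simp add: departure_sum[OF X] sum_subtractf)
  next
    case False
    hence "(\<Sum>r=k..<j. S r - T r) \<le> X j" using X by (auto simp: queue_solution_def)
    thus ?thesis
      using assms k RS False sum_int_split[of k j n "\<lambda>r. S r - T r"]
      by (intro exI[of _ j]) (simp add: departure_sum[OF X] sum_subtractf)
  qed
qed

lemma ex_first_int:
  fixes P :: "int \<Rightarrow> bool"
  assumes "i \<le> j" "P j"
  shows "\<exists>t. i \<le> t \<and> t \<le> j \<and> P t \<and> (\<forall>s. i \<le> s \<longrightarrow> s < t \<longrightarrow> \<not> P s)"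
proof -
  define k where "k = (LEAST k::nat. P (i + int k))"
  have ex: "P (i + int (nat (j - i)))" using assms by simp
  have P: "P (i + int k)" unfolding k_def by (rule LeastI) (rule ex)
  have "k \<le> nat (j - i)" unfolding k_def by (rule Least_le) (rule ex)
  moreover have "\<not> P s" if "i \<le> s" "s < i + int k" for s
  proof -
    have "nat (s - i) < k" using that by auto
    hence "\<not> P (i + int (nat (s - i)))" unfolding k_def by (rule not_less_Least)
    thus ?thesis using that by simp
  qed
  ultimately show ?thesis using P assms by (intro exI[of _ "i + int k"]) auto
qed

text \<open>The witness is the first time \<open>t\<close> in \<open>[i,j]\<close> with an empty
  queue. Before \<open>t\<close> the services \<open>R\<close> and \<open>S\<close> agree, and from
  \<open>t\<close> on the departures are \<open>S[t,n) - X n\<close>, which is at most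
  \<open>S[t,j) + T[j,n)\<close>. Without such a time, \<open>R\<close> and \<open>S\<close> agree
  on \<open>[i,j)\<close> and departures never exceed \<open>T\<close>.\<close>

lemma passage_le:
  assumes X: "queue_solution S T X" and R: "\<And>n. 0 < X n \<Longrightarrow> R n = S n" and "i \<le> j" "j \<le> n"
  shows "\<exists>k. i \<le> k \<and> k \<le> n \<and> (\<Sum>r=i..<k. R r) + (\<Sum>r=k..<n. departure S T r)
    \<le> (\<Sum>r=i..<j. S r) + (\<Sum>r=j..<n. T r)"
proof -
  have RS: "(\<Sum>r=i..<k. R r) = (\<Sum>r=i..<k. S r)" if "\<And>s. i \<le> s \<Longrightarrow> s < k \<Longrightarrow> X s \<noteq> 0" for k
    using R that queue_solution_nonneg[OF X] by (intro sum.cong) (auto simp: less_le)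
  show ?thesis
  proof (cases "\<exists>t. i \<le> t \<and> t \<le> j \<and> X t = 0")
    case True
    then obtain t0 where "i \<le> t0" "t0 \<le> j" "X t0 = 0" by blast
    with ex_first_int[of i t0 "\<lambda>t. X t = 0"]
    obtain t where t: "i \<le> t" "t \<le> j" "X t = 0" "\<And>s. i \<le> s \<Longrightarrow> s < t \<Longrightarrow> X s \<noteq> 0"
      by (metis order_trans)
    have "(\<Sum>r=j..<n. S r - T r) \<le> X n"
      using X assms by (auto simp: queue_solution_def)
    thus ?thesis
      using t assms RS[of t] sum_int_split[of t j n S] sum_int_split[of i t j S]
      by (intro exI[of _ t]) (simp add: departure_sum[OF X] sum_subtractf)
  next
    case False
    have "(\<Sum>r=j..<n. departure S T r) \<le> (\<Sum>r=j..<n. T r)"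
      by (intro sum_mono) (simp add: departure_solution[OF X])
    thus ?thesis using False assms RS[of j] by (intro exI[of _ j]) auto
  qed
qed

text \<open>By the passage times both tandems have the same total content at all times. By
  conservation, the final output is the arrivals minus the increment of this content.\<close>

lemma interchange_finite:
  assumes Q: "queue_solution S T Q" and R: "\<And>n. S n \<le> R n" "\<And>n. 0 < Q n \<Longrightarrow> R n = S n"
    and X: "queue_solution A S X" and Y: "queue_solution (departure A S) T Y"
    and X': "queue_solution A R X'"
    and Y': "queue_solution (departure A R) (departure S T) Y'"
  shows "departure (departure A S) T n = departure (departure A R) (departure S T) n"
proof -
  have eq: "X n + Y n = X' n + Y' n" for n
  proof (rule antisym)
    obtain i j where ij: "i \<le> j" "j \<le> n"
      "X n + Y n = (\<Sum>r=i..<n. A r) - (\<Sum>r=i..<j. S r) - (\<Sum>r=j..<n. T r)"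
      using tandem_queue_attained[OF X Y] by blast
    show "X n + Y n \<le> X' n + Y' n"
      using passage_le[OF Q R(2) ij(1,2)] tandem_queue_upper[OF X' Y'] ij by fastforce
  next
    obtain i j where ij: "i \<le> j" "j \<le> n"
      "X' n + Y' n = (\<Sum>r=i..<n. A r) - (\<Sum>r=i..<j. R r) - (\<Sum>r=j..<n. departure S T r)"
      using tandem_queue_attained[OF X' Y'] by blast
    show "X' n + Y' n \<le> X n + Y n"
      using passage_ge[OF Q R(1) ij(1,2)] tandem_queue_upper[OF X Y] ij by fastforce
  qed
  show ?thesis
    using eq[of n] eq[of "n+1"]
    by (simp add: departure_conservation[OF Y] departure_conservation[OF Y']
        departure_conservation[OF X] departure_conservation[OF X'])
qed

section \<open>Monotone approximation of the arrivals\<close>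

lemma queue_length_mono:
  assumes "\<And>n. A n \<le> B n"
  shows "queue_length A S n \<le> queue_length B S n"
  unfolding queue_length_altdef
  by (intro SUP_mono' ) (auto intro!: sum_mono assms)

lemma ereal_departure:
  "ereal (departure A S n) = min (queue_length A S n + ereal (A n)) (ereal (S n))"
  using queue_length_nonneg[of A S n]
  unfolding departure_def
  by (cases "queue_length A S n") (auto simp: min_def)

lemma departure_mono:
  assumes "\<And>n. A n \<le> B n"
  shows "departure A S n \<le> departure B S n"
proof -
  have "ereal (departure A S n) \<le> ereal (departure B S n)"
    unfolding ereal_departure using queue_length_mono[OF assms, where S=S and n=n] assms[of n]
    by (intro min.mono add_mono) auto
  thus ?thesis by simp
qed

text \<open>An increasing limit is a supremum and can be interchanged with the supremum over
  starting times. Infinite queue lengths are included.\<close>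

lemma queue_length_tendsto:
  assumes inc: "\<And>n. incseq (\<lambda>N. A N n)" and lim: "\<And>n. (\<lambda>N. A N n) \<longlonglongrightarrow> B n"
  shows "(\<lambda>N. queue_length (A N) S n) \<longlonglongrightarrow> queue_length B S n"
proof -
  have SUP: "(SUP N. ereal (\<Sum>r=k..<n. A N r - S r)) = ereal (\<Sum>r=k..<n. B r - S r)" for k
  proof (rule LIMSEQ_unique[OF LIMSEQ_SUP])
    show "incseq (\<lambda>N. ereal (\<Sum>r=k..<n. A N r - S r))"
      using inc by (auto simp: incseq_def intro!: sum_mono diff_mono)
    show "(\<lambda>N. ereal (\<Sum>r=k..<n. A N r - S r)) \<longlonglongrightarrow> ereal (\<Sum>r=k..<n. B r - S r)"
      using lim by (intro tendsto_intros) 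
  qed
  have "(SUP N. queue_length (A N) S n) = queue_length B S n"
    unfolding queue_length_altdef by (subst SUP_commute) (simp add: SUP)
  moreover have "incseq (\<lambda>N. queue_length (A N) S n)"
    using inc by (auto simp: incseq_def intro!: queue_length_mono)
  ultimately show ?thesis using LIMSEQ_SUP by metis
qed

lemma departure_tendsto:
  assumes inc: "\<And>n. incseq (\<lambda>N. A N n)" and lim: "\<And>n. (\<lambda>N. A N n) \<longlonglongrightarrow> B n"
  shows "(\<lambda>N. departure (A N) S n) \<longlonglongrightarrow> departure B S n"
proof -
  have "(\<lambda>N. ereal (departure (A N) S n)) \<longlonglongrightarrow> ereal (departure B S n)"
    unfolding ereal_departure
    using queue_length_tendsto[OF assms] lim
    by (intro tendsto_min tendsto_add_ereal_general tendsto_intros) auto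
  thus ?thesis by simp
qed

theorem departure_interchange:
  assumes Q: "queue_solution S T Q" and R: "\<And>n. S n \<le> R n" "\<And>n. 0 < Q n \<Longrightarrow> R n = S n"
  shows "departure (departure A S) T n = departure (departure A R) (departure S T) n"
proof -
  \<comment> \<open>Lowering \<open>A\<close> below all processes involved before time \<open>- N\<close> makes all queues finite.\<close>
  define AN where "AN N n = (if n < - int N
     then Min {A n, S n, T n, R n, departure S T n} else A n)" for N n
  have eq: "departure (departure (AN N) S) T n = departure (departure (AN N) R) (departure S T) n" for N n
  proof -
    \<comment> \<open>While the arrivals stay below the services nothing accumulates, so the output
      is again at most \<open>AN N\<close>. Hence the second queue of each tandem is empty before
      \<open>- N\<close> as well.\<close>
    have dep: "departure (AN N) U k \<le> AN N k" if k: "k < - int N" and U: "\<And>n. n < - int N \<Longrightarrow> AN N n \<le> U n" for U k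
    proof -
      have "queue_length (AN N) U k \<le> 0"
        unfolding queue_length_altdef using U k by (intro SUP_least) (auto intro!: sum_nonpos)
      hence "queue_length (AN N) U k = 0" using queue_length_nonneg antisym by blast
      thus ?thesis by (simp add: departure_def min_def)
    qed
    have S: "AN N k \<le> S k" and T: "AN N k \<le> T k" and R': "AN N k \<le> R k"
      and D: "AN N k \<le> departure S T k" if "k < - int N" for k
      using that by (auto simp: AN_def)
    obtain X where X: "queue_solution (AN N) S X"
      using ex_queue_solution[of "- int N" "AN N" S] S by blast
    obtain Y where Y: "queue_solution (departure (AN N) S) T Y"
      using ex_queue_solution[of "- int N" "departure (AN N) S" T] dep[of _ S] S T order_trans by blast
    obtain X' where X': "queue_solution (AN N) R X'"
      using ex_queue_solution[of "- int N" "AN N" R] R' by blast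
    obtain Y' where Y': "queue_solution (departure (AN N) R) (departure S T) Y'"
      using ex_queue_solution[of "- int N" "departure (AN N) R" "departure S T"] dep[of _ R] R' D order_trans by blast
    show ?thesis by (rule interchange_finite[OF Q R X Y X' Y'])
  qed
  have inc: "incseq (\<lambda>N. AN N k)" for k
    by (auto simp: incseq_def AN_def)
  have lim: "(\<lambda>N. AN N k) \<longlonglongrightarrow> A k" for k
  proof (rule tendsto_eventually)
    show "\<forall>\<^sub>F N in sequentially. AN N k = A k"
      using eventually_ge_at_top[of "nat (- k)"] by eventually_elim (auto simp: AN_def)
  qed
  have inc2: "incseq (\<lambda>N. departure (AN N) U k)" for U k
    using inc by (auto simp: incseq_def intro!: departure_mono)
  have "(\<lambda>N. departure (departure (AN N) S) T n) \<longlonglongrightarrow> departure (departure A S) T n"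
    by (intro departure_tendsto inc2 inc lim)
  moreover have "(\<lambda>N. departure (departure (AN N) S) T n) \<longlonglongrightarrow> departure (departure A R) (departure S T) n"
    unfolding eq by (intro departure_tendsto inc2 inc lim)
  ultimately show ?thesis by (rule LIMSEQ_unique)
qed

section \<open>One time slot of the stationary queue\<close>

locale bergeom_pair =
  fixes p \<alpha> q \<beta> :: real
  assumes p: "0 < p" "p \<le> 1" and \<alpha>: "0 < \<alpha>" "\<alpha> \<le> 1"
    and q: "0 < q" "q \<le> 1" and \<beta>: "0 < \<beta>" "\<beta> \<le> 1"
    and c_eq: "bg_c p \<alpha> = bg_c q \<beta>"
begin

abbreviation "arr \<equiv> bergeom_pmf p \<alpha>"
abbreviation "srv \<equiv> bergeom_pmf q \<beta>"

text \<open>One time slot carries the arrivals, the services and two auxiliary variables, from which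
  the service process of the time-reversed queue is built.\<close>

definition noise :: "(nat \<times> nat \<times> nat \<times> nat) pmf" where
  "noise = pair_pmf arr (pair_pmf srv (pair_pmf srv (geometric_pmf \<beta>)))"

lemmas pmf_arr = pmf_bergeom_pmf[OF p \<alpha>]
lemmas pmf_srv = pmf_bergeom_pmf[OF q \<beta>]

text \<open>Equality of \<open>c\<close> with denominators cleared; in the case
  \<open>c = \<infinity>\<close> both sides vanish.\<close>

lemma c_rel: "p * \<alpha> * (1 - q) * (1 - \<beta>) = q * \<beta> * (1 - p) * (1 - \<alpha>)"
proof (cases "p = 1 \<or> \<alpha> = 1")
  case True
  hence "q = 1 \<or> \<beta> = 1" using c_eq by (auto simp: bg_c_def split: if_splits)
  thus ?thesis using True by auto
next
  case False
  hence ne: "1 - p \<noteq> 0" "1 - \<alpha> \<noteq> 0" "1 - q \<noteq> 0" "1 - \<beta> \<noteq> 0"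
    using c_eq by (auto simp: bg_c_def split: if_splits)
  hence "p / (1 - p) * (\<alpha> / (1 - \<alpha>)) = q / (1 - q) * (\<beta> / (1 - \<beta>))"
    using c_eq by (auto simp: bg_c_def split: if_splits)
  thus ?thesis using ne by (simp add: frac_eq_eq)
qed

end

text \<open>The state is the queue length before the arrival. The output is the departure together
  with the service of the reversed queue, which differs from the arrival only if the state is \<open>0\<close>.\<close>

fun queue_step :: "nat \<Rightarrow> nat \<times> nat \<times> nat \<times> nat \<Rightarrow> nat" where
  "queue_step x (a, s, v) = x + a - s"

fun queue_out :: "nat \<Rightarrow> nat \<times> nat \<times> nat \<times> nat \<Rightarrow> nat \<times> nat" where
  "queue_out x (a, s, v0, v1) =
     (min (x + a) s, if 0 < x then a else if 0 < a then a + v1 else v0)"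

locale bergeom_stable = bergeom_pair +
  assumes load: "p / \<alpha> < q / \<beta>"
begin

text \<open>If \<open>\<alpha> \<le> \<beta>\<close>, the load forces \<open>p < q\<close>, and then
  \<open>c\<close> would be strictly larger for \<open>(q, \<beta>)\<close>, unless
  \<open>\<alpha> = 1\<close> makes it infinite. The second case is the Bernoulli queue.\<close>

lemma stable_cases:
  obtains "\<beta> < \<alpha>" | "\<alpha> = 1" "\<beta> = 1" "p < q"
proof (cases "\<beta> < \<alpha>")
  case False
  have 1: "p * \<beta> < q * \<alpha>" using load \<alpha> \<beta> by (simp add: field_simps)
  have "p < q"
  proof (rule ccontr)
    assume "\<not> p < q"
    hence "q * \<alpha> \<le> p * \<beta>" using False \<alpha> q by (intro mult_mono) auto
    thus False using 1 by simp
  qed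
  show ?thesis
  proof (cases "\<alpha> = 1")
    case True
    thus ?thesis using that(2) False \<open>p < q\<close> \<beta> by auto
  next
    case a1: False
    hence "bg_c p \<alpha> \<noteq> \<infinity>" using \<open>p < q\<close> q by (auto simp: bg_c_def)
    hence 2: "q \<noteq> 1" "\<beta> \<noteq> 1" using c_eq by (auto simp: bg_c_def)
    have "p / (1 - p) < q / (1 - q)" "\<alpha> / (1 - \<alpha>) \<le> \<beta> / (1 - \<beta>)"
      using \<open>p < q\<close> p \<alpha> q \<beta> 2 False by (auto intro!: frac_less frac_le)
    hence "p / (1 - p) * (\<alpha> / (1 - \<alpha>)) < q / (1 - q) * (\<beta> / (1 - \<beta>))"
      using p \<alpha> q \<beta> 2 a1 by (intro mult_less_le_imp_less) auto
    hence False using c_eq 2 a1 \<open>p < q\<close> q by (auto simp: bg_c_def)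
    thus ?thesis ..
  qed
qed (use that in blast)

text \<open>The ratio of the geometric tail of the stationary law. If \<open>\<beta> = 1\<close> then also \<open>\<alpha> = 1\<close>, and
  \<open>(1 - \<alpha>) / (1 - \<beta>)\<close> degenerates to the junk value \<open>0 / 0\<close>.\<close>

definition rho :: real where
  "rho = (if \<beta> < 1 then (1 - \<alpha>) / (1 - \<beta>) else p * (1 - q) / ((1 - p) * q))"

lemma rho: "0 \<le> rho" "rho < 1"
proof -
  have "0 \<le> rho \<and> rho < 1"
  proof (cases rule: stable_cases)
    case 1
    thus ?thesis unfolding rho_def using \<alpha> by (auto simp: field_simps)
  next
    case 2
    thus ?thesis unfolding rho_def using q p by (auto simp: field_simps)
  qed
  thus "0 \<le> rho" "rho < 1" by auto
qed

text \<open>The stationary law of the queue length, with weights 1 at 0 and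
  \<open>\<beta> * rho ^ k\<close> at \<open>k > 0\<close>. If \<open>rho = 0\<close>, arrivals of
  at most 1 meet services of at least 1 and the queue stays empty; its Bernoulli parameter would be
  0, outside the range of \<open>pmf_bergeom_pmf\<close>.\<close>

definition stat :: "nat pmf" where
  "stat = (if rho = 0 then return_pmf 0 else bergeom_pmf (\<beta> * rho / (1 - rho + \<beta> * rho)) (1 - rho))"

lemma pmf_stat:
  "pmf stat k = (if k = 0 then 1 else \<beta> * rho ^ k) * ((1 - rho) / (1 - rho + \<beta> * rho))"
proof (cases "rho = 0")
  case True
  thus ?thesis by (auto simp: stat_def)
next
  case False
  hence r: "0 < rho" "rho < 1" using rho by auto
  have d: "0 < 1 - rho + \<beta> * rho" using r \<beta> by (simp add: add_pos_pos)
  have "\<beta> * rho / (1 - rho + \<beta> * rho) \<le> 1" using d r by (simp add: field_simps)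
  moreover have "0 < \<beta> * rho / (1 - rho + \<beta> * rho)" using d r \<beta> by simp
  ultimately have "pmf stat k = (if k = 0 then 1 - \<beta> * rho / (1 - rho + \<beta> * rho) else
      \<beta> * rho / (1 - rho + \<beta> * rho) * (1 - rho) * rho ^ (k - 1))"
    using False r by (simp add: stat_def pmf_bergeom_pmf)
  also have "\<dots> = (if k = 0 then 1 else \<beta> * rho ^ k) * ((1 - rho) / (1 - rho + \<beta> * rho))"
    using d by (cases k) (auto simp: field_simps)
  finally show ?thesis .
qed

definition tail :: "nat \<Rightarrow> real" where
  "tail z = (if z = 0 then 1 else q * (1 - \<beta>) ^ (z - 1))"

lemma srv_tail: "measure_pmf.prob srv {z..} = tail z"
proof (induction z)
  case (Suc z)
  have "{z..} = insert z {Suc z..}" by auto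
  hence "measure_pmf.prob srv {z..} = pmf srv z + measure_pmf.prob srv {Suc z..}"
    by (simp add: measure_pmf.finite_measure_Union[of "{z}", simplified] measure_pmf_single)
  thus ?case using Suc by (cases z) (auto simp: pmf_srv tail_def algebra_simps)
qed (simp add: tail_def)

text \<open>Memorylessness: a service known to be at least \<open>z > 0\<close> exceeds
  \<open>z\<close> by a geometric variable starting at 0. This is the origin of the last component
  of \<open>noise\<close>.\<close>

lemma srv_excess:
  assumes "0 < z" "z \<le> r"
  shows "tail z * pmf (geometric_pmf \<beta>) (r - z) = pmf srv r"
proof -
  have "(1 - \<beta>) ^ (z - 1) * (1 - \<beta>) ^ (r - z) = (1 - \<beta>) ^ (r - 1)"
    using assms by (simp add: power_add[symmetric])
  thus ?thesis using assms \<beta> by (simp add: tail_def pmf_srv algebra_simps)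
qed

lemma rho_power: "\<beta> < 1 \<Longrightarrow> rho ^ k * (1 - \<beta>) ^ k = (1 - \<alpha>) ^ k"
  by (simp add: rho_def power_mult_distrib[symmetric])

text \<open>Detailed balance: given that \<open>z\<close> customers are present, the weight of an arrival of size
  \<open>a\<close> is proportional to that of a departure of size \<open>a\<close>.\<close>

lemma stat_balance:
  assumes "a < z"
  shows "pmf stat (z - a) * pmf arr a * tail z = pmf stat 0 * pmf arr z * pmf srv a"
proof (cases "\<beta> < 1")
  case True
  define K where "K = (1 - rho) / (1 - rho + \<beta> * rho)"
  have "\<beta> * rho ^ (z - a) * pmf arr a * tail z = pmf arr z * pmf srv a"
  \<comment> \<open>For \<open>a = 0\<close> a factor \<open>1 - \<beta>\<close> completes the power
    required by \<open>rho_power\<close>, and \<open>c_rel\<close> exchanges the parameters. For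
    \<open>a > 0\<close> the Bernoulli factors agree and only geometric powers are compared.\<close>
  proof (cases "a = 0")
    case a: True
    obtain k where k: "z = Suc k" using assms by (cases z) auto
    have "\<beta> * rho ^ (z - a) * pmf arr a * tail z * (1 - \<beta>)
       = \<beta> * (rho ^ z * (1 - \<beta>) ^ z) * (1 - p) * q"
      by (simp add: a pmf_arr tail_def k algebra_simps)
    also have "\<dots> = (1 - \<alpha>) ^ k * (q * \<beta> * (1 - p) * (1 - \<alpha>))"
      using True by (subst rho_power) (auto simp: k)
    also have "\<dots> = pmf arr z * pmf srv a * (1 - \<beta>)"
      by (subst c_rel[symmetric]) (simp add: a pmf_arr pmf_srv k)
    finally show ?thesis using True by simp
  next
    case a: False
    then obtain b where b: "a = Suc b" by (cases a) auto
    define d where "d = z - a"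
    have z: "z = Suc (b + d)" using assms b by (simp add: d_def)
    have "\<beta> * rho ^ (z - a) * pmf arr a * tail z
       = \<beta> * (rho ^ d * (1 - \<beta>) ^ d) * p * \<alpha> * (1 - \<alpha>) ^ b * q * (1 - \<beta>) ^ b"
      by (simp add: pmf_arr tail_def z b power_add)
    also have "\<dots> = pmf arr z * pmf srv a"
      using True by (subst rho_power) (auto simp: pmf_arr pmf_srv b z power_add)
    finally show ?thesis .
  qed
  hence "K * (\<beta> * rho ^ (z - a) * pmf arr a * tail z) = K * (pmf arr z * pmf srv a)" by simp
  thus ?thesis unfolding pmf_stat K_def[symmetric] using assms by (simp add: mult_ac)
next
  case False
  hence 1: "\<beta> = 1" "\<alpha> = 1" "p < q" using \<beta> \<alpha> by (cases rule: stable_cases; simp)+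
  \<comment> \<open>With Bernoulli arrivals and services \<open>rho\<close> is the ratio of the up
    and down probabilities of a birth-death chain.\<close>
  have r: "rho * ((1 - p) * q) = p * (1 - q)" unfolding rho_def using 1 q by simp
  show ?thesis
  proof (cases "z = 1")
    case True
    define K where "K = (1 - rho) / (1 - rho + \<beta> * rho)"
    have "K * (rho * ((1 - p) * q)) = K * (p * (1 - q))" by (simp only: r)
    thus ?thesis
      unfolding pmf_stat pmf_arr pmf_srv tail_def K_def[symmetric] using True assms 1
      by (simp add: mult_ac)
  next
    case False
    thus ?thesis unfolding pmf_arr tail_def using assms 1 by simp
  qed
qed

text \<open>Multiplied by \<open>tail z\<close>, both sides become
  \<open>pmf stat 0 * pmf arr z * pmf srv a * pmf srv d\<close> by \<open>stat_balance\<close>. If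
  \<open>tail z = 0\<close>, everything is Bernoulli with \<open>z \<ge> 2\<close>, and only the
  values 0 and 1 of \<open>a\<close> and \<open>d\<close> matter.\<close>

lemma stat_balance2:
  assumes "a < z" "d < z"
  shows "pmf stat (z - a) * pmf arr a * pmf srv d = pmf stat (z - d) * pmf arr d * pmf srv a"
proof (cases "tail z = 0")
  case False
  have "tail z * (pmf stat (z - a) * pmf arr a * pmf srv d) =
      tail z * (pmf stat (z - d) * pmf arr d * pmf srv a)"
  proof -
    have "tail z * (pmf stat (z - a) * pmf arr a * pmf srv d) =
        (pmf stat (z - a) * pmf arr a * tail z) * pmf srv d" by (simp add: mult_ac)
    also have "\<dots> = (pmf stat 0 * pmf arr z * pmf srv d) * pmf srv a"
      unfolding stat_balance[OF assms(1)] by (simp add: mult_ac)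
    also have "\<dots> = (pmf stat (z - d) * pmf arr d * tail z) * pmf srv a"
      by (simp only: stat_balance[OF assms(2)])
    finally show ?thesis by (simp add: mult_ac)
  qed
  thus ?thesis using False by simp
next
  case True
  hence b: "\<beta> = 1" "2 \<le> z" using q by (auto simp: tail_def split: if_splits)
  hence a: "\<alpha> = 1" "p < q" using \<alpha> by (cases rule: stable_cases; simp)+
  have r: "rho * ((1 - p) * q) = p * (1 - q)" unfolding rho_def using a b q by simp
  have *: "pmf stat z * pmf arr 0 * pmf srv (Suc 0) = pmf stat (z - 1) * pmf arr (Suc 0) * pmf srv 0"
  proof -
    obtain k where k: "z = Suc (Suc k)" using b by (metis add_2_eq_Suc le_Suc_ex)
    define K where "K = rho ^ Suc k * ((1 - rho) / (1 - rho + \<beta> * rho))"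
    have "K * (rho * ((1 - p) * q)) = K * (p * (1 - q))" by (simp add: r)
    thus ?thesis unfolding pmf_stat pmf_arr pmf_srv using a b k by (simp add: K_def algebra_simps)
  qed
  consider "a = d" | "a = 0" "d = 1" | "a = 1" "d = 0" | "2 \<le> a" | "2 \<le> d" by linarith
  thus ?thesis
  proof cases
    case 4 thus ?thesis unfolding pmf_arr pmf_srv using a b by simp
  next
    case 5 thus ?thesis unfolding pmf_arr pmf_srv using a b by simp
  qed (use * in auto)
qed

text \<open>One slot of Burke's theorem: the new state is again stationary and independent of the
  departure and the reversed service, which have the laws of arrival and service.\<close>

theorem stat_invariant:
  "map_pmf (\<lambda>(x, e). (queue_step x e, queue_out x e)) (pair_pmf stat noise)
     = pair_pmf stat (pair_pmf arr srv)"
proof (rule pmf_eqI, clarify)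
  fix x' d' r' :: nat
  define f where "f = (\<lambda>(x, e). (queue_step x e, queue_out x e))"
  \<comment> \<open>\<open>z\<close> counts the customers present between arrival and service.
    \<open>Ss\<close> collects the services that let \<open>d'\<close> of them leave: exactly
    \<open>d'\<close> if some remain, at least \<open>d'\<close> if the queue is emptied.\<close>
  define z where "z = x' + d'"
  define Ss where "Ss = (if 0 < x' then {d'} else {d'..})"
  have Ss: "measure_pmf.prob srv Ss = (if 0 < x' then pmf srv d' else tail z)"
    by (simp add: Ss_def measure_pmf_single srv_tail z_def)
  have prod: "measure_pmf.prob (pair_pmf stat noise) (X \<times> A \<times> B \<times> C \<times> D) =
     measure_pmf.prob stat X * (measure_pmf.prob arr A * (measure_pmf.prob srv B *
       (measure_pmf.prob srv C * measure_pmf.prob (geometric_pmf \<beta>) D)))" for X A B C D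
    by (simp add: noise_def measure_pmf_prob_product)
  have "pmf (map_pmf f (pair_pmf stat noise)) (x', d', r') =
      measure_pmf.prob (pair_pmf stat noise) (f -` {(x', d', r')})"
    by (simp add: pmf_map)
  also have "\<dots> = pmf stat x' * (pmf arr d' * pmf srv r')"
  \<comment> \<open>The reversed service \<open>r'\<close> reveals the past. If
    \<open>r' < z\<close>, it did not empty the reversed queue, so \<open>r'\<close> customers
    arrived at a queue of length \<open>z - r'\<close>. Otherwise all \<open>z\<close> arrived at an
    empty queue, and the auxiliary variables produced the rest of \<open>r'\<close>.\<close>
  proof (cases "r' < z")
    case True
    have "f -` {(x', d', r')} = {z - r'} \<times> {r'} \<times> Ss \<times> UNIV \<times> UNIV"
      using True by (auto simp: f_def z_def Ss_def min_def split: if_splits)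
    hence "measure_pmf.prob (pair_pmf stat noise) (f -` {(x', d', r')}) =
       pmf stat (z - r') * (pmf arr r' * (if 0 < x' then pmf srv d' else tail z))"
      by (simp only: prod Ss) (simp add: measure_pmf_single)
    also have "\<dots> = pmf stat x' * (pmf arr d' * pmf srv r')"
    proof (cases "0 < x'")
      case x: True
      thus ?thesis using stat_balance2[OF True, of d'] by (simp add: z_def mult.assoc)
    next
      case x: False
      thus ?thesis using stat_balance[OF True] by (simp add: z_def mult.assoc)
    qed
    finally show ?thesis .
  next
    case False
    define E where "E = (if 0 < z then {r' - z} else UNIV)"
    define C where "C = (if 0 < z then UNIV else {r'})"
    have "f -` {(x', d', r')} = {0} \<times> {z} \<times> Ss \<times> C \<times> E"
      using False by (auto simp: f_def z_def Ss_def min_def E_def C_def split: if_splits)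
    hence "measure_pmf.prob (pair_pmf stat noise) (f -` {(x', d', r')}) =
       pmf stat 0 * (pmf arr z * ((if 0 < x' then pmf srv d' else tail z) *
        (measure_pmf.prob srv C * measure_pmf.prob (geometric_pmf \<beta>) E)))"
      by (simp only: prod Ss) (simp add: measure_pmf_single)
    also have "\<dots> = pmf stat x' * (pmf arr d' * pmf srv r')"
    proof (cases "z = 0")
      case True
      thus ?thesis using \<beta> by (simp add: z_def C_def E_def measure_pmf_single tail_def)
    next
      case z: False
      define V where "V = pmf (geometric_pmf \<beta>) (r' - z)"
      have V: "tail z * V = pmf srv r'"
        unfolding V_def using z False by (intro srv_excess) auto
      show ?thesis
      proof (cases "0 < x'")
        case True
        have "pmf stat x' * (pmf arr d' * pmf srv r') = (pmf stat (z - d') * pmf arr d' * tail z) * V"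
          unfolding V[symmetric] by (simp add: z_def)
        also have "\<dots> = pmf stat 0 * pmf arr z * pmf srv d' * V"
          using True by (subst stat_balance) (auto simp: z_def)
        finally show ?thesis using z True
          by (simp add: C_def E_def measure_pmf_single V_def)
      next
        case x: False
        thus ?thesis using z unfolding V[symmetric]
          by (simp add: C_def E_def measure_pmf_single V_def z_def)
      qed
    qed
    finally show ?thesis .
  qed
  finally show "pmf (map_pmf (\<lambda>(x, e). (queue_step x e, queue_out x e)) (pair_pmf stat noise)) (x', d', r')
     = pmf (pair_pmf stat (pair_pmf arr srv)) (x', d', r')"
    by (simp add: f_def pmf_pair)
qed

end

section \<open>Finite runs, coupling and critical load\<close>

primrec queue_outs :: "nat \<Rightarrow> (nat \<times> nat \<times> nat \<times> nat) list \<Rightarrow> (nat \<times> nat) list" where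
  "queue_outs x [] = []"
| "queue_outs x (e # es) = queue_out x e # queue_outs (queue_step x e) es"

lemma length_queue_outs [simp]: "length (queue_outs x es) = length es"
  by (induction es arbitrary: x) auto

lemma nth_queue_outs:
  "i < length es \<Longrightarrow> queue_outs x es ! i = queue_out (foldl queue_step x (take i es)) (es ! i)"
  by (induction es arbitrary: x i) (auto simp: nth_Cons split: nat.split)

lemma queue_step_mono: "x \<le> y \<Longrightarrow> queue_step x e \<le> queue_step y e"
  by (cases e) auto

lemma foldl_queue_step_mono: "x \<le> y \<Longrightarrow> foldl queue_step x es \<le> foldl queue_step y es"
  by (induction es arbitrary: x y) (auto intro: queue_step_mono)

context bergeom_stable
begin

text \<open>Since \<open>g\<close> receives final state and outputs together, this determines their
  joint law, including independence. The induction splits off the first slot; its output is absorbed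
  into \<open>g\<close>, which is therefore arbitrary.\<close>

lemma bind_queue_outs:
  "bind_pmf stat (\<lambda>x. bind_pmf (replicate_pmf n noise) (\<lambda>es. g (foldl queue_step x es) (queue_outs x es)))
   = bind_pmf stat (\<lambda>x. bind_pmf (replicate_pmf n (pair_pmf arr srv)) (\<lambda>os. g x os))"
proof (induction n arbitrary: g)
  case 0
  show ?case by (simp add: bind_return_pmf)
next
  case (Suc n)
  have inv: "bind_pmf stat (\<lambda>x. bind_pmf noise (\<lambda>e. f (queue_step x e) (queue_out x e))) =
     bind_pmf stat (\<lambda>x. bind_pmf (pair_pmf arr srv) (\<lambda>ou. f x ou))"
    for f :: "nat \<Rightarrow> nat \<times> nat \<Rightarrow> 'b pmf"
  proof -
    have "bind_pmf (map_pmf (\<lambda>(x, e). (queue_step x e, queue_out x e)) (pair_pmf stat noise)) (\<lambda>(x, ou). f x ou)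
      = bind_pmf (pair_pmf stat (pair_pmf arr srv)) (\<lambda>(x, ou). f x ou)"
      by (simp only: stat_invariant)
    thus ?thesis
      by (simp add: map_pmf_def pair_pmf_def[of stat] bind_assoc_pmf bind_return_pmf)
  qed
  have "bind_pmf stat (\<lambda>x. bind_pmf (replicate_pmf (Suc n) noise) (\<lambda>es. g (foldl queue_step x es) (queue_outs x es)))
    = bind_pmf stat (\<lambda>x. bind_pmf noise (\<lambda>e. bind_pmf (replicate_pmf n noise)
        (\<lambda>es. g (foldl queue_step (queue_step x e) es) (queue_out x e # queue_outs (queue_step x e) es))))"
    by (simp add: bind_assoc_pmf bind_return_pmf)
  also have "\<dots> = bind_pmf stat (\<lambda>x. bind_pmf (pair_pmf arr srv) (\<lambda>ou. bind_pmf (replicate_pmf n noise)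
        (\<lambda>es. g (foldl queue_step x es) (ou # queue_outs x es))))"
    by (rule inv)
  also have "\<dots> = bind_pmf (pair_pmf arr srv) (\<lambda>ou. bind_pmf stat (\<lambda>x. bind_pmf (replicate_pmf n noise)
        (\<lambda>es. g (foldl queue_step x es) (ou # queue_outs x es))))"
    by (rule bind_commute_pmf)
  also have "\<dots> = bind_pmf (pair_pmf arr srv) (\<lambda>ou. bind_pmf stat (\<lambda>x. bind_pmf (replicate_pmf n (pair_pmf arr srv))
        (\<lambda>os. g x (ou # os))))"
    by (subst Suc) (rule refl)
  also have "\<dots> = bind_pmf stat (\<lambda>x. bind_pmf (pair_pmf arr srv) (\<lambda>ou. bind_pmf (replicate_pmf n (pair_pmf arr srv))
        (\<lambda>os. g x (ou # os))))"
    by (rule bind_commute_pmf)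
  also have "\<dots> = bind_pmf stat (\<lambda>x. bind_pmf (replicate_pmf (Suc n) (pair_pmf arr srv)) (\<lambda>os. g x os))"
    by (simp add: bind_assoc_pmf bind_return_pmf)
  finally show ?case .
qed

lemma stat_queue_outs:
  "map_pmf (\<lambda>(x, es). queue_outs x es) (pair_pmf stat (replicate_pmf n noise))
     = replicate_pmf n (pair_pmf arr srv)"
  using bind_queue_outs[of n "\<lambda>x os. return_pmf os"]
  by (simp add: map_pmf_def pair_pmf_def bind_assoc_pmf bind_return_pmf bind_return_pmf')

lemma stat_foldl:
  "map_pmf (\<lambda>(x, es). foldl queue_step x es) (pair_pmf stat (replicate_pmf n noise)) = stat"
  using bind_queue_outs[of n "\<lambda>x os. return_pmf x"]
  by (simp add: map_pmf_def pair_pmf_def bind_assoc_pmf bind_return_pmf bind_return_pmf')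

end

section \<open>Generating functions and exponential bounds\<close>

definition bergeom_pgf :: "real \<Rightarrow> real \<Rightarrow> real \<Rightarrow> real" where
  "bergeom_pgf p \<alpha> z = 1 - p + p * \<alpha> * z / (1 - (1 - \<alpha>) * z)"

lemma nn_integral_bergeom_pgf:
  assumes p: "0 < p" "p \<le> 1" "0 < \<alpha>" "\<alpha> \<le> 1" and z: "0 \<le> z" "(1 - \<alpha>) * z < 1"
  shows "(\<integral>\<^sup>+k. ennreal (z ^ k) \<partial>bergeom_pmf p \<alpha>) = ennreal (bergeom_pgf p \<alpha> z)"
proof -
  let ?f = "\<lambda>k. pmf (bergeom_pmf p \<alpha>) k * z ^ k"
  have "(\<lambda>k. ((1 - \<alpha>) * z) ^ k) sums (1 / (1 - (1 - \<alpha>) * z))"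
    using p z by (intro geometric_sums) auto
  hence "(\<lambda>k. p * \<alpha> * z * ((1 - \<alpha>) * z) ^ k) sums (p * \<alpha> * z * (1 / (1 - (1 - \<alpha>) * z)))"
    by (rule sums_mult)
  also have "(\<lambda>k. p * \<alpha> * z * ((1 - \<alpha>) * z) ^ k) = (\<lambda>k. ?f (Suc k))"
    using p by (simp add: pmf_bergeom_pmf power_mult_distrib mult_ac)
  finally have "?f sums (p * \<alpha> * z * (1 / (1 - (1 - \<alpha>) * z)) + ?f 0)" by (rule sums_Suc)
  hence s: "?f sums bergeom_pgf p \<alpha> z" using p by (simp add: pmf_bergeom_pmf bergeom_pgf_def add.commute)
  have "(\<integral>\<^sup>+k. ennreal (z ^ k) \<partial>bergeom_pmf p \<alpha>) = (\<integral>\<^sup>+k. ennreal (?f k) \<partial>count_space UNIV)"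
    using z by (simp add: nn_integral_measure_pmf ennreal_mult)
  also have "\<dots> = (\<Sum>k. ennreal (?f k))" by (rule nn_integral_count_space_nat)
  also have "\<dots> = ennreal (\<Sum>k. ?f k)"
    using z s by (intro suminf_ennreal2) (auto simp: sums_iff)
  finally show ?thesis using s by (simp add: sums_iff)
qed

lemma bergeom_pgf_1: "\<alpha> \<noteq> 0 \<Longrightarrow> bergeom_pgf p \<alpha> 1 = 1"
  by (simp add: bergeom_pgf_def)

lemma bergeom_pgf_nonneg:
  assumes "0 < p" "p \<le> 1" "0 < \<alpha>" "0 \<le> z" "(1 - \<alpha>) * z < 1"
  shows "0 \<le> bergeom_pgf p \<alpha> z"
  unfolding bergeom_pgf_def using assms by (intro add_nonneg_nonneg divide_nonneg_pos) auto

lemma bergeom_pgf_deriv: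
  assumes "\<alpha> \<noteq> 0"
  shows "(bergeom_pgf p \<alpha> has_real_derivative p / \<alpha>) (at 1)"
  unfolding bergeom_pgf_def [abs_def]
  by (rule derivative_eq_intros refl | use assms in \<open>simp add: field_simps power2_eq_square\<close>)+

lemma replicate_pmf_snoc:
  "replicate_pmf (Suc n) p = bind_pmf (replicate_pmf n p) (\<lambda>xs. map_pmf (\<lambda>x. xs @ [x]) p)"
  using replicate_pmf_distrib[of n 1 p]
  by (simp add: bind_assoc_pmf bind_return_pmf map_pmf_def)

context bergeom_pair
begin

text \<open>The expectation of \<open>z\<close> to the power of arrivals minus services. Its
  derivative at 1 is the mean drift, negative at stable load and zero at critical load.\<close>

definition drift_pgf :: "real \<Rightarrow> real" where
  "drift_pgf z = bergeom_pgf p \<alpha> z * bergeom_pgf q \<beta> (1 / z)"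

lemma nn_integral_drift:
  assumes "0 < z" "(1 - \<alpha>) * z < 1" "1 - \<beta> < z"
  shows "(\<integral>\<^sup>+(a, s, v). ennreal (z ^ a * (1 / z) ^ s) \<partial>noise) = ennreal (drift_pgf z)"
proof -
  have b: "(1 - \<beta>) * (1 / z) < 1" using assms by (simp add: field_simps)
  have "(\<integral>\<^sup>+(a, s, v). ennreal (z ^ a * (1 / z) ^ s) \<partial>noise) =
     (\<integral>\<^sup>+a. \<integral>\<^sup>+s. ennreal (z ^ a) * ennreal ((1 / z) ^ s) \<partial>srv \<partial>arr)"
    unfolding noise_def using assms by (simp add: nn_integral_pair_pmf' ennreal_mult')
  also have "\<dots> = (\<integral>\<^sup>+a. ennreal (z ^ a) \<partial>arr) * (\<integral>\<^sup>+s. ennreal ((1 / z) ^ s) \<partial>srv)"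
    by (simp add: nn_integral_cmult nn_integral_multc)
  also have "\<dots> = ennreal (bergeom_pgf p \<alpha> z) * ennreal (bergeom_pgf q \<beta> (1 / z))"
    using assms p \<alpha> q \<beta> b by (subst (1 2) nn_integral_bergeom_pgf) auto
  also have "\<dots> = ennreal (drift_pgf z)"
    unfolding drift_pgf_def using assms p \<alpha> q \<beta> b
    by (intro ennreal_mult[symmetric] bergeom_pgf_nonneg) auto
  finally show ?thesis .
qed

lemma drift_pgf_1: "drift_pgf 1 = 1"
  using \<alpha> \<beta> by (simp add: drift_pgf_def bergeom_pgf_1)

lemma drift_pgf_deriv: "(drift_pgf has_real_derivative (p / \<alpha> - q / \<beta>)) (at 1)"
proof -
  have inv: "((\<lambda>z. 1 / z) has_real_derivative -1) (at (1::real))"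
    by (auto intro!: derivative_eq_intros)
  have "((\<lambda>z. bergeom_pgf q \<beta> (1 / z)) has_real_derivative (q / \<beta> * -1)) (at 1)"
    using DERIV_chain2[OF _ inv, of "bergeom_pgf q \<beta>"] bergeom_pgf_deriv[of \<beta> q] \<beta> by simp
  from DERIV_mult[OF bergeom_pgf_deriv[of \<alpha> p] this] \<alpha> \<beta> show ?thesis
    unfolding drift_pgf_def[abs_def] by (simp add: bergeom_pgf_1)
qed

text \<open>Two queues driven by the same noise coincide from the moment the longer one gets empty;
  until then the longer one moves like the free random walk.\<close>

lemma coupling_bound:
  assumes z: "1 \<le> z" "(1 - \<alpha>) * z < 1" and "x \<le> y"
  shows "(\<integral>\<^sup>+es. ennreal (z ^ foldl queue_step y es) * indicator {es. foldl queue_step x es \<noteq> foldl queue_step y es} es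
      \<partial>replicate_pmf n noise) \<le> ennreal (z ^ y) * ennreal (drift_pgf z) ^ n * of_bool (x \<noteq> y)"
  using assms(3)
proof (induction n arbitrary: x y)
  case 0
  thus ?case by (simp add: indicator_def)
next
  case (Suc n)
  let ?h = "\<lambda>x y es. ennreal (z ^ foldl queue_step y es) * indicator {es. foldl queue_step x es \<noteq> foldl queue_step y es} es"
  let ?\<phi> = "ennreal (drift_pgf z)"
  have "(\<integral>\<^sup>+es. ?h x y es \<partial>replicate_pmf (Suc n) noise) =
    (\<integral>\<^sup>+e. \<integral>\<^sup>+es. ?h (queue_step x e) (queue_step y e) es \<partial>replicate_pmf n noise \<partial>noise)"
    by (simp add: nn_integral_return indicator_def)
  also have "\<dots> \<le> (\<integral>\<^sup>+e. ennreal (z ^ queue_step y e) * ?\<phi> ^ n * of_bool (queue_step x e \<noteq> queue_step y e) \<partial>noise)"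
    by (intro nn_integral_mono Suc.IH queue_step_mono Suc.prems)
  also have "\<dots> \<le> (\<integral>\<^sup>+e. (ennreal (z ^ y) * ?\<phi> ^ n * of_bool (x \<noteq> y)) * (case e of (a, s, v) \<Rightarrow> ennreal (z ^ a * (1 / z) ^ s)) \<partial>noise)"
  proof (intro nn_integral_mono, clarify)
    fix a s v0 v1 :: nat
    show "ennreal (z ^ queue_step y (a, s, v0, v1)) * ?\<phi> ^ n *
        of_bool (queue_step x (a, s, v0, v1) \<noteq> queue_step y (a, s, v0, v1))
      \<le> (ennreal (z ^ y) * ?\<phi> ^ n * of_bool (x \<noteq> y)) * ennreal (z ^ a * (1 / z) ^ s)"
    proof (cases "x + a - s = y + a - s")
      case False
      hence "s \<le> y + a" "x \<noteq> y" using Suc.prems by auto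
      hence "z ^ (y + a - s) = z ^ y * (z ^ a * (1 / z) ^ s)"
        using z by (simp add: power_diff power_add power_divide)
      moreover have "ennreal (z ^ y * (z ^ a * (1 / z) ^ s)) = ennreal (z ^ y) * ennreal (z ^ a * (1 / z) ^ s)"
        using z by (intro ennreal_mult) auto
      ultimately show ?thesis using False \<open>x \<noteq> y\<close> by (simp add: mult_ac)
    qed simp
  qed
  also have "\<dots> = (ennreal (z ^ y) * ?\<phi> ^ n * of_bool (x \<noteq> y)) * ?\<phi>"
    using z \<beta> by (subst nn_integral_cmult) (auto simp: nn_integral_drift)
  finally show ?case by (simp add: mult_ac)
qed

text \<open>The function \<open>z ^ x\<close> is multiplied on average by \<open>drift_pgf z\<close>, except for the loss at the
  boundary. At critical load the factor is \<open>1 + o(1 - z)\<close>, while each visit to \<open>0\<close> costs a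
  multiple of \<open>1 - z\<close>.\<close>

lemma boundary_loss:
  assumes z: "0 < z" "z < 1" "1 - \<beta> < z"
    and g: "\<And>n. g \<le> measure_pmf.prob (replicate_pmf n noise) {es. foldl queue_step 0 es = 0}" "0 \<le> g"
  shows "g * measure_pmf.prob noise {(a, s, v). a < s} * (1 / z - 1) \<le> \<bar>drift_pgf z - 1\<bar>"
proof -
  define \<phi> where "\<phi> = drift_pgf z"
  define f where "f = measure_pmf.prob noise {(a, s, v). a < s}"
  define G where "G n = (\<integral>\<^sup>+es. ennreal (z ^ foldl queue_step 0 es) \<partial>replicate_pmf n noise)" for n
  have "(1 - \<alpha>) * z \<le> 1 * z" using z \<alpha> by (intro mult_right_mono) auto
  hence az: "(1 - \<alpha>) * z < 1" using z by linarith
  \<comment> \<open>If the service exceeds the customers present, the free walk contributes at least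
    \<open>1 / z\<close> where the truncated queue contributes 1. Only the loss at
    \<open>x = 0\<close> is kept.\<close>
  have step: "ennreal (z ^ queue_step x e) + ennreal (1 / z - 1) * of_bool (x = 0) * indicator {(a, s, v). a < s} e
     \<le> ennreal (z ^ x) * (case e of (a, s, v) \<Rightarrow> ennreal (z ^ a * (1 / z) ^ s))" for x e
  proof -
    obtain a s v0 v1 where e: "e = (a, s, v0, v1)" by (cases e) auto
    have "z ^ (x + a - s) + (1 / z - 1) * of_bool (x = 0 \<and> a < s) \<le> z ^ x * (z ^ a * (1 / z) ^ s)"
    proof (cases "s \<le> x + a")
      case True
      thus ?thesis using z by (simp add: power_diff power_add power_divide)
    next
      case False
      hence "z ^ x * (z ^ a * (1 / z) ^ s) = (1 / z) ^ (s - (x + a))"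
        using z by (simp add: power_diff power_add power_divide)
      moreover have "(1 / z) ^ 1 \<le> (1 / z) ^ (s - (x + a))"
        using False z by (intro power_increasing) auto
      ultimately show ?thesis using False z by (auto simp: field_simps)
    qed
    hence "ennreal (z ^ (x + a - s) + (1 / z - 1) * of_bool (x = 0 \<and> a < s)) \<le> ennreal (z ^ x * (z ^ a * (1 / z) ^ s))"
      by (rule ennreal_leI)
    moreover have "ennreal (z ^ (x + a - s) + (1 / z - 1) * of_bool (x = 0 \<and> a < s)) =
       ennreal (z ^ (x + a - s)) + ennreal (1 / z - 1) * of_bool (x = 0) * indicator {(a, s, v). a < s} e"
      using z by (subst ennreal_plus) (auto simp: e)
    moreover have "ennreal (z ^ x * (z ^ a * (1 / z) ^ s)) = ennreal (z ^ x) * ennreal (z ^ a * (1 / z) ^ s)"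
      using z by (intro ennreal_mult) auto
    ultimately show ?thesis by (simp add: e)
  qed
  have G_Suc: "G (Suc n) + ennreal (g * f * (1 / z - 1)) \<le> ennreal \<phi> * G n" for n
  proof -
    have "ennreal g \<le> (\<integral>\<^sup>+es. of_bool (foldl queue_step 0 es = 0) \<partial>replicate_pmf n noise)"
    proof -
      have "(\<integral>\<^sup>+es. of_bool (foldl queue_step 0 es = 0) \<partial>replicate_pmf n noise) =
         (\<integral>\<^sup>+es. indicator {es. foldl queue_step 0 es = 0} es \<partial>replicate_pmf n noise)"
        by (intro nn_integral_cong) (auto simp: indicator_def)
      thus ?thesis using g(1)[of n] by (simp add: measure_pmf.emeasure_eq_measure)
    qed
    hence "ennreal (1 / z - 1) * ennreal f * ennreal g \<le>
       ennreal (1 / z - 1) * ennreal f * (\<integral>\<^sup>+es. of_bool (foldl queue_step 0 es = 0) \<partial>replicate_pmf n noise)"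
      by (rule mult_left_mono) simp
    moreover have "ennreal (g * f * (1 / z - 1)) = ennreal (1 / z - 1) * ennreal f * ennreal g"
      using z g(2) by (simp add: ennreal_mult'[symmetric] f_def mult_ac)
    ultimately have "G (Suc n) + ennreal (g * f * (1 / z - 1)) \<le>
       G (Suc n) + ennreal (1 / z - 1) * ennreal f * (\<integral>\<^sup>+es. of_bool (foldl queue_step 0 es = 0) \<partial>replicate_pmf n noise)"
      by (simp add: add_left_mono)
    also have "\<dots> = (\<integral>\<^sup>+es. \<integral>\<^sup>+e. (ennreal (z ^ queue_step (foldl queue_step 0 es) e) +
        ennreal (1 / z - 1) * of_bool (foldl queue_step 0 es = 0) * indicator {(a, s, v). a < s} e) \<partial>noise \<partial>replicate_pmf n noise)"
    proof -
      have "G (Suc n) = (\<integral>\<^sup>+es. \<integral>\<^sup>+e. ennreal (z ^ queue_step (foldl queue_step 0 es) e) \<partial>noise \<partial>replicate_pmf n noise)"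
        unfolding G_def replicate_pmf_snoc by simp
      moreover have "ennreal f = emeasure noise {(a, s, v). a < s}"
        by (simp add: f_def measure_pmf.emeasure_eq_measure)
      moreover have "(\<integral>\<^sup>+e. U e + c * indicator {(a, s, v). a < s} e \<partial>noise) =
          (\<integral>\<^sup>+e. U e \<partial>noise) + c * emeasure noise {(a, s, v). a < s}" for U c
        by (simp add: nn_integral_add nn_integral_cmult)
      moreover have "(\<integral>\<^sup>+es. H es + c * P es * d \<partial>replicate_pmf n noise) =
          (\<integral>\<^sup>+es. H es \<partial>replicate_pmf n noise) + c * d * (\<integral>\<^sup>+es. P es \<partial>replicate_pmf n noise)" for H P c d
        by (simp add: nn_integral_add nn_integral_multc nn_integral_cmult) (simp add: mult_ac)
      ultimately show ?thesis by (simp only:)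
    qed
    also have "\<dots> \<le> (\<integral>\<^sup>+es. \<integral>\<^sup>+e. ennreal (z ^ foldl queue_step 0 es) *
        (case e of (a, s, v) \<Rightarrow> ennreal (z ^ a * (1 / z) ^ s)) \<partial>noise \<partial>replicate_pmf n noise)"
      by (intro nn_integral_mono step)
    also have "\<dots> = ennreal \<phi> * G n"
      using z az by (simp add: nn_integral_cmult nn_integral_multc nn_integral_drift G_def \<phi>_def mult.commute)
    finally show ?thesis .
  qed
  define \<epsilon> where "\<epsilon> = g * f * (1 / z - 1)"
  have \<epsilon>: "0 \<le> \<epsilon>" using g z by (simp add: \<epsilon>_def f_def)
  have G1: "G n \<le> 1" for n
  proof -
    have "G n \<le> (\<integral>\<^sup>+es. 1 \<partial>replicate_pmf n noise)"
      unfolding G_def using z by (intro nn_integral_mono) (simp add: power_le_one)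
    thus ?thesis by simp
  qed
  \<comment> \<open>Summing \<open>G_Suc\<close> over \<open>n\<close> slots: since \<open>G\<close>
    stays in \<open>[0,1]\<close>, the accumulated loss can exceed the accumulated growth by at most
    1. Comparing the terms linear in \<open>n\<close> gives the claim.\<close>
  have "ennreal (n * \<epsilon>) \<le> ennreal (1 + n * \<bar>\<phi> - 1\<bar>)" for n :: nat
  proof -
    have "G n + ennreal (n * \<epsilon>) \<le> ennreal (1 + n * \<bar>\<phi> - 1\<bar>)"
    proof (induction n)
      case 0
      show ?case using G1[of 0] by simp
    next
      case (Suc n)
      have "ennreal \<phi> * G n \<le> ennreal (1 + \<bar>\<phi> - 1\<bar>) * G n"
        by (intro mult_right_mono ennreal_leI) auto
      also have "\<dots> = G n + ennreal \<bar>\<phi> - 1\<bar> * G n"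
        by (simp add: distrib_right)
      also have "\<dots> \<le> G n + ennreal \<bar>\<phi> - 1\<bar>"
        using mult_left_mono[OF G1[of n], of "ennreal \<bar>\<phi> - 1\<bar>"] by (intro add_left_mono) auto
      finally have "G (Suc n) + ennreal \<epsilon> \<le> G n + ennreal \<bar>\<phi> - 1\<bar>"
        using G_Suc[of n] unfolding \<epsilon>_def by (rule order_trans[rotated])
      hence "G (Suc n) + ennreal \<epsilon> + ennreal (n * \<epsilon>) \<le> G n + ennreal \<bar>\<phi> - 1\<bar> + ennreal (n * \<epsilon>)"
        by (rule add_right_mono)
      also have "\<dots> \<le> ennreal (1 + n * \<bar>\<phi> - 1\<bar>) + ennreal \<bar>\<phi> - 1\<bar>"
        using add_right_mono[OF Suc, of "ennreal \<bar>\<phi> - 1\<bar>"] by (simp add: ac_simps)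
      also have "\<dots> = ennreal (1 + Suc n * \<bar>\<phi> - 1\<bar>)"
        by (subst ennreal_plus[symmetric]) (auto simp: algebra_simps)
      finally have "G (Suc n) + (ennreal \<epsilon> + ennreal (n * \<epsilon>)) \<le> ennreal (1 + Suc n * \<bar>\<phi> - 1\<bar>)"
        by (simp only: add.assoc)
      moreover have "ennreal \<epsilon> + ennreal (n * \<epsilon>) = ennreal (Suc n * \<epsilon>)"
        using \<epsilon> by (subst ennreal_plus[symmetric]) (auto simp: algebra_simps)
      ultimately show ?case by (simp only:)
    qed
    moreover have "ennreal (n * \<epsilon>) \<le> G n + ennreal (n * \<epsilon>)" by simp
    ultimately show ?thesis by (rule order_trans[rotated])
  qed
  hence le: "n * \<epsilon> \<le> 1 + n * \<bar>\<phi> - 1\<bar>" for n :: nat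
    by (subst (asm) ennreal_le_iff) auto
  have "\<epsilon> \<le> \<bar>\<phi> - 1\<bar>"
  proof (rule ccontr)
    assume "\<not> \<epsilon> \<le> \<bar>\<phi> - 1\<bar>"
    then obtain n :: nat where "1 < n * (\<epsilon> - \<bar>\<phi> - 1\<bar>)"
      using ex_less_of_nat_mult[of "\<epsilon> - \<bar>\<phi> - 1\<bar>" 1] by auto
    thus False using le[of n] by (simp add: algebra_simps)
  qed
  thus ?thesis by (simp add: \<epsilon>_def f_def \<phi>_def)
qed

text \<open>Dividing \<open>boundary_loss\<close> by \<open>1 - z\<close> and letting
  \<open>z\<close> increase to 1 bounds \<open>g * f\<close> by the modulus of the derivative of
  \<open>drift_pgf\<close> at 1, which is 0.\<close>

lemma critical_never_empty:
  assumes load: "p / \<alpha> = q / \<beta>" and nondeg: "\<not> (q = 1 \<and> \<beta> = 1)"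
    and g: "\<And>n. g \<le> measure_pmf.prob (replicate_pmf n noise) {es. foldl queue_step 0 es = 0}" "0 \<le> g"
  shows "g = 0"
proof -
  define f where "f = measure_pmf.prob noise {(a, s, v). a < s}"
  have f: "0 < f"
  proof -
    \<comment> \<open>No arrival and one service if \<open>p < 1\<close>. If \<open>p = 1\<close>,
      then \<open>c = \<infinity>\<close> and the load force \<open>q = 1\<close>, so
      \<open>\<beta> < 1\<close>, and one arrival with two services is possible.\<close>
    obtain a s where as: "a < s" "0 < pmf arr a" "0 < pmf srv s"
    proof (cases "p < 1")
      case True
      show ?thesis using that[of 0 1] True by (simp add: pmf_arr pmf_srv q \<beta>)
    next
      case False
      hence p1: "p = 1" using p by simp
      hence "bg_c q \<beta> = \<infinity>" using c_eq by (simp add: bg_c_def)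
      hence *: "q = 1 \<or> \<beta> = 1" by (auto simp: bg_c_def split: if_splits)
      have "q = 1"
      proof (rule ccontr)
        assume "q \<noteq> 1"
        hence "q / \<beta> < 1" using * q by auto
        moreover have "1 \<le> p / \<alpha>" using p1 \<alpha> by simp
        ultimately show False using load by simp
      qed
      hence "\<beta> < 1" using nondeg \<beta> by auto
      thus ?thesis using that[of 1 2] p \<alpha> q \<beta> unfolding pmf_arr pmf_srv by simp
    qed
    have "{(a, s)} \<subseteq> set_pmf arr \<times> set_pmf srv" using as by (auto simp: set_pmf_iff)
    moreover obtain v where "v \<in> set_pmf (pair_pmf srv (geometric_pmf \<beta>))"
      using set_pmf_not_empty by fast
    ultimately have "(a, s, v) \<in> set_pmf noise" by (auto simp: noise_def)
    thus ?thesis unfolding f_def using as by (intro measure_pmf_posI) auto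
  qed
  have "((\<lambda>z. (drift_pgf z - drift_pgf 1) / (z - 1)) \<longlongrightarrow> 0) (at 1)"
    using drift_pgf_deriv load by (simp add: has_field_derivative_iff)
  hence "((\<lambda>z. (drift_pgf z - 1) / (z - 1)) \<longlongrightarrow> 0) (at_left 1)"
    by (simp add: drift_pgf_1 filterlim_at_split)
  hence "((\<lambda>z. \<bar>(drift_pgf z - 1) / (z - 1)\<bar>) \<longlongrightarrow> 0) (at_left 1)"
    by (rule tendsto_rabs_zero)
  moreover have "\<forall>\<^sub>F z in at_left 1. g * f \<le> \<bar>(drift_pgf z - 1) / (z - 1)\<bar>"
  proof -
    have "\<forall>\<^sub>F z in at_left (1::real). max 0 (1 - \<beta>) < z \<and> z < 1"
      using \<beta> by (intro eventually_at_leftI[of "max 0 (1 - \<beta>)"]) auto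
    thus ?thesis
    proof eventually_elim
      case (elim z)
      have "g * f * (1 - z) \<le> g * f * (1 / z - 1)"
      proof (rule mult_left_mono)
        show "1 - z \<le> 1 / z - 1"
          using elim zero_le_power2[of "z - 1"] by (simp add: field_simps power2_eq_square)
      qed (use g(2) f in simp)
      also have "\<dots> \<le> \<bar>drift_pgf z - 1\<bar>"
        unfolding f_def using elim by (intro boundary_loss g) auto
      finally show ?case using elim by (simp add: abs_divide pos_le_divide_eq)
    qed
  qed
  ultimately have "g * f \<le> 0" by (rule tendsto_lowerbound) simp
  thus ?thesis using f g(2) by (metis mult_le_0_iff not_less order_antisym)
qed

end

context bergeom_stable
begin

text \<open>Any \<open>z\<close> slightly above 1 will do: the negative drift pushes
  \<open>drift_pgf z\<close> below 1, and \<open>rho * z < 1\<close> keeps \<open>z ^ x\<close>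
  integrable under the geometric tail of \<open>stat\<close>.\<close>

lemma ex_drift:
  obtains z where "1 < z" "(1 - \<alpha>) * z < 1" "drift_pgf z < 1" "(\<integral>\<^sup>+x. ennreal (z ^ x) \<partial>stat) < \<infinity>"
proof -
  have "p / \<alpha> - q / \<beta> < 0" using load by simp
  from DERIV_neg_dec_right[OF drift_pgf_deriv this]
  obtain d where d: "0 < d" "\<And>h. 0 < h \<Longrightarrow> h < d \<Longrightarrow> drift_pgf (1 + h) < 1"
    by (auto simp: drift_pgf_1)
  have "\<forall>\<^sub>F h in at_right (0::real). h < d \<and> 0 < h"
    using d by (intro eventually_at_rightI[of 0 d]) auto
  moreover have "\<forall>\<^sub>F h in at_right (0::real). (1 - \<alpha>) * (1 + h) < 1"
    using \<alpha> by (intro order_tendstoD(2)[of _ "(1 - \<alpha>) * (1 + 0)"] tendsto_intros) auto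
  moreover have "\<forall>\<^sub>F h in at_right (0::real). rho * (1 + h) < 1"
    using rho by (intro order_tendstoD(2)[of _ "rho * (1 + 0)"] tendsto_intros) auto
  ultimately have "\<forall>\<^sub>F h in at_right (0::real). (h < d \<and> 0 < h) \<and> (1 - \<alpha>) * (1 + h) < 1 \<and> rho * (1 + h) < 1"
    by eventually_elim auto
  then obtain h where h: "h < d" "0 < h" "(1 - \<alpha>) * (1 + h) < 1" "rho * (1 + h) < 1"
    using eventually_happens'[of "at_right (0::real)"] by (metis (lifting) trivial_limit_at_right_real)
  have "(\<integral>\<^sup>+x. ennreal ((1 + h) ^ x) \<partial>stat) < \<infinity>"
  proof (cases "rho = 0")
    case False
    hence r: "0 < rho" "rho < 1" using rho by auto
    have d: "0 < 1 - rho + \<beta> * rho" using r \<beta> by (simp add: add_pos_pos)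
    have "\<beta> * rho / (1 - rho + \<beta> * rho) \<le> 1" "0 < \<beta> * rho / (1 - rho + \<beta> * rho)"
      using d r \<beta> by (auto simp: field_simps)
    thus ?thesis using False r h by (simp add: stat_def nn_integral_bergeom_pgf)
  qed (simp add: stat_def)
  thus ?thesis using that[of "1 + h"] h d by auto
qed

text \<open>As \<open>z > 1\<close>, the indicator of the event is at most its product with
  \<open>z\<close> to the length of the longer queue. So \<open>coupling_bound\<close> gives
  exponential decay, with a constant that is finite by the choice of \<open>z\<close>.\<close>

lemma coalescence:
  "(\<lambda>n. measure_pmf.prob (pair_pmf stat (replicate_pmf n noise))
     {(x, es). foldl queue_step 0 es \<noteq> foldl queue_step x es}) \<longlonglongrightarrow> 0"
proof -
  obtain z where z: "1 < z" "(1 - \<alpha>) * z < 1" "drift_pgf z < 1" "(\<integral>\<^sup>+x. ennreal (z ^ x) \<partial>stat) < \<infinity>"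
    by (rule ex_drift)
  define C where "C = enn2real (\<integral>\<^sup>+x. ennreal (z ^ x) \<partial>stat)"
  have C: "(\<integral>\<^sup>+x. ennreal (z ^ x) \<partial>stat) = ennreal C" using z by (simp add: C_def)
  have \<phi>0: "0 \<le> drift_pgf z"
    unfolding drift_pgf_def using z p \<alpha> q \<beta>
    by (intro mult_nonneg_nonneg bergeom_pgf_nonneg) (auto simp: field_simps)
  have bound: "measure_pmf.prob (pair_pmf stat (replicate_pmf n noise))
     {(x, es). foldl queue_step 0 es \<noteq> foldl queue_step x es} \<le> C * drift_pgf z ^ n" for n
  proof -
    have "emeasure (pair_pmf stat (replicate_pmf n noise)) {(x, es). foldl queue_step 0 es \<noteq> foldl queue_step x es}
      = (\<integral>\<^sup>+x. \<integral>\<^sup>+es. indicator {es. foldl queue_step 0 es \<noteq> foldl queue_step x es} es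
          \<partial>replicate_pmf n noise \<partial>stat)"
    proof -
      let ?S = "{(x, es). foldl queue_step 0 es \<noteq> foldl queue_step x es}"
      have "emeasure (pair_pmf stat (replicate_pmf n noise)) ?S
        = (\<integral>\<^sup>+y. indicator ?S y \<partial>pair_pmf stat (replicate_pmf n noise))" by simp
      also have "\<dots> = (\<integral>\<^sup>+x. \<integral>\<^sup>+es. indicator ?S (x, es) \<partial>replicate_pmf n noise \<partial>stat)"
        by (rule nn_integral_pair_pmf')
      also have "\<dots> = (\<integral>\<^sup>+x. \<integral>\<^sup>+es. indicator {es. foldl queue_step 0 es \<noteq> foldl queue_step x es} es
          \<partial>replicate_pmf n noise \<partial>stat)"
        by (intro nn_integral_cong) (simp add: indicator_def)
      finally show ?thesis .
    qed
    also have "\<dots> \<le> (\<integral>\<^sup>+x. \<integral>\<^sup>+es. ennreal (z ^ foldl queue_step x es) *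
        indicator {es. foldl queue_step 0 es \<noteq> foldl queue_step x es} es \<partial>replicate_pmf n noise \<partial>stat)"
      using z by (intro nn_integral_mono) (auto simp: indicator_def)
    also have "\<dots> \<le> (\<integral>\<^sup>+x. ennreal (z ^ x) * ennreal (drift_pgf z) ^ n * of_bool (0 \<noteq> x) \<partial>stat)"
      using z by (intro nn_integral_mono coupling_bound) auto
    also have "\<dots> \<le> (\<integral>\<^sup>+x. ennreal (z ^ x) * ennreal (drift_pgf z) ^ n \<partial>stat)"
      by (intro nn_integral_mono) auto
    also have "\<dots> = ennreal C * ennreal (drift_pgf z ^ n)"
      using \<phi>0 by (simp add: nn_integral_multc C ennreal_power)
    also have "\<dots> = ennreal (C * drift_pgf z ^ n)"
      using \<phi>0 by (intro ennreal_mult[symmetric]) (auto simp: C_def)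
    finally show ?thesis
      using \<phi>0 by (simp add: measure_pmf.emeasure_eq_measure C_def)
  qed
  have "(\<lambda>n. C * drift_pgf z ^ n) \<longlonglongrightarrow> C * 0"
    using z \<phi>0 by (intro tendsto_intros LIMSEQ_realpow_zero) auto
  hence lim: "(\<lambda>n. C * drift_pgf z ^ n) \<longlonglongrightarrow> 0" by simp
  show ?thesis
    by (rule tendsto_sandwich[OF _ _ tendsto_const lim])
       (rule always_eventually, rule allI, rule measure_nonneg bound)+
qed

end

section \<open>Laws of pairs of processes\<close>

definition window :: "(int \<Rightarrow> 'a) \<Rightarrow> int \<Rightarrow> nat \<Rightarrow> 'a list" where
  "window \<omega> a K = map (\<lambda>i. \<omega> (a + int i)) [0..<K]"

lemma length_window [simp]: "length (window \<omega> a K) = K"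
  by (simp add: window_def)

lemma nth_window [simp]: "i < K \<Longrightarrow> window \<omega> a K ! i = \<omega> (a + int i)"
  by (simp add: window_def)

lemma take_window: "i \<le> K \<Longrightarrow> take i (window \<omega> a K) = window \<omega> a i"
  by (rule nth_equalityI) auto

lemma window_0 [simp]: "window \<omega> a 0 = []"
  by (simp add: window_def)

lemma window_append: "window \<omega> a (N + K) = window \<omega> a N @ window \<omega> (a + int N) K"
  by (rule nth_equalityI) (auto simp: nth_append)

lemma window_snoc: "window \<omega> a (Suc N) = window \<omega> a N @ [\<omega> (a + int N)]"
  using window_append[of \<omega> a N 1] by (simp add: window_def)

lemma window_Cons: "window \<omega> a (Suc N) = \<omega> a # window \<omega> (a + 1) N"
  using window_append[of \<omega> a 1 N] by (simp add: window_def)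

section \<open>The i.i.d. noise and its finite windows\<close>

definition iid :: "'a pmf \<Rightarrow> (int \<Rightarrow> 'a) measure" where
  "iid \<nu> = PiM UNIV (\<lambda>_. measure_pmf \<nu>)"

lemma prob_space_iid: "prob_space (iid \<nu>)"
  unfolding iid_def by (intro prob_space_PiM prob_space_measure_pmf)

lemma space_iid [simp]: "space (iid \<nu>) = UNIV"
  by (auto simp: iid_def space_PiM PiE_def)

lemma measurable_iid_coord [measurable]: "(\<lambda>\<omega>. \<omega> n) \<in> measurable (iid \<nu>) (count_space UNIV)"
proof -
  have "(\<lambda>\<omega>. \<omega> n) \<in> measurable (iid \<nu>) (measure_pmf \<nu>)"
    unfolding iid_def by (rule measurable_component_singleton) simp
  thus ?thesis by (simp cong: measurable_cong_sets)
qed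

lemma measurable_window [measurable]:
  "(\<lambda>\<omega>. window \<omega> a K :: 'a :: countable list) \<in> measurable (iid \<nu>) (count_space UNIV)"
proof (subst measurable_count_space_eq2_countable, safe)
  fix xs :: "'a list"
  have "(\<lambda>\<omega>. window \<omega> a K) -` {xs} \<inter> space (iid \<nu>) =
    {\<omega> \<in> space (iid \<nu>). length xs = K \<and> (\<forall>i\<in>{..<K}. \<omega> (a + int i) \<in> {xs ! i})}"
    by (auto simp: list_eq_iff_nth_eq)
  also have "\<dots> \<in> sets (iid \<nu>)"
    by (intro sets.sets_Collect sets.sets_Collect_finite_All measurable_sets_Collect[OF measurable_iid_coord]) auto
  finally show "(\<lambda>\<omega>. window \<omega> a K) -` {xs} \<inter> space (iid \<nu>) \<in> sets (iid \<nu>)" .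
qed auto

lemma emeasure_iid:
  "emeasure (iid \<nu>) {\<omega>. \<forall>i<K. \<omega> (a + int i) \<in> B i} = (\<Prod>i<K. emeasure (measure_pmf \<nu>) (B i))"
proof -
  interpret product_prob_space "\<lambda>_. measure_pmf \<nu>" "UNIV :: int set" by unfold_locales
  have "emeasure (iid \<nu>) {\<omega>. \<forall>i<K. \<omega> (a + int i) \<in> B i} =
    emeasure (iid \<nu>) {\<omega> \<in> space (iid \<nu>). \<forall>n \<in> (\<lambda>i. a + int i) ` {..<K}. \<omega> n \<in> B (nat (n - a))}"
    by (rule arg_cong[where f = "emeasure _"]) auto
  also have "\<dots> = (\<Prod>n\<in>(\<lambda>i. a + int i) ` {..<K}. emeasure (measure_pmf \<nu>) (B (nat (n - a))))"
    unfolding iid_def by (rule emeasure_PiM_Collect) auto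
  also have "\<dots> = (\<Prod>i<K. emeasure (measure_pmf \<nu>) (B i))"
    by (subst prod.reindex) (auto simp: inj_on_def)
  finally show ?thesis .
qed

lemma pmf_replicate_pmf:
  "pmf (replicate_pmf K \<nu>) xs = (if length xs = K then \<Prod>i<K. pmf \<nu> (xs ! i) else 0)"
proof (induction K arbitrary: xs)
  case (Suc K)
  have eq: "replicate_pmf (Suc K) \<nu> = map_pmf (\<lambda>(x, xs). x # xs) (pair_pmf \<nu> (replicate_pmf K \<nu>))"
    by (simp add: pair_pmf_def map_pmf_def bind_assoc_pmf bind_return_pmf)
  show ?case
  proof (cases xs)
    case Nil
    thus ?thesis unfolding eq by (subst pmf_map_outside) auto
  next
    case (Cons y ys)
    have "pmf (replicate_pmf (Suc K) \<nu>) xs = pmf (pair_pmf \<nu> (replicate_pmf K \<nu>)) (y, ys)"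
      unfolding eq Cons using pmf_map_inj'[of "\<lambda>(x, xs). x # xs" _ "(y, ys)"] by (simp add: inj_def)
    thus ?thesis using Suc[of ys] by (simp add: Cons pmf_pair prod.lessThan_Suc_shift del: prod.lessThan_Suc replicate_pmf.simps)
  qed
qed auto

lemma distr_window:
  "distr (iid \<nu>) (count_space UNIV) (\<lambda>\<omega>. window \<omega> a K) = measure_pmf (replicate_pmf K (\<nu> :: 'a :: countable pmf))"
proof (rule measure_eqI_countable[of _ UNIV])
  fix xs :: "'a list"
  have "emeasure (distr (iid \<nu>) (count_space UNIV) (\<lambda>\<omega>. window \<omega> a K)) {xs} =
     emeasure (iid \<nu>) {\<omega>. window \<omega> a K = xs}"
    by (subst emeasure_distr) (auto intro: arg_cong[where f = "emeasure _"])
  also have "\<dots> = ennreal (pmf (replicate_pmf K \<nu>) xs)"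
  proof (cases "length xs = K")
    case True
    hence "{\<omega>. window \<omega> a K = xs} = {\<omega>. \<forall>i<K. \<omega> (a + int i) \<in> {xs ! i}}"
      by (auto simp: list_eq_iff_nth_eq)
    thus ?thesis using True
      by (simp only: emeasure_iid) (simp add: pmf_replicate_pmf emeasure_pmf_single prod_ennreal)
  next
    case False
    hence "{\<omega>. window \<omega> a K = xs} = {}" by auto
    thus ?thesis using False by (simp add: pmf_replicate_pmf)
  qed
  finally show "emeasure (distr (iid \<nu>) (count_space UNIV) (\<lambda>\<omega>. window \<omega> a K)) {xs} =
     emeasure (replicate_pmf K \<nu>) {xs}" by (simp add: emeasure_pmf_single)
qed auto

lemma measure_window:
  "measure (iid \<nu>) {\<omega>. P (window \<omega> a K)} = measure_pmf.prob (replicate_pmf K (\<nu> :: 'a :: countable pmf)) {es. P es}"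
  unfolding distr_window[symmetric, of _ _ a] by (subst measure_distr) (auto simp: vimage_def)

lemma space_proc_space [simp]: "space proc_space = UNIV"
  by (auto simp: proc_space_def space_PiM PiE_def)

lemma measurable_proc_coord [measurable]: "(\<lambda>f. f n) \<in> borel_measurable proc_space"
  unfolding proc_space_def by measurable

lemma measurable_procI:
  assumes "\<And>n. (\<lambda>x. f x n) \<in> borel_measurable M"
  shows "f \<in> measurable M proc_space"
  unfolding proc_space_def using assms by (intro measurable_PiM_single') auto

text \<open>Conditions on consecutive times suffice, since gaps between arbitrary finitely many
  times can be filled with \<open>UNIV\<close>.\<close>

definition cylinder :: "int \<Rightarrow> nat \<Rightarrow> (nat \<Rightarrow> real set) \<Rightarrow> (nat \<Rightarrow> real set) \<Rightarrow> ((int \<Rightarrow> real) \<times> (int \<Rightarrow> real)) set" where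
  "cylinder a K B C = {x. \<forall>i<K. fst x (a + int i) \<in> B i \<and> snd x (a + int i) \<in> C i}"

lemma cylinder_Times:
  "cylinder a K B C = {f. \<forall>i<K. f (a + int i) \<in> B i} \<times> {f. \<forall>i<K. f (a + int i) \<in> C i}"
  by (auto simp: cylinder_def)

lemma sets_proc_cylinder:
  assumes "\<And>i. B i \<in> sets borel"
  shows "{f. \<forall>i<K. f (a + int i) \<in> B i} \<in> sets proc_space"
proof -
  have "{f \<in> space proc_space. \<forall>i\<in>{..<K}. f (a + int i) \<in> B i} \<in> sets proc_space"
    using assms by (intro sets.sets_Collect_finite_All measurable_sets_Collect[OF measurable_proc_coord]) auto
  thus ?thesis by (simp add: Ball_def)
qed

text \<open>Uniqueness is available for a single infinite product. So the pair of paths is recoded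
  by \<open>\<Psi>\<close> as one family indexed by \<open>bool \<times> int\<close>, with inverse
  \<open>\<Phi>\<close>, and finite index sets are enlarged to windows.\<close>

lemma measure_eq_cylinder:
  assumes P: "sets P = sets (proc_space \<Otimes>\<^sub>M proc_space)" and Q: "sets Q = sets (proc_space \<Otimes>\<^sub>M proc_space)"
    and fin: "prob_space P"
    and eq: "\<And>a K B C. (\<And>i. B i \<in> sets borel) \<Longrightarrow> (\<And>i. C i \<in> sets borel) \<Longrightarrow>
       emeasure P (cylinder a K B C) = emeasure Q (cylinder a K B C)"
  shows "P = Q"
proof -
  define I where "I = PiM (UNIV :: (bool \<times> int) set) (\<lambda>_. borel :: real measure)"
  define \<Psi> where "\<Psi> x = (\<lambda>(b, n). if b then fst x n else snd x n)" for x :: "(int \<Rightarrow> real) \<times> (int \<Rightarrow> real)"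
  define \<Phi> where "\<Phi> h = ((\<lambda>n. h (True, n)), (\<lambda>n. h (False, n)))" for h :: "bool \<times> int \<Rightarrow> real"
  have \<Psi>: "\<Psi> \<in> measurable (proc_space \<Otimes>\<^sub>M proc_space) I"
  proof -
    have "(\<lambda>x. \<Psi> x bn) \<in> borel_measurable (proc_space \<Otimes>\<^sub>M proc_space)" for bn
      unfolding \<Psi>_def by (cases bn; cases "fst bn") auto
    thus ?thesis unfolding I_def by (intro measurable_PiM_single') auto
  qed
  have \<Phi>: "\<Phi> \<in> measurable I (proc_space \<Otimes>\<^sub>M proc_space)"
    unfolding \<Phi>_def I_def by (intro measurable_Pair measurable_procI) measurable
  have id: "\<Phi> (\<Psi> x) = x" for x by (simp add: \<Phi>_def \<Psi>_def)
  have recover: "distr (distr M I \<Psi>) (proc_space \<Otimes>\<^sub>M proc_space) \<Phi> = M"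
    if M: "sets M = sets (proc_space \<Otimes>\<^sub>M proc_space)" for M
  proof -
    have "\<Psi> \<in> measurable M I" using \<Psi> M by (simp cong: measurable_cong_sets)
    hence "distr (distr M I \<Psi>) (proc_space \<Otimes>\<^sub>M proc_space) \<Phi> = distr M (proc_space \<Otimes>\<^sub>M proc_space) (\<lambda>x. x)"
      using \<Phi> by (simp add: distr_distr o_def id)
    also have "\<dots> = M" using M by (intro distr_id2) simp
    finally show ?thesis .
  qed
  have "distr P I \<Psi> = distr Q I \<Psi>"
  proof (rule measure_eqI_PiM_infinite)
    fix A :: "bool \<times> int \<Rightarrow> real set" and J :: "(bool \<times> int) set"
    assume J: "finite J" and A: "\<And>i. i \<in> J \<Longrightarrow> A i \<in> sets borel"
    define N where "N = Max (insert 0 ((\<lambda>j. \<bar>snd j\<bar>) ` J))"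
    define B where "B b i = (if (b, - N + int i) \<in> J then A (b, - N + int i) else UNIV)" for b i
    have N: "\<bar>n\<bar> \<le> N" if "(b, n) \<in> J" for b n
      unfolding N_def using J that by (intro Max_ge) force+
    have *: "\<Psi> -` prod_emb UNIV (\<lambda>_. borel) J (Pi\<^sub>E J A) = cylinder (- N) (nat (2 * N + 1)) (B True) (B False)"
    proof (intro set_eqI iffI)
      fix x assume "x \<in> \<Psi> -` prod_emb UNIV (\<lambda>_. borel) J (Pi\<^sub>E J A)"
      hence "\<forall>j\<in>J. \<Psi> x j \<in> A j" by (auto simp: prod_emb_def PiE_iff)
      thus "x \<in> cylinder (- N) (nat (2 * N + 1)) (B True) (B False)"
        by (force simp: cylinder_def B_def \<Psi>_def)
    next
      fix x assume x: "x \<in> cylinder (- N) (nat (2 * N + 1)) (B True) (B False)"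
      have "\<Psi> x j \<in> A j" if j: "j \<in> J" for j
      proof -
        obtain b n where bn: "j = (b, n)" by (cases j)
        have "- N \<le> n" "n \<le> N" using N[of b n] j bn by auto
        hence "nat (n + N) < nat (2 * N + 1)" "- N + int (nat (n + N)) = n" by auto
        thus ?thesis using x j bn unfolding cylinder_def B_def \<Psi>_def
          by (cases b) (auto dest!: spec[of _ "nat (n + N)"])
      qed
      thus "x \<in> \<Psi> -` prod_emb UNIV (\<lambda>_. borel) J (Pi\<^sub>E J A)"
        by (auto simp: prod_emb_def PiE_iff)
    qed
    have B: "B b i \<in> sets borel" for b i using A by (auto simp: B_def)
    have emb: "prod_emb UNIV (\<lambda>_. borel) J (Pi\<^sub>E J A) \<in> sets I"
      unfolding I_def using J A by (intro sets_PiM_I) auto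
    have "emeasure (distr M I \<Psi>) (prod_emb UNIV (\<lambda>_. borel) J (Pi\<^sub>E J A)) =
        emeasure M (cylinder (- N) (nat (2 * N + 1)) (B True) (B False))"
      if M: "sets M = sets (proc_space \<Otimes>\<^sub>M proc_space)" for M
    proof -
      have "space M = UNIV" using sets_eq_imp_space_eq[OF M] by (simp add: space_pair_measure)
      moreover have "\<Psi> \<in> measurable M I" using \<Psi> M by (simp cong: measurable_cong_sets)
      ultimately show ?thesis using emb by (simp add: emeasure_distr *)
    qed
    thus "emeasure (distr P I \<Psi>) (prod_emb UNIV (\<lambda>_. borel) J (Pi\<^sub>E J A)) =
        emeasure (distr Q I \<Psi>) (prod_emb UNIV (\<lambda>_. borel) J (Pi\<^sub>E J A))"
      using eq[OF B B] P Q by simp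
  next
    have "\<Psi> \<in> measurable P I" using \<Psi> P by (simp cong: measurable_cong_sets)
    thus "finite_measure (distr P I \<Psi>)"
      using prob_space.prob_space_distr[OF fin] prob_space.finite_measure by blast
  qed (auto simp: I_def)
  thus ?thesis using recover[OF P] recover[OF Q] by metis
qed

section \<open>Finite-dimensional laws of Bernoulli-geometric sequences\<close>

lemma emeasure_bergeom_seq:
  assumes "\<And>i. B i \<in> sets borel"
  shows "emeasure (bergeom_seq p \<alpha>) {f. \<forall>i<K. f (a + int i) \<in> B i} =
    (\<Prod>i<K. emeasure (bergeom_pmf p \<alpha>) (real -` B i))"
proof -
  interpret b: prob_space "bergeom p \<alpha>"
    unfolding bergeom_def by (intro prob_space.prob_space_distr prob_space_measure_pmf) simp
  interpret product_prob_space "\<lambda>_. bergeom p \<alpha>" "UNIV :: int set" by unfold_locales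
  have space: "space (bergeom_seq p \<alpha>) = UNIV"
    using sets_eq_imp_space_eq[OF sets_bergeom_seq] by simp
  have "emeasure (bergeom_seq p \<alpha>) {f. \<forall>i<K. f (a + int i) \<in> B i} =
    emeasure (bergeom_seq p \<alpha>) {\<omega> \<in> space (bergeom_seq p \<alpha>). \<forall>n \<in> (\<lambda>i. a + int i) ` {..<K}. \<omega> n \<in> B (nat (n - a))}"
    unfolding space by (rule arg_cong[where f = "emeasure _"]) auto
  also have "\<dots> = (\<Prod>n\<in>(\<lambda>i. a + int i) ` {..<K}. emeasure (bergeom p \<alpha>) (B (nat (n - a))))"
    unfolding bergeom_seq_def by (rule emeasure_PiM_Collect) (use assms in \<open>auto simp: bergeom_def\<close>)
  also have "\<dots> = (\<Prod>i<K. emeasure (bergeom p \<alpha>) (B i))"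
    by (subst prod.reindex) (auto simp: inj_on_def)
  also have "\<dots> = (\<Prod>i<K. emeasure (bergeom_pmf p \<alpha>) (real -` B i))"
    unfolding bergeom_def using assms by (intro prod.cong) (auto simp: emeasure_distr)
  finally show ?thesis .
qed

lemma emeasure_bergeom_pair:
  assumes "\<And>i. B i \<in> sets borel" "\<And>i. C i \<in> sets borel"
  shows "emeasure (bergeom_seq p \<alpha> \<Otimes>\<^sub>M bergeom_seq q \<beta>) (cylinder a K B C) =
    (\<Prod>i<K. emeasure (bergeom_pmf p \<alpha>) (real -` B i) * emeasure (bergeom_pmf q \<beta>) (real -` C i))"
proof -
  interpret q: prob_space "bergeom_seq q \<beta>" by (rule prob_space_bergeom_seq)
  show ?thesis
    unfolding cylinder_Times prod.distrib using sets_proc_cylinder[of B K a] sets_proc_cylinder[of C K a] assms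
    by (subst q.emeasure_pair_measure_Times) (auto simp: sets_bergeom_seq emeasure_bergeom_seq)
qed

text \<open>Brings the target law into the form in which finite runs of the queue deliver
  it.\<close>

lemma emeasure_bergeom_pair_list:
  assumes "\<And>i. B i \<in> sets borel" "\<And>i. C i \<in> sets borel"
  shows "emeasure (bergeom_seq p \<alpha> \<Otimes>\<^sub>M bergeom_seq q \<beta>) (cylinder a K B C) =
    emeasure (replicate_pmf K (pair_pmf (bergeom_pmf p \<alpha>) (bergeom_pmf q \<beta>)))
      {os. \<forall>i<K. real (fst (os ! i)) \<in> B i \<and> real (snd (os ! i)) \<in> C i}"
proof -
  let ?os = "pair_pmf (bergeom_pmf p \<alpha>) (bergeom_pmf q \<beta>)"
  have "emeasure (bergeom_seq p \<alpha> \<Otimes>\<^sub>M bergeom_seq q \<beta>) (cylinder a K B C) =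
      (\<Prod>i<K. emeasure ?os ((real -` B i) \<times> (real -` C i)))"
    unfolding emeasure_bergeom_pair[OF assms]
    by (simp add: measure_pmf.emeasure_eq_measure measure_pmf_prob_product ennreal_mult)
  also have "\<dots> = emeasure (iid ?os) {\<omega>. \<forall>i<K. \<omega> (a + int i) \<in> (real -` B i) \<times> (real -` C i)}"
    by (rule emeasure_iid[symmetric])
  also have "\<dots> = emeasure (distr (iid ?os) (count_space UNIV) (\<lambda>\<omega>. window \<omega> a K))
       {os. \<forall>i<K. real (fst (os ! i)) \<in> B i \<and> real (snd (os ! i)) \<in> C i}"
    by (subst emeasure_distr) (auto intro!: arg_cong[where f = "emeasure _"] simp: mem_Times_iff)
  finally show ?thesis unfolding distr_window .
qed

lemma (in prob_space) tendsto_prob_AE: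
  assumes [measurable]: "\<And>N. E N \<in> events" "E' \<in> events"
    and ev: "AE \<omega> in M. \<forall>\<^sub>F N in sequentially. \<omega> \<in> E N \<longleftrightarrow> \<omega> \<in> E'"
  shows "(\<lambda>N. prob (E N)) \<longlonglongrightarrow> prob E'"
proof -
  have "(\<lambda>N. integral\<^sup>L M (indicat_real (E N))) \<longlonglongrightarrow> integral\<^sup>L M (indicat_real E')"
  proof (rule integral_dominated_convergence[where w = "\<lambda>_. 1"])
    show "AE \<omega> in M. (\<lambda>N. indicat_real (E N) \<omega>) \<longlonglongrightarrow> indicat_real E' \<omega>"
      using ev
    proof eventually_elim
      case (elim \<omega>)
      show ?case by (rule tendsto_eventually, rule eventually_mono[OF elim]) (auto simp: indicator_def)
    qed
  qed (auto simp: indicator_def)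
  thus ?thesis by simp
qed

section \<open>The queue driven by an i.i.d. sequence\<close>

text \<open>The queue started at \<open>x\<close> follows the free walk until it is emptied, and
  from then on coincides with the one started at 0.\<close>

lemma foldl_queue_step_max:
  "real (foldl queue_step x es) =
     max (real x + (\<Sum>e\<leftarrow>es. real (fst e) - real (fst (snd e)))) (real (foldl queue_step 0 es))"
proof (induction es rule: rev_induct)
  case (snoc e es)
  obtain a s v where e: "e = (a, s, v)" by (cases e)
  have step: "real (queue_step y e) = max 0 (real y + real a - real s)" for y
    by (simp add: e of_nat_diff max_def)
  show ?case using snoc by (simp add: step) (simp add: e)
qed simp

definition arr_of :: "(int \<Rightarrow> nat \<times> nat \<times> nat \<times> nat) \<Rightarrow> int \<Rightarrow> real" where
  "arr_of \<omega> n = real (fst (\<omega> n))"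

definition srv_of :: "(int \<Rightarrow> nat \<times> nat \<times> nat \<times> nat) \<Rightarrow> int \<Rightarrow> real" where
  "srv_of \<omega> n = real (fst (snd (\<omega> n)))"

abbreviation queue_of :: "(int \<Rightarrow> nat \<times> nat \<times> nat \<times> nat) \<Rightarrow> int \<Rightarrow> ereal" where
  "queue_of \<omega> \<equiv> queue_length (arr_of \<omega>) (srv_of \<omega>)"

abbreviation dep_of :: "(int \<Rightarrow> nat \<times> nat \<times> nat \<times> nat) \<Rightarrow> int \<Rightarrow> real" where
  "dep_of \<omega> \<equiv> departure (arr_of \<omega>) (srv_of \<omega>)"

text \<open>The queue length at time \<open>n\<close> of the system that is empty at time \<open>n - N\<close>.\<close>

definition late_queue :: "(int \<Rightarrow> nat \<times> nat \<times> nat \<times> nat) \<Rightarrow> int \<Rightarrow> nat \<Rightarrow> nat" where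
  "late_queue \<omega> n N = foldl queue_step 0 (window \<omega> (n - int N) N)"

lemma sum_window:
  "(\<Sum>e\<leftarrow>window \<omega> a K. real (fst e) - real (fst (snd e))) = (\<Sum>r=a..<a + int K. arr_of \<omega> r - srv_of \<omega> r)"
proof (induction K)
  case (Suc K)
  have *: "a + int (Suc K) = (a + int K) + 1" by simp
  show ?case unfolding * using Suc
    by (simp add: window_snoc sum_int_Suc) (simp add: arr_of_def srv_of_def)
qed simp

lemma late_queue_0 [simp]: "late_queue \<omega> n 0 = 0"
  by (simp add: late_queue_def)

lemma late_queue_Suc_start:
  "late_queue \<omega> n (Suc N) = foldl queue_step (queue_step 0 (\<omega> (n - int (Suc N)))) (window \<omega> (n - int N) N)"
  unfolding late_queue_def window_Cons by (simp add: algebra_simps)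

lemma late_queue_Suc_end:
  "late_queue \<omega> (n + 1) (Suc N) = queue_step (late_queue \<omega> n N) (\<omega> n)"
  unfolding late_queue_def window_snoc by simp

lemma incseq_late_queue: "incseq (late_queue \<omega> n)"
proof (rule incseq_SucI)
  fix N
  show "late_queue \<omega> n N \<le> late_queue \<omega> n (Suc N)"
    unfolding late_queue_Suc_start unfolding late_queue_def by (rule foldl_queue_step_mono) simp
qed

text \<open>Starting one slot earlier adds one starting time to the running maximum. The middle
  entry comes from the truncation at 0 in the first slot.\<close>

lemma late_queue_Suc_max:
  "real (late_queue \<omega> n (Suc N)) = Max {\<Sum>r=n - int (Suc N)..<n. arr_of \<omega> r - srv_of \<omega> r,
     \<Sum>r=n - int N..<n. arr_of \<omega> r - srv_of \<omega> r, real (late_queue \<omega> n N)}"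
proof -
  define k where "k = n - int (Suc N)"
  have step: "real (queue_step 0 (\<omega> k)) = max 0 (arr_of \<omega> k - srv_of \<omega> k)"
    by (cases "\<omega> k") (simp add: arr_of_def srv_of_def of_nat_diff max_def)
  have k1: "n - int N = k + 1" by (simp add: k_def)
  have "(\<Sum>r=k..<n. arr_of \<omega> r - srv_of \<omega> r) =
      arr_of \<omega> k - srv_of \<omega> k + (\<Sum>r=k+1..<n. arr_of \<omega> r - srv_of \<omega> r)"
    using sum_int_split[of k "k+1" n "\<lambda>r. arr_of \<omega> r - srv_of \<omega> r"]
      sum_int_Suc[of k k "\<lambda>r. arr_of \<omega> r - srv_of \<omega> r"] by (simp add: k_def)
  moreover have "real (late_queue \<omega> n (Suc N)) =
      max (max 0 (arr_of \<omega> k - srv_of \<omega> k) + (\<Sum>r=k+1..<n. arr_of \<omega> r - srv_of \<omega> r)) (real (late_queue \<omega> n N))"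
    unfolding late_queue_Suc_start
    by (subst foldl_queue_step_max) (simp only: sum_window k_def[symmetric] step, simp add: k_def late_queue_def)
  ultimately show ?thesis unfolding k_def[symmetric] k1 by auto
qed

lemma late_queue_upper:
  assumes "k \<le> N"
  shows "(\<Sum>r=n - int k..<n. arr_of \<omega> r - srv_of \<omega> r) \<le> real (late_queue \<omega> n N)"
proof -
  have "(\<Sum>r=n - int k..<n. arr_of \<omega> r - srv_of \<omega> r) \<le> real (late_queue \<omega> n k)"
  proof (cases k)
    case (Suc j)
    show ?thesis unfolding Suc late_queue_Suc_max by simp
  qed simp
  also have "\<dots> \<le> real (late_queue \<omega> n N)"
    using incseq_late_queue assms by (auto simp: incseq_def)
  finally show ?thesis .
qed

lemma late_queue_attained:
  "\<exists>i\<le>n. real (late_queue \<omega> n N) = (\<Sum>r=i..<n. arr_of \<omega> r - srv_of \<omega> r)"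
proof (induction N)
  case 0
  show ?case by (intro exI[of _ n]) simp
next
  case (Suc N)
  have "real (late_queue \<omega> n (Suc N)) \<in> {\<Sum>r=n - int (Suc N)..<n. arr_of \<omega> r - srv_of \<omega> r,
     \<Sum>r=n - int N..<n. arr_of \<omega> r - srv_of \<omega> r, real (late_queue \<omega> n N)}"
    unfolding late_queue_Suc_max by (rule Max_in) auto
  thus ?case using Suc by (elim insertE) (auto intro: exI[of _ "n - int (Suc N)"] exI[of _ "n - int N"])
qed

lemma queue_of_SUP: "queue_of \<omega> n = (SUP N. ereal (real (late_queue \<omega> n N)))"
proof (rule antisym)
  show "queue_of \<omega> n \<le> (SUP N. ereal (real (late_queue \<omega> n N)))"
    unfolding queue_length_altdef
  proof (rule SUP_least)
    fix k assume "k \<in> {..n}"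
    hence "k = n - int (nat (n - k))" by simp
    thus "ereal (\<Sum>r=k..<n. arr_of \<omega> r - srv_of \<omega> r) \<le> (SUP N. ereal (real (late_queue \<omega> n N)))"
      using late_queue_upper[of "nat (n - k)" "nat (n - k)" \<omega> n]
      by (intro SUP_upper2[of "nat (n - k)"]) auto
  qed
  show "(SUP N. ereal (real (late_queue \<omega> n N))) \<le> queue_of \<omega> n"
    unfolding queue_length_altdef
  proof (rule SUP_least)
    fix N
    obtain i where "i \<le> n" "real (late_queue \<omega> n N) = (\<Sum>r=i..<n. arr_of \<omega> r - srv_of \<omega> r)"
      using late_queue_attained by blast
    thus "ereal (real (late_queue \<omega> n N)) \<le> (SUP k\<in>{..n}. ereal (\<Sum>r=k..<n. arr_of \<omega> r - srv_of \<omega> r))"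
      by (intro SUP_upper2[of i]) auto
  qed
qed

text \<open>The late queues form an increasing sequence of naturals, which is either eventually
  constant or unbounded. So this expresses finiteness of the queue and records its length as a
  natural number.\<close>

definition settled :: "(int \<Rightarrow> nat \<times> nat \<times> nat \<times> nat) \<Rightarrow> int \<Rightarrow> nat \<Rightarrow> bool" where
  "settled \<omega> n x \<longleftrightarrow> (\<forall>\<^sub>F N in sequentially. late_queue \<omega> n N = x)"

lemma settled_queue:
  assumes "settled \<omega> n x"
  shows "queue_of \<omega> n = ereal (real x)"
proof -
  have "(\<lambda>N. ereal (real (late_queue \<omega> n N))) \<longlonglongrightarrow> ereal (real x)"
    using assms unfolding settled_def by (intro tendsto_eventually) (auto elim: eventually_mono)
  moreover have "(\<lambda>N. ereal (real (late_queue \<omega> n N))) \<longlonglongrightarrow> queue_of \<omega> n"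
    unfolding queue_of_SUP using incseq_late_queue
    by (intro LIMSEQ_SUP) (auto simp: incseq_def)
  ultimately show ?thesis using LIMSEQ_unique by blast
qed

lemma bounded_settled:
  assumes "\<And>N. late_queue \<omega> n N \<le> B"
  shows "\<exists>x. settled \<omega> n x"
proof -
  have fin: "finite (range (late_queue \<omega> n))"
    using assms by (auto intro: finite_subset[of _ "{..B}"])
  have "Max (range (late_queue \<omega> n)) \<in> range (late_queue \<omega> n)" using fin by (intro Max_in) auto
  then obtain N where N: "Max (range (late_queue \<omega> n)) = late_queue \<omega> n N" by auto
  have "late_queue \<omega> n M = late_queue \<omega> n N" if "N \<le> M" for M
  proof (rule antisym)
    show "late_queue \<omega> n M \<le> late_queue \<omega> n N" unfolding N[symmetric] using fin by (intro Max_ge) auto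
    show "late_queue \<omega> n N \<le> late_queue \<omega> n M" using incseq_late_queue that by (auto simp: incseq_def)
  qed
  thus ?thesis unfolding settled_def eventually_sequentially by blast
qed

lemma settled_bounded: "settled \<omega> n x \<Longrightarrow> late_queue \<omega> n N \<le> x"
proof -
  assume "settled \<omega> n x"
  then obtain M where M: "\<And>N. M \<le> N \<Longrightarrow> late_queue \<omega> n N = x"
    by (auto simp: settled_def eventually_sequentially)
  have "late_queue \<omega> n N \<le> late_queue \<omega> n (max M N)"
    using incseq_late_queue by (auto simp: incseq_def)
  thus ?thesis using M[of "max M N"] by simp
qed

lemma finite_queue_settled:
  assumes "queue_of \<omega> n \<noteq> \<infinity>"
  shows "\<exists>x. settled \<omega> n x"
proof -
  obtain b where b: "queue_of \<omega> n = ereal b"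
    using assms queue_length_nonneg[of "arr_of \<omega>" "srv_of \<omega>" n] by (cases "queue_of \<omega> n") auto
  have "ereal (real (late_queue \<omega> n N)) \<le> ereal b" for N
    unfolding b[symmetric] queue_of_SUP by (rule SUP_upper) simp
  hence "late_queue \<omega> n N \<le> nat \<lceil>b\<rceil>" for N
    by (metis ereal_less_eq(3) nat_ceiling_le_eq of_nat_le_iff order_trans real_nat_ceiling_ge)
  thus ?thesis by (rule bounded_settled)
qed

lemma settled_step:
  assumes "settled \<omega> n x"
  shows "settled \<omega> (n + 1) (queue_step x (\<omega> n))"
proof -
  have "\<forall>\<^sub>F N in sequentially. late_queue \<omega> (n + 1) (Suc N) = queue_step x (\<omega> n)"
    using assms unfolding settled_def late_queue_Suc_end by eventually_elim simp
  thus ?thesis unfolding settled_def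
    by (subst (asm) eventually_sequentially_Suc[of "\<lambda>N. late_queue \<omega> (n + 1) N = _"])
qed

text \<open>A slot removes at most its service, so a queue that is finite afterwards was finite
  before. Hence finiteness holds at all times or at none.\<close>

lemma settled_pred:
  assumes "settled \<omega> (n + 1) x"
  shows "\<exists>y. settled \<omega> n y"
proof (rule bounded_settled)
  fix N
  obtain a s v where e: "\<omega> n = (a, s, v)" by (cases "\<omega> n")
  have "queue_step (late_queue \<omega> n N) (\<omega> n) \<le> x"
    using settled_bounded[OF assms, of "Suc N"] by (simp only: late_queue_Suc_end)
  thus "late_queue \<omega> n N \<le> x + fst (snd (\<omega> n))" by (simp add: e)
qed

lemma settled_everywhere:
  assumes "settled \<omega> n x"
  shows "\<exists>y. settled \<omega> m y"
proof (cases "n \<le> m")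
  case True
  thus ?thesis
  proof (induction m rule: int_ge_induct)
    case (step m)
    thus ?case using settled_step by blast
  qed (use assms in blast)
next
  case False
  hence "m \<le> n" by simp
  thus ?thesis
  proof (induction m rule: int_le_induct)
    case (step m)
    thus ?case using settled_pred[of \<omega> "m - 1"] by auto
  qed (use assms in blast)
qed

lemma settled_solution:
  assumes "settled \<omega> n x"
  shows "\<exists>X. queue_solution (arr_of \<omega>) (srv_of \<omega>) X"
proof -
  have "\<exists>X. \<forall>m. settled \<omega> m (X m)" using settled_everywhere[OF assms] by metis
  then obtain X where X: "\<And>m. settled \<omega> m (X m)" by blast
  have "queue_solution (arr_of \<omega>) (srv_of \<omega>) (\<lambda>m. real (X m))"
    unfolding queue_solution_def
  proof (intro allI conjI impI)
    fix m i :: int assume "i \<le> m"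
    hence "i = m - int (nat (m - i))" by simp
    hence "(\<Sum>r=i..<m. arr_of \<omega> r - srv_of \<omega> r) \<le> real (late_queue \<omega> m (nat (m - i)))"
      using late_queue_upper[of "nat (m - i)" "nat (m - i)" \<omega> m] by simp
    also have "\<dots> \<le> real (X m)" using settled_bounded[OF X[of m]] by simp
    finally show "(\<Sum>r=i..<m. arr_of \<omega> r - srv_of \<omega> r) \<le> real (X m)" .
  next
    fix m
    obtain N where "late_queue \<omega> m N = X m"
      using X[of m] by (auto simp: settled_def eventually_sequentially)
    thus "\<exists>i\<le>m. real (X m) = (\<Sum>r=i..<m. arr_of \<omega> r - srv_of \<omega> r)"
      using late_queue_attained[of m \<omega> N] by simp
  qed
  thus ?thesis by blast
qed

lemma queue_of_infinite_all:
  assumes "queue_of \<omega> n = \<infinity>"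
  shows "queue_of \<omega> m = \<infinity>"
proof (rule ccontr)
  assume "queue_of \<omega> m \<noteq> \<infinity>"
  then obtain x where "settled \<omega> n x" using finite_queue_settled settled_everywhere by blast
  thus False using settled_queue assms by fastforce
qed

text \<open>An infinite queue is infinite at all times; then \<open>R\<close> is
  \<open>arr_of \<omega>\<close>, all services are used, and the two sides coincide. Otherwise
  \<open>departure_interchange\<close> applies.\<close>

lemma queue_interchange:
  assumes R: "\<And>n. arr_of \<omega> n \<le> R n" "\<And>n. 0 < queue_of \<omega> n \<Longrightarrow> R n = arr_of \<omega> n"
  shows "departure (departure A (arr_of \<omega>)) (srv_of \<omega>) n = departure (departure A R) (dep_of \<omega>) n"
proof (cases "queue_of \<omega> 0 = \<infinity>")
  case True
  have "R = arr_of \<omega>" using queue_of_infinite_all[OF True] R(2) by auto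
  moreover have "dep_of \<omega> = srv_of \<omega>"
    using queue_of_infinite_all[OF True] by (auto simp: departure_def)
  ultimately show ?thesis by simp
next
  case False
  then obtain X where X: "queue_solution (arr_of \<omega>) (srv_of \<omega>) X"
    using finite_queue_settled settled_solution by blast
  show ?thesis
    using R(2) by (intro departure_interchange[OF X R(1)]) (simp add: queue_length_solution[OF X])
qed

text \<open>The second component of \<open>queue_out\<close> along the path. Written with
  \<open>queue_of\<close>, it satisfies the hypotheses on \<open>R\<close> on every path, also where
  the queue is infinite.\<close>

definition rev_of :: "(int \<Rightarrow> nat \<times> nat \<times> nat \<times> nat) \<Rightarrow> int \<Rightarrow> real" where
  "rev_of \<omega> n = arr_of \<omega> n + (if queue_of \<omega> n = 0 then
     real (case \<omega> n of (a, s, v0, v1) \<Rightarrow> if 0 < a then v1 else v0) else 0)"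

lemma settled_foldl:
  assumes "settled \<omega> a x"
  shows "settled \<omega> (a + int i) (foldl queue_step x (window \<omega> a i))"
proof (induction i)
  case (Suc i)
  have *: "a + int (Suc i) = (a + int i) + 1" by simp
  show ?case unfolding * window_snoc using settled_step[OF Suc] by simp
qed (use assms in simp)

lemma settled_out:
  assumes "settled \<omega> n x"
  shows "dep_of \<omega> n = real (fst (queue_out x (\<omega> n)))" "rev_of \<omega> n = real (snd (queue_out x (\<omega> n)))"
  by (cases "\<omega> n"; simp add: departure_def rev_of_def settled_queue[OF assms] arr_of_def srv_of_def min_def)+

lemma settled_outs:
  assumes "settled \<omega> a x" "i < K"
  shows "dep_of \<omega> (a + int i) = real (fst (queue_outs x (window \<omega> a K) ! i))"
    "rev_of \<omega> (a + int i) = real (snd (queue_outs x (window \<omega> a K) ! i))"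
  using settled_out[OF settled_foldl[OF assms(1), of i]] assms(2)
  by (simp_all add: nth_queue_outs take_window)

lemma measurable_arr_of [measurable]: "(\<lambda>\<omega>. arr_of \<omega> n) \<in> borel_measurable (iid \<nu>)"
  unfolding arr_of_def by measurable

lemma measurable_srv_of [measurable]: "(\<lambda>\<omega>. srv_of \<omega> n) \<in> borel_measurable (iid \<nu>)"
  unfolding srv_of_def by measurable

lemma measurable_queue_of [measurable]: "(\<lambda>\<omega>. queue_of \<omega> n) \<in> borel_measurable (iid \<nu>)"
  unfolding queue_length_def by measurable

lemma measurable_dep_of [measurable]: "(\<lambda>\<omega>. dep_of \<omega> n) \<in> borel_measurable (iid \<nu>)"
  by (rule measurable_departure) measurable

lemma measurable_rev_of [measurable]: "(\<lambda>\<omega>. rev_of \<omega> n) \<in> borel_measurable (iid \<nu>)"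
  unfolding rev_of_def by measurable

lemma measurable_late_queue [measurable]: "(\<lambda>\<omega>. late_queue \<omega> n N) \<in> measurable (iid \<nu>) (count_space UNIV)"
  unfolding late_queue_def by measurable

lemma measurable_paths [measurable]:
  "arr_of \<in> measurable (iid \<nu>) proc_space" "srv_of \<in> measurable (iid \<nu>) proc_space"
  "(\<lambda>\<omega>. dep_of \<omega>) \<in> measurable (iid \<nu>) proc_space" "rev_of \<in> measurable (iid \<nu>) proc_space"
  by (auto intro!: measurable_procI)

lemma measure_late_queue:
  "measure (iid \<nu>) {\<omega>. P (late_queue \<omega> n N)} = measure_pmf.prob (replicate_pmf N \<nu>) {es. P (foldl queue_step 0 es)}"
  unfolding late_queue_def using measure_window[of \<nu> "\<lambda>es. P (foldl queue_step 0 es)"] by simp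

lemma sets_bergeom_pair:
  "sets (bergeom_seq p \<alpha> \<Otimes>\<^sub>M bergeom_seq q \<beta>) = sets (proc_space \<Otimes>\<^sub>M proc_space)"
  by (intro sets_pair_measure_cong sets_bergeom_seq)

lemma (in bergeom_pair) distr_arr_srv:
  "distr (iid noise) (proc_space \<Otimes>\<^sub>M proc_space) (\<lambda>\<omega>. (arr_of \<omega>, srv_of \<omega>)) =
     bergeom_seq p \<alpha> \<Otimes>\<^sub>M bergeom_seq q \<beta>"
proof (rule measure_eq_cylinder)
  fix a K and B C :: "nat \<Rightarrow> real set"
  assume BC: "\<And>i. B i \<in> sets borel" "\<And>i. C i \<in> sets borel"
  have cyl: "cylinder a K B C \<in> sets (proc_space \<Otimes>\<^sub>M proc_space)"
    unfolding cylinder_Times using BC by (intro pair_measureI sets_proc_cylinder)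
  have "emeasure (distr (iid noise) (proc_space \<Otimes>\<^sub>M proc_space) (\<lambda>\<omega>. (arr_of \<omega>, srv_of \<omega>))) (cylinder a K B C)
    = emeasure (iid noise) {\<omega>. \<forall>i<K. \<omega> (a + int i) \<in> (real -` B i) \<times> (real -` C i) \<times> UNIV}"
    using cyl by (subst emeasure_distr)
      (auto intro!: arg_cong[where f = "emeasure _"] simp: cylinder_def arr_of_def srv_of_def mem_Times_iff)
  also have "\<dots> = (\<Prod>i<K. emeasure noise ((real -` B i) \<times> (real -` C i) \<times> UNIV))"
    by (rule emeasure_iid)
  also have "\<dots> = (\<Prod>i<K. emeasure arr (real -` B i) * emeasure srv (real -` C i))"
    by (simp add: noise_def measure_pmf.emeasure_eq_measure measure_pmf_prob_product ennreal_mult)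
  finally show "emeasure (distr (iid noise) (proc_space \<Otimes>\<^sub>M proc_space) (\<lambda>\<omega>. (arr_of \<omega>, srv_of \<omega>))) (cylinder a K B C)
     = emeasure (bergeom_seq p \<alpha> \<Otimes>\<^sub>M bergeom_seq q \<beta>) (cylinder a K B C)"
    by (simp add: emeasure_bergeom_pair BC)
next
  show "prob_space (distr (iid noise) (proc_space \<Otimes>\<^sub>M proc_space) (\<lambda>\<omega>. (arr_of \<omega>, srv_of \<omega>)))"
    by (intro prob_space.prob_space_distr prob_space_iid) measurable
qed (simp_all add: sets_bergeom_pair)

section \<open>Burke's theorem on the whole time axis, stable load\<close>

context bergeom_stable
begin

text \<open>Starting empty is dominated by starting from \<open>stat\<close>, which the dynamics
  preserve.\<close>

lemma prob_foldl_zero_le: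
  "measure_pmf.prob (replicate_pmf N noise) {es. k < foldl queue_step 0 es} \<le> measure_pmf.prob stat {k<..}"
proof -
  have "measure_pmf.prob (replicate_pmf N noise) {es. k < foldl queue_step 0 es} =
     measure_pmf.prob (pair_pmf stat (replicate_pmf N noise)) (UNIV \<times> {es. k < foldl queue_step 0 es})"
    by (simp add: measure_pmf_prob_product)
  also have "\<dots> \<le> measure_pmf.prob (pair_pmf stat (replicate_pmf N noise)) {(x, es). k < foldl queue_step x es}"
    by (intro measure_pmf.finite_measure_mono) (auto intro: less_le_trans[OF _ foldl_queue_step_mono])
  also have "\<dots> = measure_pmf.prob (map_pmf (\<lambda>(x, es). foldl queue_step x es) (pair_pmf stat (replicate_pmf N noise))) {k<..}"
    by (auto simp: vimage_def split_beta intro!: arg_cong[where f = "measure _"])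
  finally show ?thesis unfolding stat_foldl .
qed

text \<open>The tail bound by \<open>stat\<close> is uniform in the starting time, so the increasing
  limit of the late queues is almost surely finite.\<close>

lemma AE_settled: "AE \<omega> in iid noise. \<exists>x. settled \<omega> n x"
proof -
  interpret prob_space "iid noise" by (rule prob_space_iid)
  have le: "prob {\<omega>. queue_of \<omega> n = \<infinity>} \<le> measure_pmf.prob stat {k<..}" for k
  proof -
    define E where "E N = {\<omega>. k < late_queue \<omega> n N}" for N
    have E: "E N \<in> events" for N
    proof -
      have "{\<omega> \<in> space (iid noise). k < late_queue \<omega> n N} \<in> events" by measurable
      thus ?thesis by (simp add: E_def)
    qed
    have inc: "incseq E"
      using incseq_late_queue unfolding incseq_def E_def by (auto intro: less_le_trans)
    have "{\<omega>. queue_of \<omega> n = \<infinity>} \<subseteq> (\<Union>N. E N)"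
    proof safe
      fix \<omega> assume q: "queue_of \<omega> n = \<infinity>"
      show "\<omega> \<in> (\<Union>N. E N)"
      proof (rule ccontr)
        assume "\<omega> \<notin> (\<Union>N. E N)"
        hence "late_queue \<omega> n N \<le> k" for N by (auto simp: E_def not_less)
        then obtain x where "settled \<omega> n x" using bounded_settled by blast
        thus False using q settled_queue by fastforce
      qed
    qed
    hence "prob {\<omega>. queue_of \<omega> n = \<infinity>} \<le> prob (\<Union>N. E N)"
      using E by (intro finite_measure_mono) auto
    also have "\<dots> \<le> measure_pmf.prob stat {k<..}"
    proof (rule LIMSEQ_le_const2)
      show "(\<lambda>N. prob (E N)) \<longlonglongrightarrow> prob (\<Union>N. E N)"
        using E inc by (intro finite_Lim_measure_incseq) auto
      show "\<exists>N0. \<forall>N\<ge>N0. prob (E N) \<le> measure_pmf.prob stat {k<..}"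
        unfolding E_def measure_late_queue using prob_foldl_zero_le by blast
    qed
    finally show ?thesis .
  qed
  have "(\<lambda>k::nat. measure_pmf.prob stat {k<..}) \<longlonglongrightarrow> measure_pmf.prob stat (\<Inter>k. {k<..})"
    by (intro measure_pmf.finite_Lim_measure_decseq) (auto simp: decseq_def)
  moreover have "(\<Inter>k. {k::nat<..}) = {}" by auto
  ultimately have "(\<lambda>k::nat. measure_pmf.prob stat {k<..}) \<longlonglongrightarrow> 0" by simp
  hence "prob {\<omega>. queue_of \<omega> n = \<infinity>} \<le> 0"
    by (rule LIMSEQ_le_const) (use le in blast)
  hence 0: "prob {\<omega> \<in> space (iid noise). queue_of \<omega> n = \<infinity>} = 0" by (simp add: measure_le_0_iff)
  have "AE \<omega> in iid noise. queue_of \<omega> n \<noteq> \<infinity>"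
  proof -
    have "{\<omega> \<in> space (iid noise). queue_of \<omega> n = \<infinity>} \<in> events" by measurable
    thus ?thesis using 0 by (simp only: prob_Collect_eq_0)
  qed
  thus ?thesis by eventually_elim (rule finite_queue_settled)
qed

text \<open>The queues started from 0 and from \<open>stat\<close> are driven by the same noise.
  Their outputs over the last \<open>K\<close> slots can differ only if their states after
  \<open>N\<close> slots do, which \<open>coalescence\<close> excludes in the limit.\<close>

lemma late_start_outs:
  "(\<lambda>N. measure_pmf.prob (pair_pmf (replicate_pmf N noise) (replicate_pmf K noise))
     {(es, fs). queue_outs (foldl queue_step 0 es) fs \<in> G})
   \<longlonglongrightarrow> measure_pmf.prob (replicate_pmf K (pair_pmf arr srv)) G"
proof (rule LIM_zero_cancel, rule tendsto_rabs_zero_cancel, rule tendsto_sandwich[OF _ _ tendsto_const coalescence])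
  have "\<bar>measure_pmf.prob (pair_pmf (replicate_pmf N noise) (replicate_pmf K noise))
       {(es, fs). queue_outs (foldl queue_step 0 es) fs \<in> G} -
     measure_pmf.prob (replicate_pmf K (pair_pmf arr srv)) G\<bar> \<le>
     measure_pmf.prob (pair_pmf stat (replicate_pmf N noise)) {(x, es). foldl queue_step 0 es \<noteq> foldl queue_step x es}" for N
  proof -
    define P where "P = pair_pmf stat (pair_pmf (replicate_pmf N noise) (replicate_pmf K noise))"
    define E0 where "E0 = {(x :: nat, es, fs). queue_outs (foldl queue_step 0 es) fs \<in> G}"
    define E1 where "E1 = {(x, es, fs). queue_outs (foldl queue_step x es) fs \<in> G}"
    define N' where "N' = {(x, es, fs :: (nat \<times> nat \<times> nat \<times> nat) list). foldl queue_step 0 es \<noteq> foldl queue_step x es}"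
    have 0: "measure_pmf.prob P E0 = measure_pmf.prob (pair_pmf (replicate_pmf N noise) (replicate_pmf K noise))
       {(es, fs). queue_outs (foldl queue_step 0 es) fs \<in> G}"
    proof -
      have "E0 = UNIV \<times> {(es, fs). queue_outs (foldl queue_step 0 es) fs \<in> G}" by (auto simp: E0_def)
      thus ?thesis unfolding P_def by (simp only: measure_pmf_prob_product[OF countableI_type countableI_type]) simp
    qed
    have 1: "measure_pmf.prob P E1 = measure_pmf.prob (replicate_pmf K (pair_pmf arr srv)) G"
    proof -
      have "map_pmf (\<lambda>(x, es, fs). queue_outs (foldl queue_step x es) fs) P =
        bind_pmf stat (\<lambda>x. bind_pmf (replicate_pmf N noise) (\<lambda>es.
           map_pmf (\<lambda>fs. queue_outs (foldl queue_step x es) fs) (replicate_pmf K noise)))"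
        by (simp add: P_def pair_pmf_def map_pmf_def bind_assoc_pmf bind_return_pmf)
      also have "\<dots> = bind_pmf stat (\<lambda>x. map_pmf (\<lambda>fs. queue_outs x fs) (replicate_pmf K noise))"
        using bind_queue_outs[of N "\<lambda>x _. map_pmf (\<lambda>fs. queue_outs x fs) (replicate_pmf K noise)"]
        by simp
      also have "\<dots> = replicate_pmf K (pair_pmf arr srv)"
        unfolding stat_queue_outs[symmetric]
        by (simp add: pair_pmf_def map_pmf_def bind_assoc_pmf bind_return_pmf)
      finally have "measure_pmf.prob (replicate_pmf K (pair_pmf arr srv)) G =
         measure_pmf.prob (map_pmf (\<lambda>(x, es, fs). queue_outs (foldl queue_step x es) fs) P) G" by simp
      thus ?thesis by (simp add: vimage_def split_beta' E1_def)
    qed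
    have 2: "measure_pmf.prob P N' =
      measure_pmf.prob (pair_pmf stat (replicate_pmf N noise)) {(x, es). foldl queue_step 0 es \<noteq> foldl queue_step x es}"
    proof -
      have "map_pmf (\<lambda>(x, es, fs). (x, es)) P = pair_pmf stat (replicate_pmf N noise)"
        by (simp add: P_def pair_pmf_def map_pmf_def bind_assoc_pmf bind_return_pmf)
      hence "measure_pmf.prob (pair_pmf stat (replicate_pmf N noise)) {(x, es). foldl queue_step 0 es \<noteq> foldl queue_step x es}
        = measure_pmf.prob (map_pmf (\<lambda>(x, es, fs). (x, es)) P) {(x, es). foldl queue_step 0 es \<noteq> foldl queue_step x es}"
        by simp
      thus ?thesis by (simp add: vimage_def split_beta' N'_def)
    qed
    have "measure_pmf.prob P E0 \<le> measure_pmf.prob P (E1 \<union> N')"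
      by (intro measure_pmf.finite_measure_mono) (auto simp: E0_def E1_def N'_def)
    also have "\<dots> \<le> measure_pmf.prob P E1 + measure_pmf.prob P N'"
      by (rule measure_Un_le) auto
    finally have 3: "measure_pmf.prob P E0 \<le> measure_pmf.prob P E1 + measure_pmf.prob P N'" .
    have "measure_pmf.prob P E1 \<le> measure_pmf.prob P (E0 \<union> N')"
      by (intro measure_pmf.finite_measure_mono) (auto simp: E0_def E1_def N'_def)
    also have "\<dots> \<le> measure_pmf.prob P E0 + measure_pmf.prob P N'"
      by (rule measure_Un_le) auto
    finally have "measure_pmf.prob P E1 \<le> measure_pmf.prob P E0 + measure_pmf.prob P N'" .
    thus ?thesis using 3 unfolding 0 1 2 by linarith
  qed
  thus "\<forall>\<^sub>F N in sequentially. \<bar>measure_pmf.prob (pair_pmf (replicate_pmf N noise) (replicate_pmf K noise))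
       {(es, fs). queue_outs (foldl queue_step 0 es) fs \<in> G} -
     measure_pmf.prob (replicate_pmf K (pair_pmf arr srv)) G\<bar> \<le>
     measure_pmf.prob (pair_pmf stat (replicate_pmf N noise)) {(x, es). foldl queue_step 0 es \<noteq> foldl queue_step x es}"
    by simp
qed simp

text \<open>On almost every path the late queue at the left end \<open>a\<close> of the window is
  eventually constant, so the outputs of the queue started empty at \<open>a - N\<close> are
  eventually the true ones. The limit of their laws comes from
  \<open>late_start_outs\<close>.\<close>

theorem distr_dep_rev:
  "distr (iid noise) (proc_space \<Otimes>\<^sub>M proc_space) (\<lambda>\<omega>. (dep_of \<omega>, rev_of \<omega>)) =
     bergeom_seq p \<alpha> \<Otimes>\<^sub>M bergeom_seq q \<beta>"
proof (rule measure_eq_cylinder)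
  interpret prob_space "iid noise" by (rule prob_space_iid)
  fix a K and B C :: "nat \<Rightarrow> real set"
  assume BC: "\<And>i. B i \<in> sets borel" "\<And>i. C i \<in> sets borel"
  have cyl: "cylinder a K B C \<in> sets (proc_space \<Otimes>\<^sub>M proc_space)"
    unfolding cylinder_Times using BC by (intro pair_measureI sets_proc_cylinder)
  define G where "G = {os. \<forall>i<K. real (fst (os ! i)) \<in> B i \<and> real (snd (os ! i)) \<in> C i}"
  define E where "E = {\<omega>. (dep_of \<omega>, rev_of \<omega>) \<in> cylinder a K B C}"
  define EN where "EN N = {\<omega>. queue_outs (late_queue \<omega> a N) (window \<omega> a K) \<in> G}" for N
  have dr: "(\<lambda>\<omega>. (dep_of \<omega>, rev_of \<omega>)) \<in> measurable (iid noise) (proc_space \<Otimes>\<^sub>M proc_space)"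
    by measurable
  have E: "E \<in> events"
    using measurable_sets[OF dr cyl] by (simp add: E_def vimage_def)
  have EN_eq: "EN N = {\<omega>. (\<lambda>l. queue_outs (foldl queue_step 0 (take N l)) (drop N l) \<in> G) (window \<omega> (a - int N) (N + K))}" for N
    by (simp add: EN_def late_queue_def window_append)
  have EN: "EN N \<in> events" for N
  proof -
    have "(\<lambda>\<omega>. window \<omega> (a - int N) (N + K)) -` {l. queue_outs (foldl queue_step 0 (take N l)) (drop N l) \<in> G} \<inter> space (iid noise) \<in> events"
      by (rule measurable_sets[OF measurable_window]) simp
    thus ?thesis by (simp add: EN_eq vimage_def)
  qed
  have "prob (EN N) = measure_pmf.prob (pair_pmf (replicate_pmf N noise) (replicate_pmf K noise))
     {(es, fs). queue_outs (foldl queue_step 0 es) fs \<in> G}" for N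
  proof -
    have "prob (EN N) = measure_pmf.prob (replicate_pmf (N + K) noise)
       {l. queue_outs (foldl queue_step 0 (take N l)) (drop N l) \<in> G}"
      unfolding EN_eq by (rule measure_window)
    also have "replicate_pmf (N + K) noise = map_pmf (\<lambda>(es, fs). es @ fs) (pair_pmf (replicate_pmf N noise) (replicate_pmf K noise))"
      by (simp add: replicate_pmf_distrib pair_pmf_def map_pmf_def bind_assoc_pmf bind_return_pmf)
    also have "measure_pmf.prob \<dots> {l. queue_outs (foldl queue_step 0 (take N l)) (drop N l) \<in> G} =
      measure_pmf.prob (pair_pmf (replicate_pmf N noise) (replicate_pmf K noise))
       {(es, fs). queue_outs (foldl queue_step 0 es) fs \<in> G}"
    proof (subst measure_map_pmf, rule measure_pmf.finite_measure_eq_AE)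
      show "AE x in pair_pmf (replicate_pmf N noise) (replicate_pmf K noise).
        (x \<in> (\<lambda>(es, fs). es @ fs) -` {l. queue_outs (foldl queue_step 0 (take N l)) (drop N l) \<in> G}) =
        (x \<in> {(es, fs). queue_outs (foldl queue_step 0 es) fs \<in> G})"
        by (auto simp: AE_measure_pmf_iff set_replicate_pmf)
    qed auto
    finally show ?thesis .
  qed
  hence "(\<lambda>N. prob (EN N)) \<longlonglongrightarrow> measure_pmf.prob (replicate_pmf K (pair_pmf arr srv)) G"
    using late_start_outs[of K G] by simp
  moreover have "(\<lambda>N. prob (EN N)) \<longlonglongrightarrow> prob E"
  proof (rule tendsto_prob_AE[OF EN E])
    show "AE \<omega> in iid noise. \<forall>\<^sub>F N in sequentially. (\<omega> \<in> EN N) = (\<omega> \<in> E)"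
      using AE_settled[of a]
    proof eventually_elim
      case (elim \<omega>)
      then obtain x where x: "settled \<omega> a x" by blast
      have "\<omega> \<in> E \<longleftrightarrow> queue_outs x (window \<omega> a K) \<in> G"
        by (auto simp: E_def cylinder_def G_def settled_outs[OF x])
      moreover have "\<forall>\<^sub>F N in sequentially. late_queue \<omega> a N = x" using x by (simp add: settled_def)
      ultimately show ?case unfolding EN_def by (auto elim!: eventually_mono)
    qed
  qed
  ultimately have "prob E = measure_pmf.prob (replicate_pmf K (pair_pmf arr srv)) G"
    using LIMSEQ_unique by blast
  hence "emeasure (iid noise) E = emeasure (replicate_pmf K (pair_pmf arr srv)) G"
    by (simp add: emeasure_eq_measure measure_pmf.emeasure_eq_measure)
  thus "emeasure (distr (iid noise) (proc_space \<Otimes>\<^sub>M proc_space) (\<lambda>\<omega>. (dep_of \<omega>, rev_of \<omega>))) (cylinder a K B C)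
     = emeasure (bergeom_seq p \<alpha> \<Otimes>\<^sub>M bergeom_seq q \<beta>) (cylinder a K B C)"
    unfolding emeasure_bergeom_pair_list[OF BC] G_def[symmetric]
    using cyl dr by (simp add: emeasure_distr E_def vimage_def)
next
  show "prob_space (distr (iid noise) (proc_space \<Otimes>\<^sub>M proc_space) (\<lambda>\<omega>. (dep_of \<omega>, rev_of \<omega>)))"
    by (intro prob_space.prob_space_distr prob_space_iid) measurable
qed (simp_all add: sets_bergeom_pair)

end

lemma bg_params_eq:
  assumes "0 < q" "q \<le> 1" "0 < \<beta>" "\<beta> \<le> 1"
  shows "bg_params (bg_c q \<beta>) (q / \<beta>) = (q, \<beta>)"
proof -
  have "0 < bg_c q \<beta>" using assms by (auto simp: bg_c_def)
  moreover have "0 < q / \<beta>" using assms by simp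
  ultimately show ?thesis unfolding bg_params_def
    using assms by (intro the1_equality[OF bg_params_ex1]) auto
qed

lemma bg_params_unique:
  assumes "0 < p" "p \<le> 1" "0 < \<alpha>" "\<alpha> \<le> 1" "0 < q" "q \<le> 1" "0 < \<beta>" "\<beta> \<le> 1"
    and "p / \<alpha> = q / \<beta>" "bg_c p \<alpha> = bg_c q \<beta>"
  shows "p = q" "\<alpha> = \<beta>"
proof -
  have "(p, \<alpha>) = bg_params (bg_c p \<alpha>) (p / \<alpha>)"
    by (rule bg_params_eq[symmetric]) fact+
  also have "\<dots> = bg_params (bg_c q \<beta>) (q / \<beta>)" by (simp only: assms(9,10))
  also have "\<dots> = (q, \<beta>)" by (rule bg_params_eq) fact+
  finally show "p = q" "\<alpha> = \<beta>" by auto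
qed

section \<open>Critical load, and the reversed service in both regimes\<close>

context bergeom_pair
begin

text \<open>If the queue is nonempty after a slot, the server has used its full service in that
  slot. In the deterministic case every slot has one arrival and one service.\<close>

lemma AE_critical:
  assumes load: "p / \<alpha> = q / \<beta>"
  shows "AE \<omega> in iid noise. dep_of \<omega> = srv_of \<omega>"
proof (cases "q = 1 \<and> \<beta> = 1")
  case True
  have pa: "p = 1" "\<alpha> = 1" using bg_params_unique[OF p \<alpha> q \<beta> load c_eq] True by auto
  have one: "k = 1" if "k \<in> set_pmf (bergeom_pmf 1 1)" for k :: nat
    using that by (auto simp: set_pmf_iff pmf_bergeom_pmf power_0_left split: if_splits)
  have "AE \<omega> in iid noise. \<omega> n \<in> set_pmf noise" for n
  proof -
    interpret product_prob_space "\<lambda>_. measure_pmf noise" "UNIV :: int set" by unfold_locales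
    show ?thesis unfolding iid_def by (rule AE_component) (auto simp: AE_measure_pmf)
  qed
  hence "AE \<omega> in iid noise. \<forall>n. \<omega> n \<in> set_pmf noise" by (simp add: AE_all_countable)
  thus ?thesis
  proof eventually_elim
    case (elim \<omega>)
    have 1: "arr_of \<omega> n = 1" "srv_of \<omega> n = 1" for n
    proof -
      have "fst (\<omega> n) \<in> set_pmf arr" "fst (snd (\<omega> n)) \<in> set_pmf srv"
        using elim[rule_format, of n] by (auto simp: noise_def)
      thus "arr_of \<omega> n = 1" "srv_of \<omega> n = 1"
        using one[of "fst (\<omega> n)"] one[of "fst (snd (\<omega> n))"] True pa
        by (simp_all add: arr_of_def srv_of_def)
    qed
    show ?case
    proof
      fix n
      have "ereal (dep_of \<omega> n) = min (queue_of \<omega> n + 1) 1"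
        by (simp add: ereal_departure 1 one_ereal_def)
      also have "\<dots> = 1" using queue_length_nonneg[of "arr_of \<omega>" "srv_of \<omega>" n]
        add_right_mono[of 0 "queue_of \<omega> n" 1] by (intro min_absorb2) simp
      finally show "dep_of \<omega> n = srv_of \<omega> n" by (simp add: 1 one_ereal_def)
    qed
  qed
next
  case False
  interpret prob_space "iid noise" by (rule prob_space_iid)
  \<comment> \<open>A queue that is empty at \<open>n\<close> was also empty there for every late
    start, so this probability is a lower bound \<open>g\<close> uniform in the length of the
    run.\<close>
  have prob0: "prob {\<omega>. queue_of \<omega> n = 0} = 0" for n
  proof (rule critical_never_empty[OF load False])
    fix N
    have "{\<omega>. queue_of \<omega> n = 0} \<subseteq> {\<omega>. late_queue \<omega> n N = 0}"
    proof safe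
      fix \<omega> assume "queue_of \<omega> n = 0"
      hence "ereal (real (late_queue \<omega> n N)) \<le> 0" unfolding queue_of_SUP by (metis SUP_upper UNIV_I)
      thus "late_queue \<omega> n N = 0" by simp
    qed
    moreover have "{\<omega> \<in> space (iid noise). late_queue \<omega> n N = 0} \<in> events" by measurable
    ultimately have "prob {\<omega>. queue_of \<omega> n = 0} \<le> prob {\<omega>. late_queue \<omega> n N = 0}"
      by (intro finite_measure_mono) auto
    thus "prob {\<omega>. queue_of \<omega> n = 0} \<le> measure_pmf.prob (replicate_pmf N noise) {es. foldl queue_step 0 es = 0}"
      using measure_late_queue[of noise "\<lambda>x. x = 0" n N] by simp
  qed simp
  have "AE \<omega> in iid noise. queue_of \<omega> n \<noteq> 0" for n
  proof -
    have "{\<omega> \<in> space (iid noise). queue_of \<omega> n = 0} \<in> events" by measurable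
    thus ?thesis using prob_Collect_eq_0[of "\<lambda>\<omega>. queue_of \<omega> n = 0"] prob0[of n] by simp
  qed
  hence "AE \<omega> in iid noise. \<forall>n. queue_of \<omega> n \<noteq> 0" by (simp add: AE_all_countable)
  thus ?thesis
  proof eventually_elim
    case (elim \<omega>)
    show ?case
    proof (cases "queue_of \<omega> 0 = \<infinity>")
      case True
      thus ?thesis using queue_of_infinite_all[OF True] by (auto simp: departure_def)
    next
      case False
      then obtain X where X: "queue_solution (arr_of \<omega>) (srv_of \<omega>) X"
        using finite_queue_settled settled_solution by blast
      show ?thesis
      proof
        fix n
        have "X (n + 1) \<noteq> 0"
          using elim[rule_format, of "n + 1"] by (simp add: queue_length_solution[OF X] zero_ereal_def)
        thus "dep_of \<omega> n = srv_of \<omega> n"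
          by (simp add: departure_solution[OF X] queue_solution_step[OF X] max_def split: if_splits)
      qed
    qed
  qed
qed

theorem ex_reversed_service:
  assumes load: "p / \<alpha> \<le> q / \<beta>"
  obtains R where "R \<in> measurable (iid noise) proc_space" "\<And>\<omega> n. arr_of \<omega> n \<le> R \<omega> n"
    "\<And>\<omega> n. 0 < queue_of \<omega> n \<Longrightarrow> R \<omega> n = arr_of \<omega> n"
    "distr (iid noise) (proc_space \<Otimes>\<^sub>M proc_space) (\<lambda>\<omega>. (dep_of \<omega>, R \<omega>)) =
       bergeom_seq p \<alpha> \<Otimes>\<^sub>M bergeom_seq q \<beta>"
proof (cases "p / \<alpha> < q / \<beta>")
  case True
  then interpret bergeom_stable p \<alpha> q \<beta> by unfold_locales
  show ?thesis
    by (rule that[of rev_of]) (auto simp: rev_of_def distr_dep_rev)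
next
  case False
  hence eq: "p / \<alpha> = q / \<beta>" using load by simp
  \<comment> \<open>Equal load and equal \<open>c\<close> determine the parameters. Arrivals and
    services are then exchangeable, which gives the required joint law of
    \<open>(dep_of \<omega>, arr_of \<omega>)\<close>.\<close>
  have pq: "p = q" "\<alpha> = \<beta>" using bg_params_unique[OF p \<alpha> q \<beta> eq c_eq] by auto
  interpret prob_space "bergeom_seq q \<beta>" by (rule prob_space_bergeom_seq)
  interpret pair_sigma_finite "bergeom_seq q \<beta>" "bergeom_seq q \<beta>" ..
  have swap: "(\<lambda>(x, y). (y, x)) \<in> measurable (proc_space \<Otimes>\<^sub>M proc_space) (proc_space \<Otimes>\<^sub>M proc_space)"
    by measurable
  have "distr (iid noise) (proc_space \<Otimes>\<^sub>M proc_space) (\<lambda>\<omega>. (dep_of \<omega>, arr_of \<omega>)) =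
     distr (iid noise) (proc_space \<Otimes>\<^sub>M proc_space) (\<lambda>\<omega>. (srv_of \<omega>, arr_of \<omega>))"
    using AE_critical[OF eq] by (intro distr_cong_AE) auto
  also have "\<dots> = distr (distr (iid noise) (proc_space \<Otimes>\<^sub>M proc_space) (\<lambda>\<omega>. (arr_of \<omega>, srv_of \<omega>)))
      (proc_space \<Otimes>\<^sub>M proc_space) (\<lambda>(x, y). (y, x))"
    by (subst distr_distr[OF swap]) (auto simp: o_def)
  also have "\<dots> = distr (bergeom_seq q \<beta> \<Otimes>\<^sub>M bergeom_seq q \<beta>) (bergeom_seq q \<beta> \<Otimes>\<^sub>M bergeom_seq q \<beta>) (\<lambda>(x, y). (y, x))"
    unfolding distr_arr_srv unfolding pq by (intro distr_cong refl sets_pair_measure_cong sets_bergeom_seq[symmetric])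
  also have "\<dots> = bergeom_seq p \<alpha> \<Otimes>\<^sub>M bergeom_seq q \<beta>"
    unfolding pq by (rule distr_pair_swap[symmetric])
  finally show ?thesis by (intro that[of arr_of]) auto
qed

end

section \<open>Multi-type processes\<close>

lemma distr_pair_left:
  assumes "f \<in> measurable M S" "prob_space N"
  shows "distr M S f \<Otimes>\<^sub>M N = distr (M \<Otimes>\<^sub>M N) (S \<Otimes>\<^sub>M N) (\<lambda>(x, y). (f x, y))"
proof -
  have "sigma_finite_measure (distr N N (\<lambda>x. x))"
    using assms(2) by (simp add: prob_space_imp_sigma_finite)
  from pair_measure_distr[OF assms(1) measurable_ident this[folded id_def]] show ?thesis
    by (simp add: id_def)
qed

text \<open>Lets two servers independent of \<open>A\<close> be realised as functions of one noise
  \<open>w\<close>, so that both tandems can be compared path by path.\<close>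

lemma distr_pair_triple:
  fixes G :: "'a measure" and W :: "'b measure" and P :: "'c measure" and Q :: "'d measure"
  assumes G: "prob_space G" and W: "prob_space W" and P: "prob_space P" and Q: "prob_space Q"
    and X: "X \<in> measurable W P" and Y: "Y \<in> measurable W Q"
    and indep: "\<And>U V. U \<in> sets P \<Longrightarrow> V \<in> sets Q \<Longrightarrow>
      emeasure W {w \<in> space W. X w \<in> U \<and> Y w \<in> V} = emeasure P U * emeasure Q V"
  shows "distr (G \<Otimes>\<^sub>M W) ((G \<Otimes>\<^sub>M P) \<Otimes>\<^sub>M Q) (\<lambda>(a, w). ((a, X w), Y w)) = (G \<Otimes>\<^sub>M P) \<Otimes>\<^sub>M Q"
proof (rule pair_measure_eqI[symmetric])
  interpret G: prob_space G by fact
  interpret W: prob_space W by fact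
  interpret P: prob_space P by fact
  interpret Q: prob_space Q by fact
  note [measurable] = X Y
  show "sigma_finite_measure (G \<Otimes>\<^sub>M P)"
    by (intro prob_space_imp_sigma_finite prob_space_pair G P)
  show "sigma_finite_measure Q" by (intro prob_space_imp_sigma_finite Q)
  fix U V assume U: "U \<in> sets (G \<Otimes>\<^sub>M P)" and V: "V \<in> sets Q"
  define f where "f = (\<lambda>(a :: 'a, w). ((a, X w), Y w))"
  have f: "f \<in> measurable (G \<Otimes>\<^sub>M W) ((G \<Otimes>\<^sub>M P) \<Otimes>\<^sub>M Q)"
    unfolding f_def by measurable
  define E where "E = f -` (U \<times> V) \<inter> space (G \<Otimes>\<^sub>M W)"
  have UV: "U \<times> V \<in> sets ((G \<Otimes>\<^sub>M P) \<Otimes>\<^sub>M Q)" using U V by simp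
  have E: "E \<in> sets (G \<Otimes>\<^sub>M W)"
    unfolding E_def by (rule measurable_sets[OF f UV])
  have "emeasure (distr (G \<Otimes>\<^sub>M W) ((G \<Otimes>\<^sub>M P) \<Otimes>\<^sub>M Q) f) (U \<times> V) = emeasure (G \<Otimes>\<^sub>M W) E"
    unfolding E_def by (rule emeasure_distr[OF f UV])
  also have "\<dots> = (\<integral>\<^sup>+a. emeasure W (Pair a -` E) \<partial>G)"
    by (rule W.emeasure_pair_measure_alt[OF E])
  also have "\<dots> = (\<integral>\<^sup>+a. emeasure P (Pair a -` U) * emeasure Q V \<partial>G)"
  proof (rule nn_integral_cong)
    fix a assume a: "a \<in> space G"
    have "Pair a -` E = {w \<in> space W. X w \<in> Pair a -` U \<and> Y w \<in> V}"
      using a by (auto simp: E_def f_def space_pair_measure)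
    thus "emeasure W (Pair a -` E) = emeasure P (Pair a -` U) * emeasure Q V"
      using indep[OF sets_Pair1[OF U] V] by simp
  qed
  also have "\<dots> = emeasure (G \<Otimes>\<^sub>M P) U * emeasure Q V"
    using U by (simp add: nn_integral_multc P.measurable_emeasure_Pair P.emeasure_pair_measure_alt)
  finally show "emeasure (G \<Otimes>\<^sub>M P) U * emeasure Q V =
      emeasure (distr (G \<Otimes>\<^sub>M W) ((G \<Otimes>\<^sub>M P) \<Otimes>\<^sub>M Q) (\<lambda>(a, w). ((a, X w), Y w))) (U \<times> V)"
    by (simp add: f_def)
qed simp

definition class_step :: "nat \<Rightarrow> (nat \<Rightarrow> int \<Rightarrow> real) \<Rightarrow> (int \<Rightarrow> real) \<Rightarrow> nat \<Rightarrow> int \<Rightarrow> real" where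
  "class_step k A S = (mdeparture k A S)(Suc k := munused k A S)"

lemma F_Suc_Suc:
  assumes "bg_params c (\<Sum>i=1..Suc (Suc k). lam i) = (p, \<alpha>)"
  shows "F (Suc (Suc k)) c lam =
    distr (F (Suc k) c lam \<Otimes>\<^sub>M bergeom_seq p \<alpha>) (mproc_space (Suc (Suc k))) (\<lambda>(A, S). class_step (Suc k) A S)"
  using assms by (simp add: class_step_def numeral_2_eq_2)

lemma upto_class_telescope:
  assumes "\<And>i n. 1 \<le> i \<Longrightarrow> i \<le> r \<Longrightarrow> B i n = departure_upto A S i n - departure_upto A S (i - 1) n"
  shows "upto_class B r n = departure_upto A S r n"
  using assms
proof (induction r)
  case (Suc r)
  thus ?case by (simp add: upto_class_def)
qed (simp add: upto_class_def departure_upto_def)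

lemma upto_class_mdeparture:
  "r \<le> k \<Longrightarrow> upto_class (mdeparture k A S) r = departure_upto A S r"
  by (rule ext, rule upto_class_telescope) (auto simp: mdeparture_def)

lemma upto_class_class_step:
  "r \<le> k \<Longrightarrow> upto_class (class_step k A S) r = departure_upto A S r"
  by (rule ext, rule upto_class_telescope) (auto simp: mdeparture_def class_step_def)

lemma upto_class_class_step_top: "upto_class (class_step k A S) (Suc k) = S"
proof
  fix n
  have "upto_class (class_step k A S) (Suc k) n = upto_class (class_step k A S) k n + munused k A S n"
    by (simp add: upto_class_def class_step_def)
  thus "upto_class (class_step k A S) (Suc k) n = S n"
    by (simp add: upto_class_class_step munused_def)
qed

text \<open>For \<open>r \<le> k\<close> the interchange identity is applied to
  \<open>upto_class A r\<close>; up to class \<open>Suc k\<close> both sides give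
  \<open>departure S T\<close>. Differences of these recover the classes, and outside
  \<open>{1..Suc k}\<close> both sides are \<open>undefined\<close>.\<close>

lemma mdeparture_class_step:
  assumes inter: "\<And>B n. departure (departure B S) T n = departure (departure B R) (departure S T) n"
  shows "mdeparture (Suc k) (class_step k A S) T = class_step k (mdeparture k A R) (departure S T)"
proof -
  have low: "departure_upto (class_step k A S) T r n = departure_upto (mdeparture k A R) (departure S T) r n"
    if "r \<le> k" for r n
  proof (cases "r = 0")
    case False
    hence "departure_upto A U r = departure (upto_class A r) U" for U
      by (auto simp: departure_upto_def)
    thus ?thesis using that False inter
      by (simp add: departure_upto_def[of "class_step k A S"] departure_upto_def[of "mdeparture k A R"]
          upto_class_class_step upto_class_mdeparture)
  qed (simp add: departure_upto_def)
  have top: "departure_upto (class_step k A S) T (Suc k) n = departure S T n" for n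
    by (simp add: departure_upto_def upto_class_class_step_top)
  show ?thesis
  proof (intro ext)
    fix r n
    consider "1 \<le> r" "r \<le> k" | "r = Suc k" | "r = 0 \<or> Suc k < r" by linarith
    thus "mdeparture (Suc k) (class_step k A S) T r n = class_step k (mdeparture k A R) (departure S T) r n"
    proof cases
      case 1
      thus ?thesis by (simp add: mdeparture_def[of "Suc k"] class_step_def[of k "mdeparture k A R"]
            mdeparture_def[of k "mdeparture k A R"] low)
    next
      case 2
      thus ?thesis by (simp add: mdeparture_def[of "Suc k"] class_step_def[of k "mdeparture k A R"]
            munused_def low top)
    next
      case 3
      thus ?thesis by (auto simp: mdeparture_def[of "Suc k"] class_step_def[of k "mdeparture k A R"]
            mdeparture_def[of k "mdeparture k A R"])
    qed
  qed
qed

lemma measurable_mdeparture_pair: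
  "(\<lambda>(A, S). mdeparture k A S) \<in> measurable (mproc_space k \<Otimes>\<^sub>M proc_space) (mproc_space k)"
  using measurable_mdeparture[of fst "mproc_space k \<Otimes>\<^sub>M proc_space" k snd] by (simp add: split_beta')

lemma measurable_class_step_pair:
  "(\<lambda>(A, S). class_step k A S) \<in> measurable (mproc_space k \<Otimes>\<^sub>M proc_space) (mproc_space (Suc k))"
  using measurable_F_step[of k] by (simp add: class_step_def)

lemma bg_params_props:
  assumes "0 < c" "0 < l" "bg_params c l = (p, \<alpha>)"
  shows "0 < p" "p \<le> 1" "0 < \<alpha>" "\<alpha> \<le> 1" "p / \<alpha> = l" "bg_c p \<alpha> = c"
  using theI'[OF bg_params_ex1[OF assms(1,2)], folded bg_params_def] assms(3) by simp_all

lemma F_fixed_point: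
  assumes q: "0 < q" "q \<le> 1" and \<beta>: "0 < \<beta>" "\<beta> \<le> 1" and c: "c = bg_c q \<beta>"
    and lam: "\<And>r. 1 \<le> r \<Longrightarrow> r \<le> Suc k \<Longrightarrow> 0 < lam r"
    and load: "(\<Sum>r=1..Suc k. lam r) \<le> q / \<beta>"
  shows "distr (F (Suc k) c lam \<Otimes>\<^sub>M bergeom_seq q \<beta>) (mproc_space (Suc k)) (\<lambda>(A, S). mdeparture (Suc k) A S)
     = F (Suc k) c lam"
  using lam load
proof (induction k)
  case 0
  obtain p \<alpha> where pa: "bg_params c (lam 1) = (p, \<alpha>)" by force
  have "0 < c" using q \<beta> c by (auto simp: bg_c_def)
  from bg_params_props[OF this _ pa] 0(1)[of 1]
  have pp: "0 < p" "p \<le> 1" "0 < \<alpha>" "\<alpha> \<le> 1" "p / \<alpha> = lam 1" "bg_c p \<alpha> = bg_c q \<beta>" by (auto simp: c)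
  interpret bergeom_pair p \<alpha> q \<beta> using pp q \<beta> by unfold_locales auto
  have "p / \<alpha> \<le> q / \<beta>" using 0(2) pp(5) by simp
  then obtain R where R: "R \<in> measurable (iid noise) proc_space"
    "distr (iid noise) (proc_space \<Otimes>\<^sub>M proc_space) (\<lambda>\<omega>. (dep_of \<omega>, R \<omega>)) = bergeom_seq p \<alpha> \<Otimes>\<^sub>M bergeom_seq q \<beta>"
    by (rule ex_reversed_service)
  interpret S: prob_space "bergeom_seq q \<beta>" by (rule prob_space_bergeom_seq)
  define one where "one Y = (\<lambda>r\<in>{1..1::nat}. Y)" for Y :: "int \<Rightarrow> real"
  have one: "one \<in> measurable proc_space (mproc_space 1)"
    unfolding one_def mproc_space_def by (intro measurable_restrict) measurable
  have F1: "F (Suc 0) c lam = distr (bergeom_seq p \<alpha>) (mproc_space 1) one"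
    using pa by (simp add: one_def[abs_def])
  have mdep: "mdeparture 1 (one Y) T = one (departure Y T)" for Y T
    by (auto simp: mdeparture_def one_def fun_eq_iff departure_upto_def upto_class_def[abs_def])
  have one': "one \<in> measurable (bergeom_seq p \<alpha>) (mproc_space 1)"
    using one by (simp cong: measurable_cong_sets add: sets_bergeom_seq)
  have m1: "(\<lambda>(A, T). mdeparture 1 A T) \<in> measurable (mproc_space 1 \<Otimes>\<^sub>M bergeom_seq q \<beta>) (mproc_space 1)"
    using measurable_mdeparture_pair[of 1] by (simp cong: measurable_cong_sets sets_pair_measure_cong add: sets_bergeom_seq)
  have m2: "(\<lambda>(Y, T). (one Y, T)) \<in> measurable (bergeom_seq p \<alpha> \<Otimes>\<^sub>M bergeom_seq q \<beta>) (mproc_space 1 \<Otimes>\<^sub>M bergeom_seq q \<beta>)"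
    using one' by measurable
  have m3: "(\<lambda>(Y, T). mdeparture 1 (one Y) T) \<in> measurable (proc_space \<Otimes>\<^sub>M proc_space) (mproc_space 1)"
    using measurable_compose[OF m2 m1] by (simp add: split_beta' sets_bergeom_pair cong: measurable_cong_sets)
  have m4: "(\<lambda>\<omega>. (arr_of \<omega>, srv_of \<omega>)) \<in> measurable (iid noise) (proc_space \<Otimes>\<^sub>M proc_space)"
    by measurable
  have m5: "(\<lambda>\<omega>. (dep_of \<omega>, R \<omega>)) \<in> measurable (iid noise) (proc_space \<Otimes>\<^sub>M proc_space)"
    using R(1) by measurable
  have m6: "(\<lambda>x. one (fst x)) \<in> measurable (proc_space \<Otimes>\<^sub>M proc_space) (mproc_space 1)"
    using one by measurable
  \<comment> \<open>For one class the claim is Burke's theorem: the first component of the pair in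
    \<open>R(2)\<close> has the law of the arrivals.\<close>
  have "distr (F (Suc 0) c lam \<Otimes>\<^sub>M bergeom_seq q \<beta>) (mproc_space 1) (\<lambda>(A, T). mdeparture 1 A T) =
     distr (bergeom_seq p \<alpha> \<Otimes>\<^sub>M bergeom_seq q \<beta>) (mproc_space 1) (\<lambda>(Y, T). mdeparture 1 (one Y) T)"
    unfolding F1 distr_pair_left[OF one' prob_space_bergeom_seq]
    by (subst distr_distr[OF m1 m2]) (simp add: o_def split_beta')
  also have "\<dots> = distr (iid noise) (mproc_space 1) (\<lambda>\<omega>. one (dep_of \<omega>))"
    unfolding distr_arr_srv[symmetric] by (subst distr_distr[OF m3 m4]) (simp only: o_def case_prod_conv mdep)
  also have "\<dots> = distr (bergeom_seq p \<alpha> \<Otimes>\<^sub>M bergeom_seq q \<beta>) (mproc_space 1) (\<lambda>x. one (fst x))"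
    unfolding R(2)[symmetric] by (subst distr_distr[OF m6 m5]) (simp add: o_def)
  also have "\<dots> = distr (distr (bergeom_seq p \<alpha> \<Otimes>\<^sub>M bergeom_seq q \<beta>) (bergeom_seq p \<alpha>) fst) (mproc_space 1) one"
    by (subst distr_distr[OF one' measurable_fst]) (simp add: o_def)
  also have "\<dots> = F (Suc 0) c lam"
    unfolding S.distr_pair_fst F1 ..
  finally show ?case by simp
next
  case (Suc k)
  define l where "l = (\<Sum>i=1..Suc (Suc k). lam i)"
  have l: "0 < l" unfolding l_def using Suc.prems(1) by (intro sum_pos) auto
  \<comment> \<open>The parameters of the server that creates the lowest class. Its services play
    the arrivals for the server with parameters \<open>q\<close> and \<open>\<beta>\<close>.\<close>
  obtain p \<alpha> where pa: "bg_params c l = (p, \<alpha>)" by force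
  have "0 < c" using q \<beta> c by (auto simp: bg_c_def)
  from bg_params_props[OF this l pa]
  have pp: "0 < p" "p \<le> 1" "0 < \<alpha>" "\<alpha> \<le> 1" "p / \<alpha> = l" "bg_c p \<alpha> = bg_c q \<beta>" by (auto simp: c)
  interpret bergeom_pair p \<alpha> q \<beta> using pp q \<beta> by unfold_locales auto
  have "p / \<alpha> \<le> q / \<beta>" using Suc.prems(2) pp(5) by (simp add: l_def)
  then obtain R where R: "R \<in> measurable (iid noise) proc_space" "\<And>\<omega> n. arr_of \<omega> n \<le> R \<omega> n"
    "\<And>\<omega> n. 0 < queue_of \<omega> n \<Longrightarrow> R \<omega> n = arr_of \<omega> n"
    "distr (iid noise) (proc_space \<Otimes>\<^sub>M proc_space) (\<lambda>\<omega>. (dep_of \<omega>, R \<omega>)) = bergeom_seq p \<alpha> \<Otimes>\<^sub>M bergeom_seq q \<beta>"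
    using ex_reversed_service by blast
  have "0 < lam (Suc (Suc k))" using Suc.prems(1)[of "Suc (Suc k)"] by simp
  hence load': "(\<Sum>r=1..Suc k. lam r) \<le> q / \<beta>" using Suc.prems(2) by simp
  \<comment> \<open>\<open>R\<close> has the same law as the given server, so the higher classes can
    use the induction hypothesis with unchanged \<open>q\<close> and \<open>\<beta>\<close>.\<close>
  have IH: "distr (F (Suc k) c lam \<Otimes>\<^sub>M bergeom_seq q \<beta>) (mproc_space (Suc k)) (\<lambda>(A, S). mdeparture (Suc k) A S)
     = F (Suc k) c lam"
    by (rule Suc.IH[OF Suc.prems(1) load']) auto
  define G where "G = F (Suc k) c lam"
  let ?M = "mproc_space (Suc k)" and ?N = "mproc_space (Suc (Suc k))"
  let ?P = "bergeom_seq p \<alpha>" and ?Q = "bergeom_seq q \<beta>"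
  have prob: "prob_space G" "prob_space ?P" "prob_space ?Q" "prob_space (iid noise)"
    by (auto simp: G_def intro: prob_space_F prob_space_bergeom_seq prob_space_iid)
  interpret P: prob_space ?P by fact
  interpret Q: prob_space ?Q by fact
  have [measurable_cong]: "sets G = sets ?M" unfolding G_def by (rule sets_F)
  note [measurable] = R(1)
  have cs: "(\<lambda>(A, S). class_step (Suc k) A S) \<in> measurable (G \<Otimes>\<^sub>M ?P) ?N"
    "(\<lambda>(A, S). class_step (Suc k) A S) \<in> measurable (?M \<Otimes>\<^sub>M ?P) ?N"
    using measurable_class_step_pair[of "Suc k"] by measurable
  have md: "(\<lambda>(A, S). mdeparture (Suc k) A S) \<in> measurable (G \<Otimes>\<^sub>M ?Q) ?M"
    using measurable_mdeparture_pair[of "Suc k"] by measurable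
  have md2: "(\<lambda>(A, S). mdeparture (Suc (Suc k)) A S) \<in> measurable (?N \<Otimes>\<^sub>M ?Q) ?N"
    using measurable_mdeparture_pair[of "Suc (Suc k)"] by measurable
  \<comment> \<open>\<open>f\<close> creates the lowest class and then serves; \<open>g\<close>
    serves the higher classes and then creates the lowest. \<open>path\<close> identifies them on
    the common noise.\<close>
  define f where "f = (\<lambda>(x, T). mdeparture (Suc (Suc k)) ((\<lambda>(A, S). class_step (Suc k) A S) x) T)"
  define g where "g = (\<lambda>(x, D). class_step (Suc k) ((\<lambda>(A, S). mdeparture (Suc k) A S) x) D)"
  have fm: "(\<lambda>(x, y). ((\<lambda>(A, S). class_step (Suc k) A S) x, y)) \<in> measurable ((G \<Otimes>\<^sub>M ?P) \<Otimes>\<^sub>M ?Q) (?N \<Otimes>\<^sub>M ?Q)"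
    using cs(1) by measurable
  have gm: "(\<lambda>(x, y). ((\<lambda>(A, S). mdeparture (Suc k) A S) x, y)) \<in> measurable ((G \<Otimes>\<^sub>M ?Q) \<Otimes>\<^sub>M ?P) (?M \<Otimes>\<^sub>M ?P)"
    using md by measurable
  have f: "f \<in> measurable ((G \<Otimes>\<^sub>M ?P) \<Otimes>\<^sub>M ?Q) ?N"
    using measurable_compose[OF fm md2] by (simp add: f_def split_beta')
  have g: "g \<in> measurable ((G \<Otimes>\<^sub>M ?Q) \<Otimes>\<^sub>M ?P) ?N"
    using measurable_compose[OF gm cs(2)] by (simp add: g_def split_beta')
  have FN: "F (Suc (Suc k)) c lam = distr (G \<Otimes>\<^sub>M ?P) ?N (\<lambda>(A, S). class_step (Suc k) A S)"
    unfolding G_def by (rule F_Suc_Suc) (use pa in \<open>simp only: l_def\<close>)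
  have ind1: "emeasure (iid noise) {\<omega> \<in> space (iid noise). arr_of \<omega> \<in> U \<and> srv_of \<omega> \<in> V} = emeasure ?P U * emeasure ?Q V"
    if "U \<in> sets ?P" "V \<in> sets ?Q" for U V
  proof -
    have "emeasure ?P U * emeasure ?Q V = emeasure (?P \<Otimes>\<^sub>M ?Q) (U \<times> V)"
      using that by (simp add: Q.emeasure_pair_measure_Times)
    also have "\<dots> = emeasure (iid noise) {\<omega> \<in> space (iid noise). arr_of \<omega> \<in> U \<and> srv_of \<omega> \<in> V}"
      unfolding distr_arr_srv[symmetric] using that
      by (subst emeasure_distr) (auto simp: sets_bergeom_seq intro!: arg_cong[where f = "emeasure _"])
    finally show ?thesis ..
  qed
  have ind2: "emeasure (iid noise) {\<omega> \<in> space (iid noise). R \<omega> \<in> U \<and> dep_of \<omega> \<in> V} = emeasure ?Q U * emeasure ?P V"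
    if "U \<in> sets ?Q" "V \<in> sets ?P" for U V
  proof -
    have "emeasure ?Q U * emeasure ?P V = emeasure (?P \<Otimes>\<^sub>M ?Q) (V \<times> U)"
      using that by (simp add: Q.emeasure_pair_measure_Times mult.commute)
    also have "\<dots> = emeasure (iid noise) {\<omega> \<in> space (iid noise). R \<omega> \<in> U \<and> dep_of \<omega> \<in> V}"
      unfolding R(4)[symmetric] using that
      by (subst emeasure_distr) (auto simp: sets_bergeom_seq intro!: arg_cong[where f = "emeasure _"])
    finally show ?thesis ..
  qed
  have meas: "arr_of \<in> measurable (iid noise) ?P" "srv_of \<in> measurable (iid noise) ?Q"
    "R \<in> measurable (iid noise) ?Q" "(\<lambda>\<omega>. dep_of \<omega>) \<in> measurable (iid noise) ?P"
    by measurable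
  have t1: "(\<lambda>(A, \<omega>). ((A, arr_of \<omega>), srv_of \<omega>)) \<in> measurable (G \<Otimes>\<^sub>M iid noise) ((G \<Otimes>\<^sub>M ?P) \<Otimes>\<^sub>M ?Q)"
    using meas by measurable
  have t2: "(\<lambda>(A, \<omega>). ((A, R \<omega>), dep_of \<omega>)) \<in> measurable (G \<Otimes>\<^sub>M iid noise) ((G \<Otimes>\<^sub>M ?Q) \<Otimes>\<^sub>M ?P)"
    using meas by measurable
  have path: "f ((A, arr_of \<omega>), srv_of \<omega>) = g ((A, R \<omega>), dep_of \<omega>)" for A \<omega>
    unfolding f_def g_def by (simp, rule mdeparture_class_step, rule queue_interchange[OF R(2,3)])
  have "distr (F (Suc (Suc k)) c lam \<Otimes>\<^sub>M ?Q) ?N (\<lambda>(A, S). mdeparture (Suc (Suc k)) A S) =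
     distr ((G \<Otimes>\<^sub>M ?P) \<Otimes>\<^sub>M ?Q) ?N f"
    unfolding FN distr_pair_left[OF cs(1) prob(3)]
    by (subst distr_distr[OF md2 fm]) (simp add: o_def split_beta' f_def)
  also have "\<dots> = distr (distr (G \<Otimes>\<^sub>M iid noise) ((G \<Otimes>\<^sub>M ?P) \<Otimes>\<^sub>M ?Q) (\<lambda>(A, \<omega>). ((A, arr_of \<omega>), srv_of \<omega>))) ?N f"
    using prob meas ind1 by (subst distr_pair_triple) auto
  also have "\<dots> = distr (G \<Otimes>\<^sub>M iid noise) ?N (\<lambda>(A, \<omega>). f ((A, arr_of \<omega>), srv_of \<omega>))"
    by (subst distr_distr[OF f t1]) (simp add: o_def split_beta')
  also have "\<dots> = distr (distr (G \<Otimes>\<^sub>M iid noise) ((G \<Otimes>\<^sub>M ?Q) \<Otimes>\<^sub>M ?P) (\<lambda>(A, \<omega>). ((A, R \<omega>), dep_of \<omega>))) ?N g"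
    unfolding path by (subst distr_distr[OF g t2]) (simp add: o_def split_beta')
  also have "\<dots> = distr ((G \<Otimes>\<^sub>M ?Q) \<Otimes>\<^sub>M ?P) ?N g"
    using prob meas ind2 by (subst distr_pair_triple) auto
  also have "\<dots> = distr (distr (G \<Otimes>\<^sub>M ?Q) ?M (\<lambda>(A, S). mdeparture (Suc k) A S) \<Otimes>\<^sub>M ?P) ?N (\<lambda>(A, S). class_step (Suc k) A S)"
    unfolding distr_pair_left[OF md prob(2)]
    by (subst distr_distr[OF cs(2) gm]) (simp add: o_def split_beta' g_def)
  also have "\<dots> = F (Suc (Suc k)) c lam"
    unfolding FN using IH by (simp add: G_def)
  finally show ?case .
qed

theorem theorem7p1:
  fixes M :: "'a measure"
    and A :: "'a \<Rightarrow> nat \<Rightarrow> int \<Rightarrow> real" and S :: "'a \<Rightarrow> int \<Rightarrow> real"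
    and m :: nat and q \<beta> \<mu> :: real and c :: ereal and lam :: "nat \<Rightarrow> real"
  assumes "prob_space M"
    and "1 \<le> m"
    and "0 < q" "q \<le> 1" "0 < \<beta>" "\<beta> \<le> 1"
    and "\<mu> = q / \<beta>" and "c = bg_c q \<beta>"
    and S_indep: "prob_space.indep_vars M (\<lambda>_. borel) (\<lambda>n \<omega>. S \<omega> n) UNIV"
    and S_distr: "\<And>n. distr M borel (\<lambda>\<omega>. S \<omega> n) = bergeom q \<beta>"
    and "\<And>r. r \<in> {1..m} \<Longrightarrow> 0 < lam r"
    and "(\<Sum>r=1..m. lam r) \<le> \<mu>"
    and A_distr: "distr M (mproc_space m) A = F m c lam"
    and A_S_indep: "indep_elements M (mproc_space m) A proc_space S"
  shows "distr M (mproc_space m) (\<lambda>\<omega>. mdeparture m (A \<omega>) (S \<omega>)) = distr M (mproc_space m) A"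
proof -
  interpret prob_space M by fact
  obtain k where k: "m = Suc k" using assms(2) by (cases m) auto
  have A: "A \<in> measurable M (mproc_space m)" and S: "S \<in> measurable M proc_space"
    and ind: "indep_set (sigma_sets (space M) {A -` B \<inter> space M | B. B \<in> sets (mproc_space m)})
       (sigma_sets (space M) {S -` B \<inter> space M | B. B \<in> sets proc_space})"
    using A_S_indep by (auto simp: indep_elements_def)
  have rv: "random_variable borel (\<lambda>\<omega>. S \<omega> n)" for n
    using S by measurable
  have "distr M (PiM UNIV (\<lambda>_. borel)) (\<lambda>\<omega>. \<lambda>n\<in>UNIV. S \<omega> n) = PiM UNIV (\<lambda>n. distr M borel (\<lambda>\<omega>. S \<omega> n))"
    using S_indep rv by (subst (asm) indep_vars_iff_distr_eq_PiM) auto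
  hence S_law: "distr M proc_space S = bergeom_seq q \<beta>"
    by (simp add: S_distr bergeom_seq_def proc_space_def restrict_UNIV)
  \<comment> \<open>The law of the departures depends only on the joint law of
    \<open>(A, S)\<close>, which independence makes a product measure.\<close>
  have joint: "F m c lam \<Otimes>\<^sub>M bergeom_seq q \<beta> = distr M (mproc_space m \<Otimes>\<^sub>M proc_space) (\<lambda>\<omega>. (A \<omega>, S \<omega>))"
  proof (rule pair_measure_eqI)
    show "sigma_finite_measure (F m c lam)" "sigma_finite_measure (bergeom_seq q \<beta>)"
      unfolding k by (intro prob_space_imp_sigma_finite prob_space_F prob_space_bergeom_seq)+
    show "sets (F m c lam \<Otimes>\<^sub>M bergeom_seq q \<beta>) = sets (distr M (mproc_space m \<Otimes>\<^sub>M proc_space) (\<lambda>\<omega>. (A \<omega>, S \<omega>)))"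
      by (simp add: sets_F sets_bergeom_seq cong: sets_pair_measure_cong)
    fix U V assume "U \<in> sets (F m c lam)" "V \<in> sets (bergeom_seq q \<beta>)"
    hence U: "U \<in> sets (mproc_space m)" and V: "V \<in> sets proc_space"
      by (simp_all add: sets_F sets_bergeom_seq)
    have "prob ((A -` U \<inter> space M) \<inter> (S -` V \<inter> space M)) = prob (A -` U \<inter> space M) * prob (S -` V \<inter> space M)"
      using U V by (intro indep_setD[OF ind] sigma_sets.Basic) auto
    moreover have "(A -` U \<inter> space M) \<inter> (S -` V \<inter> space M) = (\<lambda>\<omega>. (A \<omega>, S \<omega>)) -` (U \<times> V) \<inter> space M" by auto
    ultimately show "emeasure (F m c lam) U * emeasure (bergeom_seq q \<beta>) V =
        emeasure (distr M (mproc_space m \<Otimes>\<^sub>M proc_space) (\<lambda>\<omega>. (A \<omega>, S \<omega>))) (U \<times> V)"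
      unfolding A_distr[symmetric] S_law[symmetric] using A S U V
      by (simp add: emeasure_distr emeasure_eq_measure ennreal_mult)
  qed
  have AS: "(\<lambda>\<omega>. (A \<omega>, S \<omega>)) \<in> measurable M (mproc_space m \<Otimes>\<^sub>M proc_space)"
    using A S by measurable
  have "distr M (mproc_space m) (\<lambda>\<omega>. mdeparture m (A \<omega>) (S \<omega>)) =
      distr (F m c lam \<Otimes>\<^sub>M bergeom_seq q \<beta>) (mproc_space m) (\<lambda>(A, S). mdeparture m A S)"
    unfolding joint by (subst distr_distr[OF measurable_mdeparture_pair AS]) (simp add: o_def)
  also have "\<dots> = F m c lam"
    unfolding k by (rule F_fixed_point) (use assms k in auto)
  finally show ?thesis by (simp add: A_distr)
qed

end
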